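(* Let $g\ge 0$ be an integer. (i) If $g\le 5$, then the gonality sequence of a graph of genus $g$ is determined by $g$ and its first gonality; that is, if $G$ and $G'$ are graphs, both of genus $g$, with $\mathrm{gon}_1(G)=\mathrm{gon}_1(G')$, then $\mathrm{gon}_r(G)=\mathrm{gon}_r(G')$ for all $r\ge 1$. (ii) If $g\geq 6$, then there exist graphs $G$ and $H$ of genus $g$ with $\mathrm{gon}_1(G)=\mathrm{gon}_1(H)$ such that $G$ and $H$ do not have the same gonality sequence.
   Context: All graphs are finite, connected, loopless multigraphs with nonempty vertex set $V(G)$ and multiset of edges $E(G)$. The genus of $G$ is $g(G)=|E(G)|-|V(G)|+1$. A divisor on $G$ is an element $D=\sum_v D(v)\cdot v$ of the free abelian group on $V(G)$; its degree is $\deg(D)=\sum_v D(v)$; it is effective if $D(v)\ge 0$ for all $v$. The Laplacian matrix has diagonal entries $\mathrm{val}(v)$ (number of edges incident to $v$) and off-diagonal entries $-|E(v,w)|$ (minus the number of edges between $v$ and $w$). Divisors $D,D'$ are linearly equivalent, $D\sim D'$, if $D-D'$ is in the image of $\mathbb{Z}^{V(G)}$ under the Laplacian. The rank $r(D)$ is $-1$ if $D$ is not equivalent to any effective divisor; otherwise it is the largest integer $r\ge 0$ such that for every effective divisor $E$ of degree $r$, $D-E$ is equivalent to an effective divisor. For an integer $r\ge 1$, the $r$-th gonality is $\mathrm{gon}_r(G)=\min\{\deg(D): D \text{ a divisor on } G,\ r(D)\ge r\}$. The gonality sequence of $G$ is $\mathrm{gon}_1(G),\mathrm{gon}_2(G),\mathrm{gon}_3(G),\ldots$.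 *)

theory Defs
  imports "HOL-Library.Multiset"
begin

record 'a mgraph =
  verts :: "'a set"
  edges :: "'a set multiset"

text \<open>An edge is recorded as the set of its two ends, parallel edges by multiplicity. Loops would
  be singletons and are excluded by \<open>card e = 2\<close>.\<close>

definition connected_mgraph :: "'a mgraph \<Rightarrow> bool" where
  "connected_mgraph G \<longleftrightarrow>
     (\<forall>u\<in>verts G. \<forall>v\<in>verts G. (u, v) \<in> {(x, y). {x, y} \<in># edges G}\<^sup>*)"

definition is_mgraph :: "'a mgraph \<Rightarrow> bool" where
  "is_mgraph G \<longleftrightarrow> finite (verts G) \<and> verts G \<noteq> {} \<and>
     (\<forall>e. e \<in># edges G \<longrightarrow> e \<subseteq> verts G \<and> card e = 2) \<and> connected_mgraph G"

definition genus :: "'a mgraph \<Rightarrow> int" where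
  "genus G = int (size (edges G)) - int (card (verts G)) + 1"

definition val :: "'a mgraph \<Rightarrow> 'a \<Rightarrow> nat" where
  "val G v = size {#e \<in># edges G. v \<in> e#}"

definition laplacian :: "'a mgraph \<Rightarrow> 'a \<Rightarrow> 'a \<Rightarrow> int" where
  "laplacian G v w = (if v = w then int (val G v) else - int (count (edges G) {v, w}))"

text \<open>The free abelian group on the finite set \<open>verts G\<close>, as integer functions that vanish
  outside \<open>verts G\<close>.\<close>

definition divisors :: "'a mgraph \<Rightarrow> ('a \<Rightarrow> int) set" where
  "divisors G = {D. \<forall>v. v \<notin> verts G \<longrightarrow> D v = 0}"

definition deg :: "'a mgraph \<Rightarrow> ('a \<Rightarrow> int) \<Rightarrow> int" where
  "deg G D = (\<Sum>v\<in>verts G. D v)"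

definition effective :: "'a mgraph \<Rightarrow> ('a \<Rightarrow> int) \<Rightarrow> bool" where
  "effective G D \<longleftrightarrow> D \<in> divisors G \<and> (\<forall>v\<in>verts G. D v \<ge> 0)"

definition lin_equiv :: "'a mgraph \<Rightarrow> ('a \<Rightarrow> int) \<Rightarrow> ('a \<Rightarrow> int) \<Rightarrow> bool" where
  "lin_equiv G D D' \<longleftrightarrow>
     (\<exists>f. \<forall>v\<in>verts G. D v - D' v = (\<Sum>w\<in>verts G. laplacian G v w * f w))"

definition equiv_effective :: "'a mgraph \<Rightarrow> ('a \<Rightarrow> int) \<Rightarrow> bool" where
  "equiv_effective G D \<longleftrightarrow> (\<exists>F. effective G F \<and> lin_equiv G D F)"

definition rank_ge :: "'a mgraph \<Rightarrow> ('a \<Rightarrow> int) \<Rightarrow> nat \<Rightarrow> bool" where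
  "rank_ge G D r \<longleftrightarrow>
     (\<forall>E. effective G E \<and> deg G E = int r \<longrightarrow> equiv_effective G (\<lambda>v. D v - E v))"

definition rank :: "'a mgraph \<Rightarrow> ('a \<Rightarrow> int) \<Rightarrow> int" where
  "rank G D = (if equiv_effective G D then int (GREATEST r. rank_ge G D r) else -1)"

definition gon :: "nat \<Rightarrow> 'a mgraph \<Rightarrow> int" where
  "gon r G = (LEAST d. \<exists>D\<in>divisors G. rank G D \<ge> int r \<and> deg G D = d)"

text \<open>The maximum and the minimum above are attained, so \<open>GREATEST\<close> and \<open>LEAST\<close> are meaningful.\<close>

lemma sum_laplacian_column:
  assumes "is_mgraph G" "w \<in> verts G"
  shows "(\<Sum>v\<in>verts G. laplacian G v w) = 0"
proof -
  let ?V = "verts G"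
  have fin: "finite ?V" using assms by (simp add: is_mgraph_def)
  have "size {#e \<in># M. w \<in> e#} = (\<Sum>v\<in>?V - {w}. count M {v, w})"
    if "\<forall>e. e \<in># M \<longrightarrow> e \<subseteq> ?V \<and> card e = 2" for M :: "'a set multiset"
    using that
  proof (induction M)
    case empty
    then show ?case by simp
  next
    case (add e M)
    have e: "e \<subseteq> ?V" "card e = 2" using add.prems by auto
    have split: "(\<Sum>v\<in>?V - {w}. count (add_mset e M) {v, w}) =
        (\<Sum>v\<in>?V - {w}. count M {v, w}) + (\<Sum>v\<in>?V - {w}. if {v, w} = e then 1 else 0)"
      unfolding sum.distrib[symmetric] by (intro sum.cong) auto
    have "(\<Sum>v\<in>?V - {w}. if {v, w} = e then 1 else 0 :: nat) = (if w \<in> e then 1 else 0)"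
    proof (cases "w \<in> e")
      case True
      then obtain u where u: "e = {u, w}" "u \<noteq> w"
        using e(2) by (auto simp: card_2_iff)
      then have "{v, w} = e \<longleftrightarrow> v = u" if "v \<noteq> w" for v
        using that by (auto simp: doubleton_eq_iff)
      then have "(\<Sum>v\<in>?V - {w}. if {v, w} = e then 1 else 0 :: nat) =
          (\<Sum>v\<in>?V - {w}. if v = u then 1 else 0)" by (intro sum.cong) auto
      also have "\<dots> = 1" using u e(1) fin by simp
      finally show ?thesis using True by simp
    next
      case False
      then have "{v, w} \<noteq> e" for v by blast
      with False show ?thesis by simp
    qed
    with split add show ?case by auto
  qed
  then have "int (val G w) = (\<Sum>v\<in>?V - {w}. int (count (edges G) {v, w}))"
    using assms by (simp add: val_def is_mgraph_def)
  then show ?thesis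
    using fin assms(2) by (simp add: sum.remove laplacian_def sum_negf)
qed

lemma deg_lin_equiv:
  assumes "is_mgraph G" "lin_equiv G D D'"
  shows "deg G D = deg G D'"
proof -
  obtain f where f: "\<forall>v\<in>verts G. D v - D' v = (\<Sum>w\<in>verts G. laplacian G v w * f w)"
    using assms(2) by (auto simp: lin_equiv_def)
  have "deg G D - deg G D' = (\<Sum>v\<in>verts G. \<Sum>w\<in>verts G. laplacian G v w * f w)"
    using f by (simp add: deg_def sum_subtractf[symmetric])
  also have "\<dots> = (\<Sum>w\<in>verts G. (\<Sum>v\<in>verts G. laplacian G v w) * f w)"
    by (subst sum.swap) (simp add: sum_distrib_right)
  also have "\<dots> = 0" using sum_laplacian_column[OF assms(1)] by simp
  finally show ?thesis by simp
qed

lemma deg_equiv_effective: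
  assumes "is_mgraph G" "equiv_effective G D"
  shows "deg G D \<ge> 0"
proof -
  obtain F where F: "effective G F" "lin_equiv G D F"
    using assms(2) by (auto simp: equiv_effective_def)
  have "deg G F \<ge> 0" using F(1) by (auto simp: deg_def effective_def intro: sum_nonneg)
  then show ?thesis using deg_lin_equiv[OF assms(1) F(2)] by simp
qed

lemma rank_ge_le_deg:
  assumes "is_mgraph G" "rank_ge G D r"
  shows "int r \<le> deg G D"
proof -
  obtain v where v: "v \<in> verts G" "finite (verts G)"
    using assms(1) by (auto simp: is_mgraph_def)
  let ?E = "\<lambda>u. if u = v then int r else 0"
  have "effective G ?E" "deg G ?E = int r"
    using v by (auto simp: effective_def divisors_def deg_def)
  then have "equiv_effective G (\<lambda>u. D u - ?E u)"
    using assms(2) unfolding rank_ge_def by blast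
  from deg_equiv_effective[OF assms(1) this] have "deg G D - deg G ?E \<ge> 0"
    by (simp only: deg_def sum_subtractf)
  with \<open>deg G ?E = int r\<close> show ?thesis by simp
qed

lemma rank_ge_0:
  assumes "is_mgraph G"
  shows "rank_ge G D 0 \<longleftrightarrow> equiv_effective G D"
proof -
  have fin: "finite (verts G)" using assms by (simp add: is_mgraph_def)
  have z: "E = (\<lambda>_. 0)" if "effective G E" "deg G E = 0" for E
  proof
    fix v show "E v = 0"
      using that fin by (cases "v \<in> verts G")
        (auto simp: effective_def divisors_def deg_def sum_nonneg_eq_0_iff)
  qed
  have "effective G (\<lambda>_. 0)" "deg G (\<lambda>_. 0) = 0"
    by (auto simp: effective_def divisors_def deg_def)
  with z show ?thesis unfolding rank_ge_def by fastforce
qed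

lemma rank_attained:
  assumes "is_mgraph G" "equiv_effective G D"
  obtains r where "rank G D = int r" "rank_ge G D r" "\<And>s. rank_ge G D s \<Longrightarrow> s \<le> r"
proof -
  have b: "\<And>s. rank_ge G D s \<Longrightarrow> s \<le> nat (deg G D)"
    using rank_ge_le_deg[OF assms(1)] by fastforce
  have 0: "rank_ge G D 0" using rank_ge_0[OF assms(1)] assms(2) by simp
  show thesis
  proof
    show "rank G D = int (GREATEST r. rank_ge G D r)" using assms(2) by (simp add: rank_def)
    show "rank_ge G D (GREATEST r. rank_ge G D r)" using GreatestI_nat[of "rank_ge G D", OF 0] b by blast
    show "\<And>s. rank_ge G D s \<Longrightarrow> s \<le> (GREATEST r. rank_ge G D r)"
      using Greatest_le_nat[of "rank_ge G D"] b by blast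
  qed
qed

lemma gon_attained:
  assumes G: "is_mgraph G"
  shows "\<exists>D\<in>divisors G. rank G D \<ge> int r \<and> deg G D = gon r G"
    and "D' \<in> divisors G \<Longrightarrow> rank G D' \<ge> int r \<Longrightarrow> gon r G \<le> deg G D'"
proof -
  let ?P = "\<lambda>d. \<exists>D\<in>divisors G. rank G D \<ge> int r \<and> deg G D = d"
  have fin: "finite (verts G)" using G by (simp add: is_mgraph_def)
  have pos: "d \<ge> 0" if "?P d" for d
  proof -
    from that obtain D where D: "rank G D \<ge> int r" "deg G D = d" by blast
    then have "equiv_effective G D" by (auto simp: rank_def split: if_splits)
    then show ?thesis using deg_equiv_effective[OF G, of D] D(2) by simp
  qed
  let ?D = "\<lambda>v. if v \<in> verts G then int r else 0"
  have triv: "lin_equiv G F F" for F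
    unfolding lin_equiv_def by (intro exI[of _ "\<lambda>_. 0"]) simp
  have DF: "?D \<in> divisors G" "effective G ?D" by (auto simp: divisors_def effective_def)
  have ee: "equiv_effective G ?D" using DF(2) triv unfolding equiv_effective_def by blast
  have "rank_ge G ?D r"
    unfolding rank_ge_def
  proof (intro allI impI)
    fix E assume E: "effective G E \<and> deg G E = int r"
    have "E v \<le> int r" if "v \<in> verts G" for v
      using member_le_sum[of v "verts G" E] E that fin by (auto simp: effective_def deg_def)
    then have "effective G (\<lambda>v. ?D v - E v)"
      using E by (auto simp: effective_def divisors_def)
    then show "equiv_effective G (\<lambda>v. ?D v - E v)"
      using triv unfolding equiv_effective_def by blast
  qed
  then have "rank G ?D \<ge> int r" using rank_attained[OF G ee] by (metis of_nat_le_iff)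
  then have ex: "?P (deg G ?D)" using DF(1) by blast
  define n where "n = (LEAST n. ?P (int n))"
  have "?P (int (nat (deg G ?D)))" using ex pos[OF ex] by simp
  then have Pn: "?P (int n)" unfolding n_def by (rule LeastI)
  have min: "int n \<le> d" if "?P d" for d
  proof -
    have "?P (int (nat d))" using that pos[OF that] by simp
    then have "n \<le> nat d" unfolding n_def by (rule Least_le)
    then show ?thesis using pos[OF that] by simp
  qed
  have gn: "gon r G = int n" unfolding gon_def using Least_equality[of ?P, OF Pn] min by blast
  show "?P (gon r G)" unfolding gn by (rule Pn)
  show "gon r G \<le> deg G D'" if "D' \<in> divisors G" "rank G D' \<ge> int r"
    unfolding gn using that by (intro min) blast
qed

end

(* For a graph of genus g, Riemann-Roch determines the set of pairs (d, r) such that there is a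
divisor of degree d and rank at least r as soon as the part with d < g is known. For g at most 5
this part is governed by the first gonality, except for one possibility: a divisor D of degree 4
and rank 2 on a graph of genus 5. Such a D is an instance of equality in Clifford's inequality, and
it forces a divisor T of degree 2 and rank 1 (a special case of a theorem of Coppens), hence
gonality 2. To find T, one contracts bridges and splits the graph at a cut vertex, dividing the
chips between the two sides. In a graph with neither, two vertices that are not separated by a
3-edge cut give T = D - x - y at once, and otherwise a count of the vertices joined by three
edge-disjoint paths contradicts genus 5.

For g at least 6, consider paths whose edges have multiplicities (3, 2, ..., 2) on g vertices and
(3, 3, 3, 2, ..., 2) on g - 2 vertices. Both have gonality 3. The number of chips on an initial
segment is an invariant modulo the multiplicity of the next edge; this shows that the second graph
has no divisor of degree 5 and rank 2, whereas five chips on the second vertex of the first graph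
have rank 2. *)

theory Submission
  imports Defs "HOL-Library.Function_Algebras" "HOL-Library.FuncSet"
begin

text \<open>In genus 5 the pair (4, 2) is its own Riemann-Roch dual, so duality cannot decide it;
  this is why that single case needs a separate argument. Graphs are symmetric integer weights on a
  vertex set because the argument passes to smaller graphs: a side of a cut vertex keeps the
  weights, and a contraction merely adds them. The engine throughout is one inequality: if a firing
  script turns A into B, each superlevel set of the script loses at least as many chips as there are
  edges leaving it. With so few chips, only small cuts can carry a flow. In the examples the degree
  5 is 3 + 2 and also 1 + 2 + 2, the ways in which chips can leave a vertex where a triple and a
  double bundle meet. Three triple bundles instead create four cells with fixed residues modulo 3,
  too many to serve with five chips.\<close>

definition pt :: "'a \<Rightarrow> 'a \<Rightarrow> int" where
  "pt x = (\<lambda>v. if v = x then 1 else 0)"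

definition charf :: "'a set \<Rightarrow> 'a \<Rightarrow> int" where
  "charf U = (\<lambda>v. if v \<in> U then 1 else 0)"

text \<open>Parallel edges become an integer weight, and connectedness takes the cut form in which
  it is used. Divisors are functions on the whole type; only their values on \<open>V\<close>
  matter.\<close>

locale chip_graph =
  fixes V :: "'a set" and w :: "'a \<Rightarrow> 'a \<Rightarrow> int"
  assumes finite_V [simp]: "finite V"
    and V_nonempty: "V \<noteq> {}"
    and w_sym: "w x y = w y x"
    and w_nonneg [simp]: "0 \<le> w x y"
    and w_irrefl [simp]: "w x x = 0"
    and connected: "U \<subseteq> V \<Longrightarrow> U \<noteq> {} \<Longrightarrow> U \<noteq> V \<Longrightarrow> 1 \<le> (\<Sum>x\<in>U. \<Sum>y\<in>V - U. w x y)"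
begin

definition between :: "'a set \<Rightarrow> 'a set \<Rightarrow> int" where
  "between A B = (\<Sum>x\<in>A. \<Sum>y\<in>B. w x y)"

definition outdeg :: "'a set \<Rightarrow> 'a \<Rightarrow> int" where
  "outdeg U x = (\<Sum>y\<in>V - U. w x y)"

definition cut :: "'a set \<Rightarrow> int" where
  "cut U = (\<Sum>x\<in>U. outdeg U x)"

definition lap :: "('a \<Rightarrow> int) \<Rightarrow> 'a \<Rightarrow> int" where
  "lap f v = (\<Sum>u\<in>V. w v u * (f v - f u))"

definition dg :: "('a \<Rightarrow> int) \<Rightarrow> int" where
  "dg D = (\<Sum>v\<in>V. D v)"

definition eff :: "('a \<Rightarrow> int) \<Rightarrow> bool" where
  "eff D \<longleftrightarrow> (\<forall>v\<in>V. 0 \<le> D v)"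

definition sim :: "('a \<Rightarrow> int) \<Rightarrow> ('a \<Rightarrow> int) \<Rightarrow> bool" where
  "sim D D' \<longleftrightarrow> (\<exists>f. \<forall>v\<in>V. D v - D' v = lap f v)"

definition eeff :: "('a \<Rightarrow> int) \<Rightarrow> bool" where
  "eeff D \<longleftrightarrow> (\<exists>F. eff F \<and> sim D F)"

definition rk :: "('a \<Rightarrow> int) \<Rightarrow> nat \<Rightarrow> bool" where
  "rk D r \<longleftrightarrow> (\<forall>E. eff E \<and> dg E = int r \<longrightarrow> eeff (D - E))"

definition valence :: "'a \<Rightarrow> int" where
  "valence v = (\<Sum>u\<in>V. w v u)"

definition canon :: "'a \<Rightarrow> int" where
  "canon v = valence v - 2"

definition legal :: "'a set \<Rightarrow> ('a \<Rightarrow> int) \<Rightarrow> bool" where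
  "legal U D \<longleftrightarrow> U \<subseteq> V \<and> U \<noteq> {} \<and> (\<forall>x\<in>U. outdeg U x \<le> D x)"

text \<open>The firing half of the usual notion of a q-reduced divisor; nonnegativity away from
  \<open>q\<close> is tracked separately.\<close>

definition reduced :: "'a \<Rightarrow> ('a \<Rightarrow> int) \<Rightarrow> bool" where
  "reduced q D \<longleftrightarrow> (\<forall>U. legal U D \<longrightarrow> q \<in> U)"

subsection \<open>Linear equivalence\<close>

lemma finite_subset_V [simp]: "U \<subseteq> V \<Longrightarrow> finite U"
  using finite_V finite_subset by blast

lemma between_nonneg [simp]: "0 \<le> between A B"
  unfolding between_def by (intro sum_nonneg) auto

lemma outdeg_nonneg [simp]: "0 \<le> outdeg U x"
  unfolding outdeg_def by (intro sum_nonneg) auto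

lemma between_commute: "between A B = between B A"
  unfolding between_def by (subst sum.swap) (simp add: w_sym)

lemma between_mono: "A \<subseteq> A' \<Longrightarrow> B \<subseteq> B' \<Longrightarrow> A' \<subseteq> V \<Longrightarrow> B' \<subseteq> V \<Longrightarrow> between A B \<le> between A' B'"
  unfolding between_def
  by (rule order_trans[OF sum_mono sum_mono2]) (auto intro!: sum_mono2 sum_nonneg intro: finite_subset)

lemma between_Un_left: "A \<subseteq> V \<Longrightarrow> B \<subseteq> V \<Longrightarrow> A \<inter> B = {} \<Longrightarrow> between (A \<union> B) C = between A C + between B C"
  unfolding between_def by (rule sum.union_disjoint) auto

lemma between_Un_right: "A \<subseteq> V \<Longrightarrow> B \<subseteq> V \<Longrightarrow> A \<inter> B = {} \<Longrightarrow> between C (A \<union> B) = between C A + between C B"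
  by (metis between_Un_left between_commute)

lemma cut_between: "cut U = between U (V - U)"
  by (simp add: cut_def outdeg_def between_def)

lemma cut_ge_1: "U \<subseteq> V \<Longrightarrow> U \<noteq> {} \<Longrightarrow> U \<noteq> V \<Longrightarrow> 1 \<le> cut U"
  using connected by (simp add: cut_between between_def)

lemma cut_compl: "U \<subseteq> V \<Longrightarrow> cut (V - U) = cut U"
  by (simp add: cut_between between_commute double_diff)

lemma lap_add: "lap (f + g) = lap f + lap g"
  by (auto simp: lap_def fun_eq_iff sum.distrib[symmetric] algebra_simps intro!: sum.cong)

lemma lap_uminus: "lap (- f) = - lap f"
  by (auto simp: lap_def fun_eq_iff sum_negf[symmetric] algebra_simps intro!: sum.cong)

lemma lap_diff: "lap (f - g) = lap f - lap g"
  using lap_add[of f "- g"] by (simp add: lap_uminus)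

lemma lap_zero: "lap 0 = 0"
  by (auto simp: lap_def fun_eq_iff)

lemma lap_cong: "(\<And>u. u \<in> V \<Longrightarrow> f u = g u) \<Longrightarrow> v \<in> V \<Longrightarrow> lap f v = lap g v"
  unfolding lap_def by (intro sum.cong) auto

lemma sum_lap:
  assumes "U \<subseteq> V"
  shows "(\<Sum>v\<in>U. lap f v) = (\<Sum>v\<in>U. \<Sum>u\<in>V - U. w v u * (f v - f u))"
proof -
  have "(\<Sum>v\<in>U. \<Sum>u\<in>U. w v u * (f v - f u)) = (\<Sum>v\<in>U. \<Sum>u\<in>U. w v u * (f u - f v))"
    by (subst sum.swap) (simp add: w_sym)
  also have "\<dots> = - (\<Sum>v\<in>U. \<Sum>u\<in>U. w v u * (f v - f u))"
    by (simp add: sum_negf[symmetric] algebra_simps)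
  finally have z: "(\<Sum>v\<in>U. \<Sum>u\<in>U. w v u * (f v - f u)) = 0" by simp
  have "V = U \<union> (V - U)" using assms by auto
  then have "lap f v = (\<Sum>u\<in>U. w v u * (f v - f u)) + (\<Sum>u\<in>V - U. w v u * (f v - f u))" for v
    unfolding lap_def using sum.subset_diff[OF assms finite_V, of "\<lambda>u. w v u * (f v - f u)"] by simp
  then show ?thesis using z by (simp add: sum.distrib)
qed

lemma sum_lap_V: "(\<Sum>v\<in>V. lap f v) = 0"
  using sum_lap[of V f] by simp

text \<open>Scripts are integer valued, so a strict drop along a boundary edge is at least
  1.\<close>

lemma cut_le_flow:
  assumes "U \<subseteq> V" "\<And>v u. v \<in> U \<Longrightarrow> u \<in> V - U \<Longrightarrow> f u < f v"
  shows "cut U \<le> (\<Sum>v\<in>U. lap f v)"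
  unfolding sum_lap[OF assms(1)] cut_def outdeg_def
proof (intro sum_mono)
  fix v u assume "v \<in> U" "u \<in> V - U"
  then have "1 \<le> f v - f u" using assms(2) by force
  then show "w v u \<le> w v u * (f v - f u)" using mult_left_mono[of 1 "f v - f u" "w v u"] by simp
qed

lemma level_cut:
  assumes "U = {v \<in> V. t < f v}"
  shows "cut U \<le> (\<Sum>v\<in>U. lap f v)"
  using assms by (intro cut_le_flow) auto

lemma lap_zero_const:
  assumes "\<And>v. v \<in> V \<Longrightarrow> lap f v = 0" "a \<in> V" "b \<in> V"
  shows "f a = f b"
proof (rule ccontr)
  assume "f a \<noteq> f b"
  then obtain a b where ab: "a \<in> V" "b \<in> V" "f b < f a"
    using assms(2,3) by (metis linorder_neqE)
  define U where "U = {v \<in> V. f b < f v}"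
  have "cut U \<le> (\<Sum>v\<in>U. lap f v)" using U_def by (rule level_cut)
  also have "\<dots> = 0" using assms(1) by (intro sum.neutral) (auto simp: U_def)
  finally show False using cut_ge_1[of U] ab by (auto simp: U_def)
qed

lemma lap_charf: "x \<in> U \<Longrightarrow> U \<subseteq> V \<Longrightarrow> lap (charf U) x = outdeg U x"
proof -
  assume "x \<in> U" "U \<subseteq> V"
  then have "lap (charf U) x = (\<Sum>u\<in>V. if u \<in> V - U then w x u else 0)"
    unfolding lap_def charf_def by (intro sum.cong) auto
  also have "\<dots> = outdeg U x"
    unfolding outdeg_def by (subst sum.If_cases) (auto intro!: sum.cong simp: Int_absorb1)
  finally show ?thesis .
qed

lemma lap_charf_out: "x \<notin> U \<Longrightarrow> lap (charf U) x \<le> 0"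
  unfolding lap_def charf_def by (intro sum_nonpos) auto

lemma dg_add: "dg (D + D') = dg D + dg D'"
  by (simp add: dg_def sum.distrib)

lemma dg_diff: "dg (D - D') = dg D - dg D'"
  by (simp add: dg_def sum_subtractf)

lemma dg_pt: "x \<in> V \<Longrightarrow> dg (pt x) = 1"
  by (simp add: dg_def pt_def)

lemma eff_add: "eff D \<Longrightarrow> eff D' \<Longrightarrow> eff (D + D')"
  by (simp add: eff_def)

lemma eff_pt [simp]: "eff (pt x)"
  by (simp add: eff_def pt_def)

lemma eff_zero [simp]: "eff 0"
  by (simp add: eff_def)

lemma eff_dg: "eff D \<Longrightarrow> 0 \<le> dg D"
  by (simp add: eff_def dg_def sum_nonneg)

lemma simI: "(\<And>v. v \<in> V \<Longrightarrow> D v - D' v = lap f v) \<Longrightarrow> sim D D'"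
  unfolding sim_def by blast

lemma sim_cong: "(\<And>v. v \<in> V \<Longrightarrow> D v = D' v) \<Longrightarrow> sim D D'"
  by (rule simI[of _ _ 0]) (simp add: lap_zero)

lemma sim_refl [simp]: "sim D D"
  by (rule sim_cong) simp

lemma sim_add: "sim A B \<Longrightarrow> sim C D \<Longrightarrow> sim (A + C) (B + D)"
proof -
  assume "sim A B" "sim C D"
  then obtain f g where "\<forall>v\<in>V. A v - B v = lap f v" "\<forall>v\<in>V. C v - D v = lap g v"
    unfolding sim_def by blast
  then show ?thesis by (intro simI[of _ _ "f + g"]) (simp add: lap_add algebra_simps)
qed

lemma sim_sym: "sim A B \<Longrightarrow> sim B A"
proof -
  assume "sim A B"
  then obtain f where "\<forall>v\<in>V. A v - B v = lap f v" unfolding sim_def by blast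
  then show ?thesis by (intro simI[of _ _ "- f"]) (auto simp: lap_uminus)
qed

lemma sim_trans [trans]: "sim A B \<Longrightarrow> sim B C \<Longrightarrow> sim A C"
proof -
  assume "sim A B" "sim B C"
  then have "sim (A + B) (B + C)" by (rule sim_add)
  then show ?thesis unfolding sim_def by simp
qed

lemma sim_diff: "sim A B \<Longrightarrow> sim C D \<Longrightarrow> sim (A - C) (B - D)"
proof -
  assume "sim A B" "sim C D"
  then obtain f g where "\<forall>v\<in>V. A v - B v = lap f v" "\<forall>v\<in>V. C v - D v = lap g v"
    unfolding sim_def by blast
  then show ?thesis by (intro simI[of _ _ "f - g"]) (simp add: lap_diff algebra_simps)
qed

lemma sim_dg: "sim D D' \<Longrightarrow> dg D = dg D'"
proof -
  assume "sim D D'"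
  then obtain f where "\<forall>v\<in>V. D v - D' v = lap f v" unfolding sim_def by blast
  then have "dg D - dg D' = (\<Sum>v\<in>V. lap f v)" by (simp add: dg_def sum_subtractf[symmetric])
  then show ?thesis by (simp add: sum_lap_V)
qed

lemma eeffI: "eff F \<Longrightarrow> sim D F \<Longrightarrow> eeff D"
  unfolding eeff_def by blast

lemma eff_eeff: "eff D \<Longrightarrow> eeff D"
  by (rule eeffI) auto

lemma eeff_sim: "eeff D \<Longrightarrow> sim D D' \<Longrightarrow> eeff D'"
  unfolding eeff_def using sim_sym sim_trans by blast

lemma eeff_add: "eeff D \<Longrightarrow> eeff D' \<Longrightarrow> eeff (D + D')"
  unfolding eeff_def using eff_add sim_add by blast

lemma eeff_dg: "eeff D \<Longrightarrow> 0 \<le> dg D"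
  unfolding eeff_def using eff_dg sim_dg by metis

subsection \<open>Reduced divisors\<close>

text \<open>Take a script of maximal total size among those that do not fire \<open>q\<close> and
  create no new debt away from \<open>q\<close>. A legal set avoiding \<open>q\<close> could be
  added to it.\<close>

lemma exists_no_legal_avoiding:
  assumes q: "q \<in> V"
  shows "\<exists>D'. sim D D' \<and> (\<forall>v\<in>V - {q}. min 0 (D v) \<le> D' v) \<and> D q \<le> D' q \<and> reduced q D'"
proof -
  \<comment> \<open>\<open>f q = 0\<close> removes the constants, which are the kernel of
    \<open>lap\<close>, so scripts are determined by the divisors they produce. These are bounded on
    both sides, hence \<open>S\<close> is finite.\<close>
  define S where "S = {f. (\<forall>v. v \<notin> V \<longrightarrow> f v = 0) \<and> (\<forall>v. 0 \<le> f v) \<and> f q = 0 \<and>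
      (\<forall>v\<in>V - {q}. min 0 (D v) \<le> D v - lap f v)}"
  have q_ge: "lap f q \<le> 0" if "f \<in> S" for f
    unfolding lap_def using that by (intro sum_nonpos) (auto simp: S_def mult_nonneg_nonpos)
  have low: "min 0 (D v) \<le> D v - lap f v" if "f \<in> S" "v \<in> V" for f v
    using that q_ge[OF that(1)] by (cases "v = q") (auto simp: S_def)
  define lo where "lo = (\<Sum>v\<in>V. - min 0 (D v))"
  define hi where "hi = dg D + lo"
  have high: "D v - lap f v \<le> hi" if "f \<in> S" "v \<in> V" for f v
  proof -
    have "dg D = (\<Sum>u\<in>V. D u - lap f u)"
      by (simp add: dg_def sum_subtractf sum_lap_V)
    also have "\<dots> = (D v - lap f v) + (\<Sum>u\<in>V - {v}. D u - lap f u)"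
      using that by (simp add: sum.remove)
    finally have "D v - lap f v = dg D - (\<Sum>u\<in>V - {v}. D u - lap f u)" by simp
    moreover have "(\<Sum>u\<in>V - {v}. min 0 (D u)) \<le> (\<Sum>u\<in>V - {v}. D u - lap f u)"
      using low[OF that(1)] by (intro sum_mono) auto
    moreover have "(\<Sum>u\<in>V. min 0 (D u)) \<le> (\<Sum>u\<in>V - {v}. min 0 (D u))"
      using that by (simp add: sum.remove)
    ultimately show ?thesis by (simp add: hi_def lo_def sum_negf)
  qed
  define g where "g f = restrict (\<lambda>v. D v - lap f v) V" for f
  have "g ` S \<subseteq> PiE V (\<lambda>v. {min 0 (D v)..hi})"
    unfolding g_def using low high by (intro image_subsetI) (simp add: PiE_iff)
  then have "finite (g ` S)" by (rule finite_subset) (intro finite_PiE, auto)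
  moreover have "inj_on g S"
  proof (rule inj_onI)
    fix f h assume fh: "f \<in> S" "h \<in> S" "g f = g h"
    have "lap (f - h) v = 0" if "v \<in> V" for v
      using fun_cong[OF fh(3), of v] that by (simp add: g_def lap_diff)
    then have "(f - h) v = (f - h) q" if "v \<in> V" for v
      using lap_zero_const[of "f - h"] that q by blast
    then have "f v = h v" if "v \<in> V" for v
      using that fh(1,2) by (simp add: S_def)
    then show "f = h" using fh(1,2) unfolding S_def fun_eq_iff by (metis (mono_tags, lifting) mem_Collect_eq)
  qed
  ultimately have fin: "finite S" using finite_imageD by blast
  have "0 \<in> S" by (auto simp: S_def lap_zero)
  then have "S \<noteq> {}" by blast
  define m where "m = Max ((\<lambda>f. sum f V) ` S)"
  have "m \<in> (\<lambda>f. sum f V) ` S" unfolding m_def using fin \<open>S \<noteq> {}\<close> by (intro Max_in) auto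
  then obtain f where f: "f \<in> S" "sum f V = m" by auto
  have max: "sum h V \<le> sum f V" if "h \<in> S" for h
    unfolding f(2) m_def using fin that by (intro Max_ge) auto
  have "reduced q (D - lap f)"
    unfolding reduced_def
  proof (intro allI impI, rule ccontr)
    fix U assume U: "legal U (D - lap f)" "q \<notin> U"
    have UV: "U \<subseteq> V" "U \<noteq> {}" using U(1) by (auto simp: legal_def)
    have "f + charf U \<in> S"
      unfolding S_def
    proof (clarsimp, intro conjI allI ballI impI)
      fix v assume "v \<notin> V"
      then show "f v + charf U v = 0" using f(1) UV by (auto simp: S_def charf_def)
    next
      fix v show "0 \<le> f v + charf U v" using f(1) by (auto simp: S_def charf_def)
    next
      show "f q + charf U q = 0" using f(1) U(2) by (auto simp: S_def charf_def)
    next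
      fix v assume v: "v \<in> V - {q}"
      show "min 0 (D v) \<le> D v - lap (f + charf U) v"
      proof (cases "v \<in> U")
        case True
        then show ?thesis using U(1) UV by (auto simp: legal_def lap_add lap_charf)
      next
        case False
        then show ?thesis using lap_charf_out[of v U] low[OF f(1), of v] v by (auto simp: lap_add)
      qed
    qed
    from max[OF this] have "sum (charf U) V \<le> 0" by (simp add: sum.distrib)
    moreover have "sum (charf U) V = int (card U)"
      using UV by (simp add: charf_def sum.If_cases Int_absorb1)
    ultimately show False using UV by (simp add: card_gt_0_iff)
  qed
  moreover have "sim D (D - lap f)" by (rule simI[of _ _ f]) simp
  ultimately show ?thesis using low[OF f(1)] q_ge[OF f(1)] by (intro exI[of _ "D - lap f"]) auto
qed

lemma exists_reduced:
  assumes "q \<in> V" "eeff D"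
  obtains D' where "sim D D'" "eff D'" "reduced q D'"
proof -
  obtain F where F: "eff F" "sim D F" using assms(2) by (auto simp: eeff_def)
  obtain D' where D': "sim F D'" "\<forall>v\<in>V - {q}. min 0 (F v) \<le> D' v" "F q \<le> D' q" "reduced q D'"
    using exists_no_legal_avoiding[OF assms(1), of F] by blast
  have "eff D'"
    unfolding eff_def
  proof
    fix v assume "v \<in> V"
    then have "0 \<le> F v" using F(1) by (simp add: eff_def)
    then show "0 \<le> D' v" using D'(2,3) \<open>v \<in> V\<close> by (cases "v = q") force+
  qed
  then show ?thesis using that D' F(2) sim_trans by blast
qed

text \<open>The vertices where the script is maximal can fire: each loses at least its outdegree.
  \<open>q\<close> is not among them, since \<open>lap f q\<close> is negative.\<close>

lemma exists_legal:
  assumes "eff R" "q \<in> V" "R q = 0" "eeff (R - pt q)"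
  obtains U where "legal U R" "q \<notin> U"
proof -
  obtain F f where F: "eff F" and f: "\<forall>v\<in>V. (R - pt q) v - F v = lap f v"
    using assms(4) by (auto simp: eeff_def sim_def)
  define m where "m = Max (f ` V)"
  define U where "U = {v \<in> V. f v = m}"
  have "m \<in> f ` V" unfolding m_def using V_nonempty by (intro Max_in) auto
  then have ne: "U \<noteq> {}" by (auto simp: U_def)
  have le: "f v \<le> m" if "v \<in> V" for v unfolding m_def using that by (intro Max_ge) auto
  have out: "outdeg U x \<le> lap f x" if "x \<in> U" for x
  proof -
    have "outdeg U x = lap (charf U) x" using that by (simp add: lap_charf U_def)
    also have "\<dots> \<le> lap f x"
      unfolding lap_def
    proof (intro sum_mono mult_left_mono)
      fix u assume "u \<in> V"
      then show "charf U x - charf U u \<le> f x - f u"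
        using that le[of u] by (auto simp: charf_def U_def)
    qed auto
    finally show ?thesis .
  qed
  have "q \<notin> U"
  proof
    assume "q \<in> U"
    then have "0 \<le> lap f q" using out[of q] outdeg_nonneg[of U q] by linarith
    moreover have "lap f q = - 1 - F q" using bspec[OF f assms(2)] assms(3) by (simp add: pt_def)
    moreover have "0 \<le> F q" using F assms(2) by (simp add: eff_def)
    ultimately show False by simp
  qed
  moreover have "legal U R"
    unfolding legal_def
  proof (intro conjI ballI)
    fix x assume "x \<in> U"
    then have "x \<in> V" by (simp add: U_def)
    have "outdeg U x \<le> lap f x" using out \<open>x \<in> U\<close> by blast
    also have "\<dots> = R x - pt q x - F x" using bspec[OF f \<open>x \<in> V\<close>] by simp
    also have "\<dots> \<le> R x"
    proof -
      have "0 \<le> F x" "0 \<le> pt q x" using F \<open>x \<in> V\<close> by (auto simp: pt_def eff_def)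
      then show ?thesis by simp
    qed
    finally show "outdeg U x \<le> R x" .
  next
    show "U \<subseteq> V" unfolding U_def by blast
    show "U \<noteq> {}" by (rule ne)
  qed
  ultimately show ?thesis by (rule that[rotated])
qed

subsection \<open>Rank\<close>

lemma rk_sim: "rk D r \<Longrightarrow> sim D D' \<Longrightarrow> rk D' r"
  unfolding rk_def using eeff_sim sim_diff sim_refl by blast

lemma rk_eq: "rk D r \<Longrightarrow> (\<And>v. v \<in> V \<Longrightarrow> D v = D' v) \<Longrightarrow> rk D' r"
  using rk_sim sim_cong by blast

lemma eeff_eq: "eeff D \<Longrightarrow> (\<And>v. v \<in> V \<Longrightarrow> D v = D' v) \<Longrightarrow> eeff D'"
  using eeff_sim sim_cong by blast

lemma sim_eq: "sim A B \<Longrightarrow> (\<And>v. v \<in> V \<Longrightarrow> A v = A' v) \<Longrightarrow> (\<And>v. v \<in> V \<Longrightarrow> B v = B' v) \<Longrightarrow> sim A' B'"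
  unfolding sim_def by simp

lemma eeff_diff_iff: "eeff (D - E) \<longleftrightarrow> (\<exists>F. sim D F \<and> (\<forall>v\<in>V. E v \<le> F v))"
proof
  assume "eeff (D - E)"
  then obtain F where F: "eff F" "sim (D - E) F" by (auto simp: eeff_def)
  have "sim D (F + E)" by (rule sim_eq[OF sim_add[OF F(2) sim_refl[of E]]]) auto
  then show "\<exists>F. sim D F \<and> (\<forall>v\<in>V. E v \<le> F v)" using F(1) by (auto simp: eff_def)
next
  assume "\<exists>F. sim D F \<and> (\<forall>v\<in>V. E v \<le> F v)"
  then obtain F where F: "sim D F" "\<forall>v\<in>V. E v \<le> F v" by blast
  have "eff (F - E)" using F(2) by (simp add: eff_def)
  then show "eeff (D - E)" using sim_diff[OF F(1) sim_refl[of E]] by (auto simp: eeff_def)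
qed

lemma exists_V: obtains v where "v \<in> V"
  using V_nonempty by blast

lemma eff_dg_0:
  assumes "eff E" "dg E = 0" "v \<in> V"
  shows "E v = 0"
  using assms sum_nonneg_eq_0_iff[of V E] by (simp add: eff_def dg_def)

lemma rk_0: "rk D 0 \<longleftrightarrow> eeff D"
proof
  assume "rk D 0"
  moreover have "dg 0 = int 0" by (simp add: dg_def)
  ultimately have "eeff (D - 0)" unfolding rk_def using eff_zero by blast
  then show "eeff D" by simp
next
  assume D: "eeff D"
  show "rk D 0"
    unfolding rk_def
  proof (intro allI impI)
    fix E assume E: "eff E \<and> dg E = int 0"
    then have "sim D (D - E)" using eff_dg_0[of E] by (intro sim_cong) auto
    then show "eeff (D - E)" using eeff_sim[OF D] by blast
  qed
qed

lemma dg_pos_chip: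
  assumes "0 < dg E"
  obtains x where "x \<in> V" "0 < E x"
proof -
  have "\<exists>x\<in>V. 0 < E x"
    using assms sum_nonpos[of V E] unfolding dg_def by force
  then show ?thesis using that by blast
qed

lemma rk_Suc: "rk D (Suc r) \<longleftrightarrow> (\<forall>x\<in>V. rk (D - pt x) r)"
proof
  assume D: "rk D (Suc r)"
  show "\<forall>x\<in>V. rk (D - pt x) r"
    unfolding rk_def
  proof (intro ballI allI impI)
    fix x E assume "x \<in> V" and E: "eff E \<and> dg E = int r"
    then have "eff (E + pt x)" "dg (E + pt x) = int (Suc r)"
      by (auto simp: dg_add dg_pt intro: eff_add)
    then have "eeff (D - (E + pt x))" using D unfolding rk_def by blast
    then show "eeff (D - pt x - E)" by (simp add: algebra_simps)
  qed
next
  assume D: "\<forall>x\<in>V. rk (D - pt x) r"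
  show "rk D (Suc r)"
    unfolding rk_def
  proof (intro allI impI)
    fix E assume E: "eff E \<and> dg E = int (Suc r)"
    then obtain x where x: "x \<in> V" "0 < E x" using dg_pos_chip[of E] by auto
    then have "eff (E - pt x)" using E by (auto simp: eff_def pt_def)
    moreover have "dg (E - pt x) = int r" using E x by (simp add: dg_diff dg_pt)
    ultimately have "eeff (D - pt x - (E - pt x))" using D x unfolding rk_def by blast
    then show "eeff (D - E)" by (simp add: algebra_simps)
  qed
qed

lemma rk_1: "rk D 1 \<longleftrightarrow> (\<forall>x\<in>V. eeff (D - pt x))"
  by (simp add: rk_Suc rk_0)

lemma rk_2: "rk D 2 \<longleftrightarrow> (\<forall>x\<in>V. \<forall>y\<in>V. eeff (D - pt x - pt y))"
  by (simp add: rk_Suc rk_0 numeral_2_eq_2)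

lemma rk_add_eeff: "rk D r \<Longrightarrow> eeff F \<Longrightarrow> rk (D + F) r"
  unfolding rk_def
proof (intro allI impI)
  fix E assume "\<forall>E. eff E \<and> dg E = int r \<longrightarrow> eeff (D - E)" "eeff F" "eff E \<and> dg E = int r"
  then have "eeff (D - E + F)" using eeff_add by blast
  then show "eeff (D + F - E)" by (simp add: algebra_simps)
qed

lemma rk_Suc_D: "rk D (Suc r) \<Longrightarrow> rk D r"
proof -
  assume D: "rk D (Suc r)"
  obtain v where v: "v \<in> V" by (rule exists_V)
  then have "rk (D - pt v) r" using D by (simp add: rk_Suc)
  then have "rk (D - pt v + pt v) r" using rk_add_eeff eff_eeff eff_pt by blast
  then show "rk D r" by (rule rk_eq) simp
qed

lemma rk_mono: "rk D r \<Longrightarrow> s \<le> r \<Longrightarrow> rk D s"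
  by (induction r) (auto simp: le_Suc_eq dest: rk_Suc_D)

lemma rk_eeff: "rk D r \<Longrightarrow> eeff D"
  using rk_mono[of D r 0] by (simp add: rk_0)

lemma rk_dg: "rk D r \<Longrightarrow> int r \<le> dg D"
proof (induction r arbitrary: D)
  case 0
  then show ?case by (simp add: rk_0 eeff_dg)
next
  case (Suc r)
  obtain v where v: "v \<in> V" by (rule exists_V)
  then have "int r \<le> dg (D - pt v)" using Suc.IH[of "D - pt v"] Suc.prems rk_Suc by blast
  then show ?case using v by (simp add: dg_diff dg_pt)
qed

lemma rk_add: "rk D r \<Longrightarrow> rk D' s \<Longrightarrow> rk (D + D') (r + s)"
proof (induction r arbitrary: D)
  case 0
  then have "rk (D' + D) s" using rk_add_eeff[of D' s D] by (simp add: rk_0)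
  then show ?case unfolding add_0 by (rule rk_eq) simp
next
  case (Suc r)
  have "rk (D + D' - pt x) (r + s)" if "x \<in> V" for x
  proof -
    have "rk (D - pt x) r" using Suc.prems(1) that by (simp only: rk_Suc)
    then have "rk (D - pt x + D') (r + s)" using Suc.IH Suc.prems(2) by blast
    then show ?thesis by (rule rk_eq) simp
  qed
  then show ?case unfolding add_Suc rk_Suc by blast
qed

subsection \<open>Riemann-Roch\<close>

definition gen :: int where
  "gen = (\<Sum>x\<in>V. \<Sum>y\<in>V. w x y) div 2 - int (card V) + 1"

text \<open>Indegree minus 1 for the acyclic orientation in which edges point from smaller to larger
  \<open>p\<close>. These are the extremal noneffective divisors.\<close>

definition nu :: "('a \<Rightarrow> nat) \<Rightarrow> 'a \<Rightarrow> int" where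
  "nu p v = (\<Sum>u\<in>{u \<in> V. p u < p v}. w v u) - 1"

text \<open>Among the vertices where the script is maximal take the first one in \<open>p\<close>.
  Its earlier neighbours lie strictly lower, so it loses its whole indegree, one chip more than it
  has.\<close>

lemma nu_not_eeff: "\<not> eeff (nu p)"
proof
  assume "eeff (nu p)"
  then obtain F f where F: "eff F" and f: "\<forall>v\<in>V. nu p v - F v = lap f v"
    by (auto simp: eeff_def sim_def)
  define m where "m = Max (f ` V)"
  have "m \<in> f ` V" unfolding m_def using V_nonempty by (intro Max_in) auto
  then obtain v0 where "v0 \<in> V \<and> f v0 = m" by blast
  from ex_has_least_nat[of "\<lambda>v. v \<in> V \<and> f v = m", OF this, of p]
  obtain v where v: "v \<in> V" "f v = m" and vmin: "\<And>u. u \<in> V \<Longrightarrow> f u = m \<Longrightarrow> p v \<le> p u" by blast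
  have le: "f u \<le> m" if "u \<in> V" for u unfolding m_def using that by (intro Max_ge) auto
  have "(\<Sum>u\<in>{u \<in> V. p u < p v}. w v u) \<le> (\<Sum>u\<in>{u \<in> V. p u < p v}. w v u * (f v - f u))"
  proof (rule sum_mono)
    fix u assume u: "u \<in> {u \<in> V. p u < p v}"
    then have "f u \<noteq> m" using vmin[of u] by auto
    then have "1 \<le> f v - f u" using le[of u] u v by simp
    then show "w v u \<le> w v u * (f v - f u)" using mult_left_mono[of 1 "f v - f u" "w v u"] by simp
  qed
  also have "\<dots> \<le> lap f v"
    unfolding lap_def using le v by (intro sum_mono2) auto
  also have "\<dots> = nu p v - F v" using bspec[OF f v(1)] by simp
  finally have "F v \<le> - 1" by (simp add: nu_def)
  then show False using F v(1) unfolding eff_def by fastforce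
qed

text \<open>Reversing the orientation exchanges indegrees and outdegrees, which add up to the
  valence.\<close>

lemma nu_reverse:
  assumes "inj_on p V" "\<And>v. v \<in> V \<Longrightarrow> p v \<le> N" "v \<in> V"
  shows "canon v - nu p v = nu (\<lambda>u. N - p u) v"
proof -
  have r: "{u \<in> V. N - p u < N - p v} = {u \<in> V. p v < p u}"
    using assms(2) assms(2)[OF assms(3)] by fastforce
  have s: "V = insert v ({u \<in> V. p u < p v} \<union> {u \<in> V. p v < p u})"
  proof -
    have "u = v \<or> p u < p v \<or> p v < p u" if "u \<in> V" for u
      using inj_onD[OF assms(1), of u v] that assms(3) by linarith
    then show ?thesis using assms(3) by blast
  qed
  have "valence v = (\<Sum>u\<in>{u \<in> V. p u < p v} \<union> {u \<in> V. p v < p u}. w v u)"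
    unfolding valence_def by (subst s) (subst sum.insert, auto)
  also have "\<dots> = (\<Sum>u\<in>{u \<in> V. p u < p v}. w v u) + (\<Sum>u\<in>{u \<in> V. p v < p u}. w v u)"
    by (rule sum.union_disjoint) auto
  finally show ?thesis by (simp add: canon_def nu_def r)
qed

lemma dg_nu:
  assumes "inj_on p V"
  shows "dg (nu p) = gen - 1" "dg canon = 2 * gen - 2"
proof -
  define A where "A = (\<Sum>v\<in>V. \<Sum>u\<in>{u \<in> V. p u < p v}. w v u)"
  define N where "N = Max (p ` V)"
  have N: "p v \<le> N" if "v \<in> V" for v unfolding N_def using that by (intro Max_ge) auto
  have split: "A = (\<Sum>v\<in>V. \<Sum>u\<in>V. if p u < p v then w v u else 0)"
    unfolding A_def by (intro sum.cong refl sum.inter_filter) simp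
  have "A = (\<Sum>v\<in>V. \<Sum>u\<in>V. if p v < p u then w v u else 0)"
    unfolding split by (subst sum.swap, intro sum.cong refl) (simp add: w_sym)
  then have "2 * A = (\<Sum>v\<in>V. \<Sum>u\<in>V. (if p u < p v then w v u else 0) + (if p v < p u then w v u else 0))"
    using split by (simp add: sum.distrib)
  also have "\<dots> = (\<Sum>v\<in>V. \<Sum>u\<in>V. w v u)"
  proof (intro sum.cong refl)
    fix v u assume "v \<in> V" "u \<in> V"
    then show "(if p u < p v then w v u else 0) + (if p v < p u then w v u else 0) = w v u"
      using assms by (cases "u = v") (auto dest: inj_onD simp: not_less_iff_gr_or_eq)
  qed
  finally have A2: "2 * A = (\<Sum>v\<in>V. \<Sum>u\<in>V. w v u)" .
  then have "A = (\<Sum>v\<in>V. \<Sum>u\<in>V. w v u) div 2" by (metis nonzero_mult_div_cancel_left zero_neq_numeral)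
  then have "A = gen + int (card V) - 1" unfolding gen_def by simp
  then show "dg (nu p) = gen - 1" by (simp add: dg_def nu_def A_def sum_subtractf)
  show "dg canon = 2 * gen - 2"
    using A2 \<open>A = gen + int (card V) - 1\<close> by (simp add: dg_def canon_def valence_def sum_subtractf)
qed

lemma exists_inj: obtains p :: "'a \<Rightarrow> nat" where "inj_on p V"
  using finite_imp_inj_to_nat_seg[OF finite_V] by blast

lemma dg_canon: "dg canon = 2 * gen - 2"
  using exists_inj dg_nu(2) by metis

text \<open>Dhar's burning algorithm: if no set avoiding \<open>q\<close> can fire, then the fire spreads from \<open>q\<close>
  over the whole graph, and the order in which vertices burn is an acyclic orientation.\<close>

lemma burning_order:
  assumes q: "q \<in> V" and red: "reduced q D"
  obtains p where "inj_on p V" "\<And>v. v \<in> V - {q} \<Longrightarrow> D v \<le> nu p v" "nu p q = -1"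
proof -
  \<comment> \<open>\<open>B\<close> is the set burnt after \<open>k\<close> steps and
    \<open>p\<close> the time of burning. A vertex burns when it has fewer chips than edges to burnt
    vertices.\<close>
  have claim: "\<exists>B p. q \<in> B \<and> B \<subseteq> V \<and> card B = Suc k \<and> inj_on p B \<and> p q = (0::nat) \<and> (\<forall>v\<in>B. p v \<le> k) \<and>
      (\<forall>v\<in>B - {q}. D v < (\<Sum>u\<in>{u \<in> B. p u < p v}. w v u))" if "Suc k \<le> card V" for k
    using that
  proof (induction k)
    case 0
    show ?case by (intro exI[of _ "{q}"] exI[of _ "\<lambda>_. 0"]) (use q in auto)
  next
    case (Suc k)
    then obtain B p where B: "q \<in> B" "B \<subseteq> V" "card B = Suc k" "inj_on p B" "p q = 0" "\<forall>v\<in>B. p v \<le> k"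
      "\<forall>v\<in>B - {q}. D v < (\<Sum>u\<in>{u \<in> B. p u < p v}. w v u)" by auto
    have "V - B \<noteq> {}" using B Suc.prems by auto
    \<comment> \<open>The unburnt set avoids \<open>q\<close>, so it is not legal: one of its
      vertices cannot pay for its edges to \<open>B\<close> and burns next.\<close>
    then have "\<not> legal (V - B) D" using red B(1) by (auto simp: reduced_def)
    then obtain v where v: "v \<in> V" "v \<notin> B" "D v < outdeg (V - B) v"
      using \<open>V - B \<noteq> {}\<close> by (auto simp: legal_def not_le)
    define p' where "p' = p(v := Suc k)"
    have out: "outdeg (V - B) v = (\<Sum>u\<in>B. w v u)" using B(2) by (simp add: outdeg_def double_diff)
    have old: "{u \<in> insert v B. p' u < p' x} = {u \<in> B. p u < p x}" if "x \<in> B" for x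
      using that v(2) B(6) by (auto simp: p'_def)
    have new: "{u \<in> insert v B. p' u < p' v} = B"
      using v(2) B(6) by (auto simp: p'_def)
    show ?case
    proof (intro exI[of _ "insert v B"] exI[of _ p'] conjI)
      show "inj_on p' (insert v B)"
      proof -
        have "inj_on p' B \<longleftrightarrow> inj_on p B"
          by (rule inj_on_cong) (use v(2) in \<open>auto simp: p'_def\<close>)
        moreover have "p' v \<noteq> p' b" if "b \<in> B - {v}" for b
          using B(6) that by (force simp: p'_def)
        then have "p' v \<notin> p' ` (B - {v})" by blast
        ultimately show ?thesis using B(4) by simp
      qed
      show "card (insert v B) = Suc (Suc k)" using B(2,3) v(2) by simp
      show "\<forall>x\<in>insert v B - {q}. D x < (\<Sum>u\<in>{u \<in> insert v B. p' u < p' x}. w x u)"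
      proof
        fix x assume x: "x \<in> insert v B - {q}"
        show "D x < (\<Sum>u\<in>{u \<in> insert v B. p' u < p' x}. w x u)"
        proof (cases "x = v")
          case True
          then show ?thesis using new v(3) out by simp
        next
          case False
          then show ?thesis using old[of x] B(7) x by simp
        qed
      qed
    qed (use B v in \<open>auto simp: p'_def\<close>)
  qed
  have "0 < card V" using V_nonempty by (simp add: card_gt_0_iff)
  then have c: "Suc (card V - 1) = card V" by simp
  have "\<exists>B p. q \<in> B \<and> B \<subseteq> V \<and> card B = card V \<and> inj_on p B \<and> p q = (0::nat) \<and>
      (\<forall>v\<in>B - {q}. D v < (\<Sum>u\<in>{u \<in> B. p u < p v}. w v u))"
    using claim[of "card V - 1"] unfolding c by blast
  then obtain B p where B: "q \<in> B" "B \<subseteq> V" "card B = card V" "inj_on p B" "p q = (0::nat)"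
      "\<forall>v\<in>B - {q}. D v < (\<Sum>u\<in>{u \<in> B. p u < p v}. w v u)"
    by blast
  have "B = V" using B(2,3) by (simp add: card_subset_eq)
  with B show ?thesis by (intro that[of p]) (auto simp: nu_def)
qed

text \<open>Reduce at a vertex \<open>q\<close> in debt. If \<open>q\<close> stays in debt, the
  burning order dominates the reduced divisor; otherwise the total debt has dropped.\<close>

lemma not_eeff_le_nu:
  assumes "\<not> eeff D"
  shows "\<exists>p D'. inj_on p V \<and> sim D D' \<and> (\<forall>v\<in>V. D' v \<le> nu p v)"
  using assms
proof (induction "nat (\<Sum>v\<in>V. - min 0 (D v))" arbitrary: D rule: less_induct)
  case (less D)
  obtain q where q: "q \<in> V" "D q < 0" using less.prems eff_eeff unfolding eff_def by (meson not_le)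
  obtain D' where D': "sim D D'" "\<forall>v\<in>V - {q}. min 0 (D v) \<le> D' v" "D q \<le> D' q" "reduced q D'"
    using exists_no_legal_avoiding[OF q(1), of D] by blast
  show ?case
  proof (cases "D' q < 0")
    case True
    obtain p where p: "inj_on p V" "\<And>v. v \<in> V - {q} \<Longrightarrow> D' v \<le> nu p v" "nu p q = -1"
      using burning_order[OF q(1) D'(4)] by blast
    have "D' v \<le> nu p v" if "v \<in> V" for v
      using p(2)[of v] p(3) True that by (cases "v = q") auto
    then show ?thesis using p(1) D'(1) by blast
  next
    case False
    have "(\<Sum>v\<in>V. - min 0 (D' v)) < (\<Sum>v\<in>V. - min 0 (D v))"
    proof (rule sum_strict_mono_ex1)
      show "\<forall>v\<in>V. - min 0 (D' v) \<le> - min 0 (D v)"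
      proof
        fix v assume "v \<in> V"
        then show "- min 0 (D' v) \<le> - min 0 (D v)" using D'(2) q False by (cases "v = q") force+
      qed
      show "\<exists>v\<in>V. - min 0 (D' v) < - min 0 (D v)" using q False by (intro bexI[of _ q]) auto
    qed simp
    moreover have "0 \<le> (\<Sum>v\<in>V. - min 0 (D' v))" by (intro sum_nonneg) auto
    ultimately have lt: "nat (\<Sum>v\<in>V. - min 0 (D' v)) < nat (\<Sum>v\<in>V. - min 0 (D v))" by linarith
    have "\<not> eeff D'" using less.prems eeff_sim D'(1) sim_sym by blast
    from less.hyps[OF lt this] show ?thesis using D'(1) sim_trans by blast
  qed
qed

text \<open>Baker and Norine's argument. If \<open>E\<close> obstructs \<open>canon - D\<close>,
  then \<open>canon - D - E\<close> is equivalent to some \<open>D'\<close> below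
  \<open>nu p\<close>. The effective divisor \<open>F = nu p - D'\<close> obstructs
  \<open>D\<close>, because \<open>D - F + E\<close> is equivalent to \<open>canon - nu p\<close>,
  the divisor of the reversed order.\<close>

lemma riemann_roch_not:
  assumes "\<not> rk (canon - D) s"
  shows "0 \<le> int s + dg D - gen + 1" "\<not> rk D (nat (int s + dg D - gen + 1))"
proof -
  obtain E where E: "eff E" "dg E = int s" "\<not> eeff (canon - D - E)" using assms by (auto simp: rk_def)
  obtain p D' where p: "inj_on p V" and D': "sim (canon - D - E) D'" and le: "\<forall>v\<in>V. D' v \<le> nu p v"
    using not_eeff_le_nu[OF E(3)] by blast
  define F where "F = nu p - D'"
  have F: "eff F" using le by (simp add: F_def eff_def)
  have dF: "dg F = int s + dg D - gen + 1"
    using sim_dg[OF D'] E(2) dg_nu[OF p] by (simp add: F_def dg_diff)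
  show "0 \<le> int s + dg D - gen + 1" using eff_dg[OF F] dF by simp
  define N where "N = Max (p ` V)"
  have N: "p v \<le> N" if "v \<in> V" for v unfolding N_def using that by (intro Max_ge) auto
  define p' where "p' = (\<lambda>u. N - p u)"
  have "\<not> eeff (D - F)"
  proof
    assume "eeff (D - F)"
    then have "eeff (D - F + E)" using E(1) eeff_add eff_eeff by blast
    moreover have "sim (D - F + E) (nu p')"
    proof -
      have "sim (D + (D' - nu p) + E) (D + ((canon - D - E) - nu p) + E)"
        by (rule sim_add[OF sim_add[OF sim_refl sim_diff[OF sim_sym[OF D'] sim_refl]] sim_refl])
      then show ?thesis
        by (rule sim_eq) (use nu_reverse[OF p N] in \<open>auto simp: F_def p'_def\<close>)
    qed
    ultimately show False using eeff_sim nu_not_eeff by blast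
  qed
  then show "\<not> rk D (nat (int s + dg D - gen + 1))"
    using F dF eff_dg[OF F] unfolding rk_def by force
qed

lemma riemann_roch:
  assumes "rk D r" "int s \<le> int r - dg D + gen - 1"
  shows "rk (canon - D) s"
proof (rule ccontr)
  assume "\<not> rk (canon - D) s"
  from riemann_roch_not[OF this] have "\<not> rk D (nat (int s + dg D - gen + 1))" by simp
  moreover have "nat (int s + dg D - gen + 1) \<le> r" using assms(2) by linarith
  ultimately show False using assms(1) rk_mono by blast
qed

lemma rk_large: "int r + gen \<le> dg D \<Longrightarrow> rk D r"
proof (rule ccontr)
  assume le: "int r + gen \<le> dg D" and "\<not> rk D r"
  then have "\<not> rk (canon - (canon - D)) r" by simp
  from riemann_roch_not(1)[OF this] le show False by (simp add: dg_diff dg_canon)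
qed

lemma gen_nonneg: "0 \<le> gen"
proof (rule ccontr)
  assume "\<not> 0 \<le> gen"
  obtain v where v: "v \<in> V" by (rule exists_V)
  have "rk (- pt v) 0"
    using \<open>\<not> 0 \<le> gen\<close> dg_diff[of 0 "pt v"] dg_pt[OF v] by (intro rk_large) (simp add: dg_def)
  then show False using rk_dg[of "- pt v" 0] dg_diff[of 0 "pt v"] dg_pt[OF v] by (simp add: dg_def)
qed

text \<open>Rank equal to degree would persist under multiples. For the multiple by
  \<open>gen\<close>, the residual divisor would need rank at least \<open>gen - 1\<close>, which
  exceeds its degree.\<close>

lemma rk_lt_dg:
  assumes "1 \<le> gen" "rk D r" "1 \<le> r"
  shows "int r < dg D"
proof (rule ccontr)
  assume "\<not> int r < dg D"
  then have d: "dg D = int r" using rk_dg[OF assms(2)] by simp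
  have step: "rk (\<lambda>v. int k * D v) (k * r)" for k
  proof (induction k)
    case 0
    then show ?case by (simp add: rk_0 eff_eeff eff_def)
  next
    case (Suc k)
    have "(\<lambda>v. int (Suc k) * D v) = D + (\<lambda>v. int k * D v)" by (auto simp: algebra_simps)
    then show ?case using rk_add[OF assms(2) Suc] by simp
  qed
  define g where "g = nat gen"
  have g: "gen = int g" "1 \<le> g" using assms(1) by (auto simp: g_def)
  have dk: "dg (\<lambda>v. int g * D v) = int (g * r)" using d by (simp add: dg_def sum_distrib_left[symmetric])
  have "rk (canon - (\<lambda>v. int g * D v)) (g - 1)"
    using riemann_roch[OF step, of "g - 1" g] dk g by (simp add: of_nat_diff)
  from rk_dg[OF this] have "int g - 1 \<le> 2 * int g - 2 - int g * int r"
    using dk g by (simp add: dg_diff dg_canon of_nat_diff)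
  moreover have "int g \<le> int g * int r" using assms(3) g by (simp add: mult_le_cancel_left1)
  ultimately show False using g by linarith
qed

text \<open>Adding \<open>D\<close> and its residual gives \<open>canon\<close> rank at least
  \<open>r + s\<close>. If the bound failed, this would be at least \<open>gen\<close>, and duality
  would give rank 1 in degree 0.\<close>

lemma clifford:
  assumes "rk D r" "dg D \<le> int r + gen - 1" 
  shows "2 * int r \<le> dg D"
proof (cases "1 \<le> gen")
  case True
  define g where "g = nat gen"
  have g: "gen = int g" "1 \<le> g" using True by (auto simp: g_def)
  define s where "s = nat (int r - dg D + gen - 1)"
  have s: "int s = int r - dg D + gen - 1" using assms(2) by (simp add: s_def)
  have "rk (D + (canon - D)) (r + s)" using rk_add[OF assms(1) riemann_roch[OF assms(1)]] s by simp
  then have K: "rk canon (r + s)" by simp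
  show ?thesis
  proof (rule ccontr)
    assume "\<not> 2 * int r \<le> dg D"
    then have "g \<le> r + s" using s g by linarith
    then have "rk canon g" using K rk_mono by blast
    then have "rk (canon - canon) 1" using riemann_roch[of canon g 1] dg_canon g by simp
    then show False using rk_dg[of "canon - canon" 1] by (simp add: dg_def)
  qed
next
  case False
  then have "gen = 0" using gen_nonneg by simp
  then show ?thesis using assms rk_dg by fastforce
qed

subsection \<open>Divisors of small degree and level sets\<close>

lemma sum_pt [simp]: "finite U \<Longrightarrow> sum (pt x) U = (if x \<in> U then 1 else 0)"
  by (simp add: pt_def)

lemma eff_sub_pt: "eff E \<Longrightarrow> 0 < E x \<Longrightarrow> eff (E - pt x)"
  by (auto simp: eff_def pt_def)

lemma eff_dg1:
  assumes "eff E" "dg E = 1"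
  obtains p where "p \<in> V" "\<And>v. v \<in> V \<Longrightarrow> E v = pt p v"
proof -
  obtain p where p: "p \<in> V" "0 < E p" using dg_pos_chip[of E] assms(2) by auto
  have "(E - pt p) v = 0" if "v \<in> V" for v
    using eff_dg_0[OF eff_sub_pt[OF assms(1) p(2)] _ that] assms(2) p(1) by (simp add: dg_diff dg_pt)
  then show ?thesis using that[OF p(1)] by simp
qed

lemma eff_dg2:
  assumes "eff E" "dg E = 2"
  obtains p q where "p \<in> V" "q \<in> V" "\<And>v. v \<in> V \<Longrightarrow> E v = pt p v + pt q v"
proof -
  obtain p where p: "p \<in> V" "0 < E p" using dg_pos_chip[of E] assms(2) by auto
  have "dg (E - pt p) = 1" using assms(2) p by (simp add: dg_diff dg_pt)
  then obtain q where q: "q \<in> V" "\<And>v. v \<in> V \<Longrightarrow> (E - pt p) v = pt q v"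
    using eff_dg1[OF eff_sub_pt[OF assms(1) p(2)]] by blast
  then show ?thesis using that[OF p(1) q(1)] by (force simp: algebra_simps)
qed

lemma outdeg_antimono: "U \<subseteq> W \<Longrightarrow> W \<subseteq> V \<Longrightarrow> outdeg W x \<le> outdeg U x"
  unfolding outdeg_def by (intro sum_mono2) auto

lemma legal_cut: "legal U E \<Longrightarrow> cut U \<le> sum E U"
  unfolding legal_def cut_def by (intro sum_mono) auto

lemma legal_cut_dg: "legal U E \<Longrightarrow> eff E \<Longrightarrow> cut U \<le> dg E"
proof -
  assume "legal U E" "eff E"
  then have "sum E U \<le> sum E V" by (intro sum_mono2) (auto simp: legal_def eff_def)
  then show ?thesis using legal_cut[OF \<open>legal U E\<close>] by (simp add: dg_def)
qed

lemma flow_level: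
  assumes "\<And>v. v \<in> V \<Longrightarrow> A v - B v = lap f v" "U = {v \<in> V. t < f v}"
  shows "cut U \<le> sum A U - sum B U"
proof -
  have "sum A U - sum B U = (\<Sum>v\<in>U. lap f v)"
    unfolding sum_subtractf[symmetric] using assms by (intro sum.cong) auto
  then show ?thesis using level_cut[OF assms(2)] by simp
qed

lemma lap_nonconst:
  assumes "v \<in> V" "lap f v \<noteq> 0"
  obtains a b where "a \<in> V" "b \<in> V" "f b < f a"
proof -
  have "\<exists>u\<in>V. f u \<noteq> f v"
  proof (rule ccontr)
    assume "\<not> (\<exists>u\<in>V. f u \<noteq> f v)"
    then have "lap f v = 0" unfolding lap_def by (intro sum.neutral) auto
    with assms show False by simp
  qed
  then show ?thesis using that assms(1) by (metis linorder_neqE)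
qed

lemma between_le_cut: "Z \<subseteq> U \<Longrightarrow> U \<subseteq> V \<Longrightarrow> Y \<subseteq> V - U \<Longrightarrow> between Z Y \<le> cut U"
  unfolding cut_between by (rule between_mono) auto

section \<open>Three-edge-connection and solid sets\<close>

text \<open>\<open>rel x y\<close> says that \<open>x\<close> and \<open>y\<close> are joined by three edge-disjoint paths (Menger).\<close>

definition rel :: "'a \<Rightarrow> 'a \<Rightarrow> bool" where
  "rel x y \<longleftrightarrow> (\<forall>U. U \<subseteq> V \<longrightarrow> x \<in> U \<longrightarrow> y \<notin> U \<longrightarrow> 3 \<le> cut U)"

lemma rel_sym: "x \<in> V \<Longrightarrow> y \<in> V \<Longrightarrow> rel x y \<Longrightarrow> rel y x"
  unfolding rel_def
proof (intro allI impI)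
  fix U assume "x \<in> V" "y \<in> V" and r: "\<forall>U\<subseteq>V. x \<in> U \<longrightarrow> y \<notin> U \<longrightarrow> 3 \<le> cut U" and U: "U \<subseteq> V" "y \<in> U" "x \<notin> U"
  then have "3 \<le> cut (V - U)" by (intro r[rule_format]) auto
  then show "3 \<le> cut U" using cut_compl[OF U(1)] by simp
qed

lemma rel_trans: "rel x y \<Longrightarrow> rel y z \<Longrightarrow> rel x z"
  unfolding rel_def by metis

lemma relD: "rel x y \<Longrightarrow> U \<subseteq> V \<Longrightarrow> x \<in> U \<Longrightarrow> y \<notin> U \<Longrightarrow> 3 \<le> cut U"
  by (auto simp: rel_def)

text \<open>The solid sets are those that induce a 2-edge-connected subgraph.\<close>

definition solid :: "'a set \<Rightarrow> bool" where
  "solid A \<longleftrightarrow> A \<subseteq> V \<and> (\<forall>Z. Z \<subseteq> A \<longrightarrow> Z \<noteq> {} \<longrightarrow> Z \<noteq> A \<longrightarrow> 2 \<le> between Z (A - Z))"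

lemma solid_split: "solid A \<Longrightarrow> a \<in> A \<Longrightarrow> a \<in> U \<Longrightarrow> b \<in> A \<Longrightarrow> b \<notin> U \<Longrightarrow> 2 \<le> between (A \<inter> U) (A - U)"
proof -
  assume "solid A" "a \<in> A" "a \<in> U" "b \<in> A" "b \<notin> U"
  then have "2 \<le> between (A \<inter> U) (A - (A \<inter> U))" unfolding solid_def by blast
  then show ?thesis by (simp add: Diff_Int_distrib Diff_Int)
qed

text \<open>Each solid set split by \<open>U\<close> supplies two boundary edges, and disjointness
  keeps these apart.\<close>

lemma cut_two_solid:
  assumes "solid A" "solid B" "A \<inter> B = {}" "U \<subseteq> V"
    and "a \<in> A" "a \<in> U" "a' \<in> A" "a' \<notin> U" "b \<in> B" "b \<in> U" "b' \<in> B" "b' \<notin> U"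
  shows "4 \<le> cut U"
proof -
  have AB: "A \<subseteq> V" "B \<subseteq> V" using assms by (auto simp: solid_def)
  have "between (A \<inter> U) (A - U) + between (B \<inter> U) (B - U)
      \<le> between (A \<inter> U) (V - U) + between (B \<inter> U) (V - U)"
    using AB assms(4) by (intro add_mono between_mono) auto
  also have "\<dots> = between (A \<inter> U \<union> B \<inter> U) (V - U)"
    using AB assms(3) by (intro between_Un_left[symmetric]) auto
  also have "\<dots> \<le> cut U" using assms(4) by (intro between_le_cut) auto
  finally show ?thesis
    using solid_split[OF assms(1,5-8)] solid_split[OF assms(2,9-12)] by simp
qed

lemma cut_solid_edge:
  assumes "B \<subseteq> V" "U \<subseteq> V" "a \<in> U" "b \<in> V - U" "a \<notin> B \<or> b \<notin> B"
  shows "between (B \<inter> U) (B - U) + w a b \<le> cut U"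
proof (cases "a \<in> B")
  case False
  have "between (B \<inter> U) (B - U) + between {a} {b} \<le> between (B \<inter> U) (V - U) + between {a} (V - U)"
    using assms by (intro add_mono between_mono) auto
  also have "\<dots> = between (B \<inter> U \<union> {a}) (V - U)"
    using assms False by (intro between_Un_left[symmetric]) auto
  also have "\<dots> \<le> cut U" using assms by (intro between_le_cut) auto
  finally show ?thesis by (simp add: between_def)
next
  case True
  then have "b \<notin> B" using assms by auto
  have "between (B \<inter> U) (B - U) + between {a} {b} \<le> between U (B - U) + between U {b}"
    using assms by (intro add_mono between_mono) auto
  also have "\<dots> = between U (B - U \<union> {b})"
    using assms \<open>b \<notin> B\<close> by (intro between_Un_right[symmetric]) auto
  also have "\<dots> \<le> cut U" using assms by (intro between_le_cut) auto
  finally show ?thesis by (simp add: between_def)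
qed

lemma reach_reduced:
  assumes "eeff (R - pt b)" "b \<in> V" "eff R" "reduced u R" "R b = 0"
  obtains S where "legal S R" "b \<notin> S" "u \<in> S"
  using exists_legal[OF assms(3,2,5,1)] assms(4) unfolding reduced_def by blast

lemma rk1_at:
  assumes "rk R 1" "u \<in> V"
  obtains R' where "sim R R'" "eff R'" "reduced u R'" "1 \<le> R' u"
proof -
  have "eeff R" using assms(1) rk_eeff by blast
  from exists_reduced[OF assms(2) this] obtain R' where R': "sim R R'" "eff R'" "reduced u R'" by blast
  have "R' u \<noteq> 0"
  proof
    assume "R' u = 0"
    moreover have "eeff (R' - pt u)" using rk_sim[OF assms(1) R'(1)] assms(2) by (simp only: rk_1)
    ultimately obtain S where "legal S R'" "u \<notin> S" using exists_legal[OF R'(2) assms(2)] by blast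
    then show False using R'(3) by (auto simp: reduced_def)
  qed
  then show ?thesis using that R' assms(2) unfolding eff_def by force
qed

text \<open>Bring a chip to \<open>u\<close> in reduced position. If \<open>b\<close> has no chip,
  reaching it takes a legal set that contains \<open>u\<close> and splits \<open>B\<close>; two
  edges then cross inside \<open>B\<close>, paid for by chips in \<open>B\<close>.\<close>

lemma rk1_solid:
  assumes "rk R 1" "solid B" "u \<in> B" "b \<in> B" "b \<noteq> u"
  obtains R' where "sim R R'" "eff R'" "1 \<le> R' u" "2 \<le> sum R' B"
proof -
  have BV: "B \<subseteq> V" using assms(2) by (simp add: solid_def)
  from rk1_at[OF assms(1), of u] obtain R' where R': "sim R R'" "eff R'" "reduced u R'" "1 \<le> R' u"
    using assms(3) BV by blast
  have nn: "0 \<le> R' v" if "v \<in> B" for v using R'(2) that BV by (auto simp: eff_def)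
  have "2 \<le> sum R' B"
  proof (cases "R' b = 0")
    case True
    have "eeff (R' - pt b)" using rk_sim[OF assms(1) R'(1)] assms(4) BV by (auto simp only: rk_1)
    from reach_reduced[OF this _ R'(2,3) True] obtain S where S: "legal S R'" "b \<notin> S" "u \<in> S"
      using assms(4) BV by blast
    then have SV: "S \<subseteq> V" by (simp add: legal_def)
    have "2 \<le> between (B \<inter> S) (B - S)" using solid_split[OF assms(2,3) S(3) assms(4) S(2)] .
    also have "\<dots> \<le> between (B \<inter> S) (V - S)" using BV SV by (intro between_mono) auto
    also have "\<dots> = (\<Sum>x\<in>B \<inter> S. outdeg S x)" by (simp add: between_def outdeg_def)
    also have "\<dots> \<le> sum R' (B \<inter> S)" using S(1) by (intro sum_mono) (auto simp: legal_def)
    also have "\<dots> \<le> sum R' B" using nn BV by (intro sum_mono2) auto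
    finally show ?thesis .
  next
    case False
    then have "1 \<le> R' b" using nn[OF assms(4)] by simp
    have "R' u + R' b = sum R' {u, b}" using assms(5) by simp
    also have "\<dots> \<le> sum R' B" using nn assms(3,4) BV by (intro sum_mono2) auto
    finally show ?thesis using \<open>1 \<le> R' b\<close> R'(4) by simp
  qed
  then show ?thesis using that R' by blast
qed

section \<open>Submodularity of cuts\<close>

text \<open>Posimodularity in exact form, by sorting the edges among the four corners of
  \<open>U\<close> and \<open>W\<close>; the edges from the intersection to the outside are the
  defect.\<close>

lemma cut_submodular_corner:
  assumes "U \<subseteq> V" "W \<subseteq> V"
  shows "cut (U - W) + cut (W - U) + 2 * between (U \<inter> W) (V - (U \<union> W)) = cut U + cut W"
proof -
  define A where "A = U - W" define B where "B = W - U"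
  define C where "C = U \<inter> W" define Z where "Z = V - (U \<union> W)"
  have d: "A \<subseteq> V" "B \<subseteq> V" "C \<subseteq> V" "Z \<subseteq> V" using assms by (auto simp: A_def B_def C_def Z_def)
  have disj: "A \<inter> B = {}" "A \<inter> C = {}" "A \<inter> Z = {}" "B \<inter> C = {}" "B \<inter> Z = {}" "C \<inter> Z = {}"
    by (auto simp: A_def B_def C_def Z_def)
  have "cut (U - W) = between A (B \<union> C \<union> Z)" "cut (W - U) = between B (A \<union> C \<union> Z)"
    "cut U = between (A \<union> C) (B \<union> Z)" "cut W = between (B \<union> C) (A \<union> Z)"
    unfolding cut_between using assms
    by (auto simp: A_def B_def C_def Z_def intro!: arg_cong2[where f = between])
  moreover have "between A (B \<union> C \<union> Z) = between A B + between A C + between A Z"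
    "between B (A \<union> C \<union> Z) = between A B + between B C + between B Z"
    "between (A \<union> C) (B \<union> Z) = between A B + between B C + between A Z + between C Z"
    "between (B \<union> C) (A \<union> Z) = between A B + between A C + between B Z + between C Z"
    using d disj by (auto simp: between_Un_left between_Un_right Int_Un_distrib Int_Un_distrib2 between_commute)
  ultimately show ?thesis by (simp add: C_def Z_def)
qed

lemma cut_submodular:
  assumes "U \<subseteq> V" "W \<subseteq> V"
  shows "cut (U \<inter> W) + cut (U \<union> W) \<le> cut U + cut W"
proof -
  have e: "U - (V - W) = U \<inter> W" "(V - W) - U = V - (U \<union> W)" using assms by auto
  have "cut (U - (V - W)) + cut ((V - W) - U) \<le> cut U + cut (V - W)"
    using cut_submodular_corner[OF assms(1) Diff_subset, of W] between_nonneg[of "U \<inter> (V - W)" "V - (U \<union> (V - W))"] by linarith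
  then show ?thesis unfolding e using cut_compl[of W] cut_compl[of "U \<union> W"] assms by simp
qed

lemma cut_Un_disjoint:
  assumes "A \<subseteq> V" "B \<subseteq> V" "A \<inter> B = {}"
  shows "cut (A \<union> B) = cut A + cut B - 2 * between A B"
proof -
  have AB: "V - A = B \<union> (V - (A \<union> B))" "V - B = A \<union> (V - (A \<union> B))" using assms by auto
  have "cut A = between A B + between A (V - (A \<union> B))"
    unfolding cut_between AB(1) using assms by (intro between_Un_right) auto
  moreover have "cut B = between A B + between B (V - (A \<union> B))"
    unfolding cut_between AB(2) using assms between_commute[of A B] by (subst between_Un_right) auto
  moreover have "cut (A \<union> B) = between A (V - (A \<union> B)) + between B (V - (A \<union> B))"
    unfolding cut_between using assms by (intro between_Un_left) auto
  ultimately show ?thesis by simp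
qed

end

section \<open>Flows in bridgeless graphs\<close>

locale bridgeless_graph = chip_graph +
  assumes bridgeless: "U \<subseteq> V \<Longrightarrow> U \<noteq> {} \<Longrightarrow> U \<noteq> V \<Longrightarrow> 2 \<le> cut U"
begin

text \<open>The script between two different divisors is nonconstant, and without bridges its
  superlevel sets move at least two chips.\<close>

lemma nontrivial_flow:
  assumes "sim A B" "v \<in> V" "A v \<noteq> B v"
  obtains U where "U \<subseteq> V" "2 \<le> cut U" "cut U \<le> sum A U - sum B U"
proof -
  obtain f where f: "\<And>v. v \<in> V \<Longrightarrow> A v - B v = lap f v" using assms(1) by (auto simp: sim_def)
  have "lap f v \<noteq> 0" using f[OF assms(2)] assms(3) by simp
  then obtain a b where ab: "a \<in> V" "b \<in> V" "f b < f a" using lap_nonconst[OF assms(2)] by blast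
  define U where "U = {v \<in> V. f b < f v}"
  have "2 \<le> cut U" by (rule bridgeless) (use ab in \<open>auto simp: U_def\<close>)
  then show ?thesis using that[of U] flow_level[OF f U_def] by (auto simp: U_def)
qed

lemma pt_sim_eq:
  assumes "x \<in> V" "y \<in> V" "sim (pt x) (pt y)"
  shows "x = y"
proof (rule ccontr)
  assume "x \<noteq> y"
  then have "pt x x \<noteq> pt y x" by (simp add: pt_def)
  from nontrivial_flow[OF assms(3,1) this] obtain U where
    "U \<subseteq> V" "2 \<le> cut U" "cut U \<le> sum (pt x) U - sum (pt y) U" by blast
  then show False by (auto split: if_splits)
qed

end

section \<open>Divisors of degree 4 and rank 2\<close>

locale rank2_graph = bridgeless_graph +
  fixes D :: "'a \<Rightarrow> int"
  assumes rk_D: "rk D 2" and dg_D: "dg D = 4"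
begin

lemma eeff_D2: "x \<in> V \<Longrightarrow> y \<in> V \<Longrightarrow> eeff (D - pt x - pt y)"
  using rk_D by (simp only: rk_2)

lemma rk_D1: "x \<in> V \<Longrightarrow> rk (D - pt x) 1"
  using rk_D by (simp add: numeral_2_eq_2 rk_Suc)

text \<open>After subtracting \<open>x\<close> and \<open>y\<close> two chips are left. Reduced at a
  vertex they cannot reach, they both lie off it; a legal set for them that avoids \<open>u\<close>
  is the contradiction sought below.\<close>

lemma unreached_chips:
  assumes "x \<in> V" "y \<in> V" "u \<in> V" "\<not> eeff (D - pt x - pt y - pt u)"
  obtains p q where "p \<in> V" "q \<in> V" "p \<noteq> u" "q \<noteq> u" "sim (D - pt x - pt y) (pt p + pt q)"
    "reduced u (pt p + pt q)"
proof -
  obtain R where R: "sim (D - pt x - pt y) R" "eff R" "reduced u R"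
    using exists_reduced[OF assms(3) eeff_D2[OF assms(1,2)]] by blast
  have dR: "dg R = 2" using sim_dg[OF R(1)] assms dg_D by (simp add: dg_diff dg_pt)
  obtain p q where pq: "p \<in> V" "q \<in> V" "\<And>v. v \<in> V \<Longrightarrow> R v = pt p v + pt q v"
    using eff_dg2[OF R(2) dR] by blast
  have "R u = 0"
  proof (rule ccontr)
    assume "R u \<noteq> 0"
    then have "0 < R u" using R(2) assms(3) by (force simp: eff_def)
    then have "eff (R - pt u)" using eff_sub_pt R(2) by blast
    then have "eeff (D - pt x - pt y - pt u)"
      using eeffI sim_diff[OF R(1) sim_refl] by blast
    with assms(4) show False by simp
  qed
  then have "p \<noteq> u" "q \<noteq> u" using pq(3)[OF assms(3)] by (auto simp: pt_def split: if_splits)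
  moreover have "sim (D - pt x - pt y) (pt p + pt q)"
    using R(1) by (rule sim_eq) (use pq in auto)
  moreover have "reduced u (pt p + pt q)"
    using R(3) pq(3) unfolding reduced_def legal_def by (metis plus_fun_apply subsetD)
  ultimately show ?thesis using that pq by blast
qed

lemma legal_drop:
  assumes "legal U (E + pt y)" "y \<notin> U"
  shows "legal U E"
  unfolding legal_def
proof (intro conjI ballI)
  fix x assume x: "x \<in> U"
  then have "outdeg U x \<le> (E + pt y) x" "x \<noteq> y" using assms by (auto simp: legal_def)
  then show "outdeg U x \<le> E x" by (simp add: pt_def)
qed (use assms in \<open>auto simp: legal_def\<close>)

text \<open>\<open>p + q + y - u\<close> is equivalent to \<open>D - x - u\<close>, so rank 2
  provides a legal set once a chip is added at \<open>y\<close>. The set must use that chip, as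
  \<open>p + q\<close> alone is reduced at \<open>u\<close>.\<close>

lemma legal_extra_chip:
  assumes "x \<in> V" "y \<in> V" "u \<in> V" "u \<noteq> y" "p \<noteq> u" "q \<noteq> u"
    and E: "sim (D - pt x - pt y) (pt p + pt q)" and red: "reduced u (pt p + pt q)"
  obtains U where "legal U (pt p + pt q + pt y)" "u \<notin> U" "y \<in> U"
proof -
  let ?R = "pt p + pt q + pt y"
  have "sim (D - pt x - pt u) (?R - pt u)"
    by (rule sim_eq[OF sim_diff[OF sim_add[OF E sim_refl[of "pt y"]] sim_refl[of "pt u"]]]) auto
  then have "eeff (?R - pt u)" using eeff_D2[OF assms(1,3)] eeff_sim by blast
  moreover have "eff ?R" by (simp add: eff_add)
  moreover have "?R u = 0" using assms(4-6) by (simp add: pt_def)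
  ultimately obtain U where U: "legal U ?R" "u \<notin> U"
    using exists_legal[of ?R u] assms(3) by blast
  have "y \<in> U"
  proof (rule ccontr)
    assume "y \<notin> U"
    then have "legal U (pt p + pt q)" using U(1) legal_drop by blast
    then show False using red U(2) by (auto simp: reduced_def)
  qed
  then show ?thesis using that U by blast
qed

lemma legal_union:
  assumes U: "legal U (pt p + pt q + pt y)" and W: "legal W (pt p + pt q + pt x)"
    and "y \<in> W" "x \<in> U" "x \<noteq> y"
  shows "legal (U \<union> W) (pt p + pt q)"
proof -
  have UW: "U \<subseteq> V" "W \<subseteq> V" "U \<noteq> {}" using U W by (auto simp: legal_def)
  have "outdeg (U \<union> W) z \<le> (pt p + pt q) z" if "z \<in> U \<union> W" for z
  proof -
    have 1: "outdeg (U \<union> W) z \<le> (pt p + pt q + pt y) z" if "z \<in> U"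
      using outdeg_antimono[of U "U \<union> W" z] UW U that by (fastforce simp: legal_def)
    have 2: "outdeg (U \<union> W) z \<le> (pt p + pt q + pt x) z" if "z \<in> W"
      using outdeg_antimono[of W "U \<union> W" z] UW W that by (fastforce simp: legal_def)
    show ?thesis
    proof (cases "z = y")
      case True
      then show ?thesis using 2 assms(3,5) by (simp add: pt_def)
    next
      case False
      show ?thesis
      proof (cases "z \<in> U")
        case True
        then show ?thesis using 1 False by (simp add: pt_def)
      next
        case False
        then have "z \<noteq> x" "z \<in> W" using assms(4) that by auto
        then show ?thesis using 2 by (simp add: pt_def)
      qed
    qed
  qed
  then show ?thesis using UW by (simp add: legal_def)
qed

text \<open>The sets from \<open>legal_extra_chip\<close> are paid for by three chips, so they
  cannot separate \<open>x\<close> from \<open>y\<close>. Each contains both, and their union is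
  legal for \<open>p + q\<close>.\<close>

lemma rk_four_edge_connected:
  assumes xy: "x \<in> V" "y \<in> V" "x \<noteq> y"
    and four: "\<And>U. U \<subseteq> V \<Longrightarrow> x \<in> U \<Longrightarrow> y \<notin> U \<Longrightarrow> 4 \<le> cut U"
  shows "rk (D - pt x - pt y) 1"
  unfolding rk_1
proof (intro ballI, rule ccontr)
  fix u assume u: "u \<in> V" and "\<not> eeff (D - pt x - pt y - pt u)"
  from unreached_chips[OF xy(1,2) this] obtain p q where pq: "p \<in> V" "q \<in> V" "p \<noteq> u" "q \<noteq> u"
    "sim (D - pt x - pt y) (pt p + pt q)" "reduced u (pt p + pt q)" by blast
  have pq': "sim (D - pt y - pt x) (pt p + pt q)"
    using pq(5) by (rule sim_eq) auto
  have no_sep: "\<not> (x \<in> U \<and> y \<notin> U)" "\<not> (y \<in> U \<and> x \<notin> U)" if "cut U \<le> 3" "U \<subseteq> V" for U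
    using four[of U] four[of "V - U"] cut_compl[of U] that xy by auto
  have small: "cut U \<le> 3" "U \<subseteq> V" if "legal U (pt p + pt q + pt z)" "z \<in> V" for U z
    using legal_cut_dg[OF that(1)] pq(1,2) that by (auto simp: eff_add dg_add dg_pt legal_def)
  have Y: "\<exists>U. legal U (pt p + pt q + pt y) \<and> u \<notin> U \<and> y \<in> U \<and> x \<in> U" if "u \<noteq> y"
    using legal_extra_chip[OF xy(1,2) u that pq(3-6)] small no_sep xy by metis
  have X: "\<exists>W. legal W (pt p + pt q + pt x) \<and> u \<notin> W \<and> x \<in> W \<and> y \<in> W" if "u \<noteq> x"
    using legal_extra_chip[OF xy(2,1) u that pq(3,4) pq' pq(6)] small no_sep xy by metis
  show False
  proof (cases "u = x \<or> u = y")
    case True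
    then show False using X Y xy(3) by blast
  next
    case False
    then obtain U W where "legal U (pt p + pt q + pt y)" "u \<notin> U" "x \<in> U"
      "legal W (pt p + pt q + pt x)" "u \<notin> W" "y \<in> W" using X Y by blast
    then have "legal (U \<union> W) (pt p + pt q)" "u \<notin> U \<union> W" using legal_union xy(3) by auto
    then show False using pq(6) by (auto simp: reduced_def)
  qed
qed

text \<open>\<open>D\<close> is equivalent to twice \<open>x + y\<close>. The union argument of
  \<open>rk_four_edge_connected\<close> works once the legal sets contain both points. As 3-cuts may
  now separate these, that is extracted from the flow from \<open>x + y\<close> to
  \<open>p + q\<close>.\<close>

lemma halving:
  assumes xy: "x \<in> V" "y \<in> V" "x \<noteq> y" "rel x y"
    and D2: "sim (D - pt x - pt y) (pt x + pt y)"
  shows "rk (pt x + pt y) 1"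
proof -
  have "rk (D - pt x - pt y) 1"
    unfolding rk_1
  proof (intro ballI, rule ccontr)
    fix u assume u: "u \<in> V" and nu: "\<not> eeff (D - pt x - pt y - pt u)"
    from unreached_chips[OF xy(1,2) this] obtain p q where pq: "p \<in> V" "q \<in> V" "p \<noteq> u" "q \<noteq> u"
      "sim (D - pt x - pt y) (pt p + pt q)" "reduced u (pt p + pt q)" by blast
    have pq': "sim (D - pt y - pt x) (pt p + pt q)"
      using pq(5) by (rule sim_eq) auto
    have T: "sim (pt x + pt y) (pt p + pt q)" using D2 pq(5) sim_sym sim_trans by blast
    have ne: "u \<noteq> x" "u \<noteq> y"
    proof -
      have "sim (D - pt x - pt y - pt x) (pt y)" "sim (D - pt x - pt y - pt y) (pt x)"
        by (rule sim_eq[OF sim_diff[OF D2 sim_refl]]; auto)+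
      then show "u \<noteq> x" "u \<noteq> y" using nu eeffI eff_pt by blast+
    qed
    have key: "z \<in> U" if U: "legal U (pt p + pt q + pt s)" "s \<in> U"
      and zs: "z = x \<and> s = y \<or> z = y \<and> s = x" for U z s
    proof (rule ccontr)
      assume z: "z \<notin> U"
      have UV: "U \<subseteq> V" using U(1) by (simp add: legal_def)
      have sz: "s \<in> V" "z \<in> V" "rel s z" "s \<noteq> z" using zs xy rel_sym by auto
      have "3 \<le> cut U" using relD[OF sz(3) UV U(2) z] .
      also have "\<dots> \<le> sum (pt p + pt q + pt s) U" using legal_cut[OF U(1)] .
      finally have inU: "p \<in> U" "q \<in> U" using UV by (auto simp: sum.distrib split: if_splits)
      have T': "sim (pt s + pt z) (pt p + pt q)" using T zs by (auto simp: add.commute)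
      have "(pt s + pt z) z \<noteq> (pt p + pt q) z" using inU z by (auto simp: pt_def)
      \<comment> \<open>The superlevel set \<open>L\<close> holds \<open>s\<close> and
        \<open>z\<close> but neither \<open>p\<close> nor \<open>q\<close>, and two edges leave it.
        \<open>U\<close> splits it across at most one edge into pieces of cut at least 3, so its cut
        would be at least 3 + 3 - 2 = 4.\<close>
      from nontrivial_flow[OF T' sz(2) this] obtain L where L: "L \<subseteq> V" "2 \<le> cut L"
        "cut L \<le> sum (pt s + pt z) L - sum (pt p + pt q) L" by blast
      then have Lin: "s \<in> L" "z \<in> L" "p \<notin> L" "q \<notin> L" "cut L = 2"
        by (auto simp: sum.distrib split: if_splits)
      have "between (L \<inter> U) (L - U) \<le> between (L \<inter> U) (V - U)"
        using L UV by (intro between_mono) auto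
      also have "\<dots> = (\<Sum>a\<in>L \<inter> U. outdeg U a)" by (simp add: between_def outdeg_def)
      also have "\<dots> \<le> sum (pt p + pt q + pt s) (L \<inter> U)"
        using U(1) by (intro sum_mono) (auto simp: legal_def)
      also have "\<dots> = 1" using Lin U(2) L(1) by (simp add: sum.distrib)
      finally have b: "between (L \<inter> U) (L - U) \<le> 1" .
      have "L \<inter> U \<union> (L - U) = L" by auto
      then have "cut L = cut (L \<inter> U) + cut (L - U) - 2 * between (L \<inter> U) (L - U)"
        using cut_Un_disjoint[of "L \<inter> U" "L - U"] L(1) UV by auto
      moreover have "3 \<le> cut (L \<inter> U)" using relD[OF sz(3), of "L \<inter> U"] UV U(2) z Lin by auto
      moreover have "3 \<le> cut (L - U)"
        using relD[OF rel_sym[OF sz(1,2,3)], of "L - U"] L(1) U(2) z Lin by auto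
      ultimately show False using b Lin(5) by linarith
    qed
    obtain U where U: "legal U (pt p + pt q + pt y)" "u \<notin> U" "y \<in> U"
      using legal_extra_chip[OF xy(1,2) u ne(2) pq(3-6)] by blast
    obtain W where W: "legal W (pt p + pt q + pt x)" "u \<notin> W" "x \<in> W"
      using legal_extra_chip[OF xy(2,1) u ne(1) pq(3,4) pq' pq(6)] by blast
    have "legal (U \<union> W) (pt p + pt q)"
      using legal_union[OF U(1) W(1)] key[OF U(1,3)] key[OF W(1,3)] xy(3) by blast
    then show False using pq(6) U(2) W(2) by (auto simp: reduced_def)
  qed
  then show ?thesis using rk_sim D2 by blast
qed

text \<open>If \<open>u\<close> is unreachable, \<open>U\<close> and \<open>W\<close> each separate
  it from a related vertex, so three edges leave each and all three chips lie inside. Unless the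
  union is legal for \<open>p + q\<close>, uncrossing leaves at most two edges around it, though it
  separates \<open>x\<close> from \<open>u\<close>.\<close>

lemma three_related:
  assumes V: "x \<in> V" "y \<in> V" "u \<in> V" and ne: "x \<noteq> y" "x \<noteq> u" "y \<noteq> u" and r: "rel x u" "rel y u"
  shows "eeff (D - pt x - pt y - pt u)"
proof (rule ccontr)
  assume "\<not> eeff (D - pt x - pt y - pt u)"
  from unreached_chips[OF V this] obtain p q where pq: "p \<in> V" "q \<in> V" "p \<noteq> u" "q \<noteq> u"
    "sim (D - pt x - pt y) (pt p + pt q)" "reduced u (pt p + pt q)" by blast
  have pq': "sim (D - pt y - pt x) (pt p + pt q)"
    using pq(5) by (rule sim_eq) auto
  obtain U where U: "legal U (pt p + pt q + pt y)" "u \<notin> U" "y \<in> U"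
    using legal_extra_chip[OF V(1,2,3) _ pq(3-6)] ne by blast
  obtain W where W: "legal W (pt p + pt q + pt x)" "u \<notin> W" "x \<in> W"
    using legal_extra_chip[OF V(2,1,3) _ pq(3,4) pq' pq(6)] ne by blast
  have UV: "U \<subseteq> V" and WV: "W \<subseteq> V" using U W by (auto simp: legal_def)
  have "3 \<le> sum (pt p + pt q + pt y) U" using relD[OF r(2) UV U(3,2)] legal_cut[OF U(1)] by simp
  then have inU: "p \<in> U" "q \<in> U" using UV by (auto simp: sum.distrib split: if_splits)
  have "3 \<le> sum (pt p + pt q + pt x) W" using relD[OF r(1) WV W(3,2)] legal_cut[OF W(1)] by simp
  then have inW: "p \<in> W" "q \<in> W" using WV by (auto simp: sum.distrib split: if_splits)
  have cU: "cut U \<le> 3" using legal_cut_dg[OF U(1)] pq(1,2) V by (simp add: eff_add dg_add dg_pt)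
  have cW: "cut W \<le> 3" using legal_cut_dg[OF W(1)] pq(1,2) V by (simp add: eff_add dg_add dg_pt)
  have big: "3 \<le> cut (U \<union> W)" using relD[OF r(1), of "U \<union> W"] UV WV U W by auto
  \<comment> \<open>\<open>W - U\<close> holds just the chip \<open>x\<close>, so at most one of its
    edges leaves \<open>W\<close> and at least two run into \<open>U\<close>. As
    \<open>cut U\<close> is at most 3, \<open>U\<close> and \<open>W - U\<close> each have at most
    one edge out of the union.\<close>
  have impossible: False
    if 1: "legal U (pt p + pt q + pt y)" "y \<in> U" "x \<notin> U" "p \<in> U" "q \<in> U" "cut U \<le> 3" "u \<notin> U"
      and 2: "legal W (pt p + pt q + pt x)" "x \<in> W" "y \<in> W" "u \<notin> W" and xu: "rel x u" for U W x y
  proof -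
    have UV: "U \<subseteq> V" and WV: "W \<subseteq> V" using 1 2 by (auto simp: legal_def)
    have a: "between (W - U) (V - W) \<le> 1"
    proof -
      have "between (W - U) (V - W) = (\<Sum>z\<in>W - U. outdeg W z)" by (simp add: between_def outdeg_def)
      also have "\<dots> \<le> sum (pt p + pt q + pt x) (W - U)"
        using 2(1) by (intro sum_mono) (auto simp: legal_def)
      also have "\<dots> = 1" using 1 2 WV by (simp add: sum.distrib)
      finally show ?thesis .
    qed
    have "3 \<le> cut (W - U)" using relD[OF xu, of "W - U"] WV 1 2 by auto
    also have "cut (W - U) = between (W - U) (V - W) + between (W - U) (W \<inter> U)"
    proof -
      have "V - (W - U) = (V - W) \<union> (W \<inter> U)" using WV UV by auto
      then show ?thesis unfolding cut_between using WV UV by (simp only:) (intro between_Un_right, auto)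
    qed
    finally have b1: "2 \<le> between (W - U) (W \<inter> U)" using a by simp
    have "between (W \<inter> U) (W - U) \<le> between U (W - U)" using UV WV by (intro between_mono) auto
    then have b: "2 \<le> between U (W - U)" using b1 between_commute[of "W - U" "W \<inter> U"] by simp
    have "cut U = between U (W - U) + between U (V - (U \<union> W))"
    proof -
      have "V - U = (W - U) \<union> (V - (U \<union> W))" using WV by auto
      then show ?thesis unfolding cut_between using WV UV by (simp only:) (intro between_Un_right, auto)
    qed
    then have c: "between U (V - (U \<union> W)) \<le> 1" using b 1(6) by simp
    have "cut (U \<union> W) = between (U \<union> (W - U)) (V - (U \<union> W))" by (simp add: cut_between)
    also have "\<dots> = between U (V - (U \<union> W)) + between (W - U) (V - (U \<union> W))"
      using UV WV by (intro between_Un_left) auto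
    also have "\<dots> \<le> 1 + between (W - U) (V - W)"
      using UV WV c by (intro add_mono between_mono) auto
    finally have "cut (U \<union> W) \<le> 2" using a by simp
    moreover have "3 \<le> cut (U \<union> W)" using relD[OF xu, of "U \<union> W"] UV WV 1 2 by auto
    ultimately show False by simp
  qed
  consider "x \<in> U" "y \<in> W" | "x \<notin> U" "y \<in> W" | "x \<in> U" "y \<notin> W" | "x \<notin> U" "y \<notin> W" by blast
  then show False
  proof cases
    case 1
    then have "legal (U \<union> W) (pt p + pt q)" using legal_union[OF U(1) W(1)] ne by blast
    then show False using pq(6) U(2) W(2) by (auto simp: reduced_def)
  next
    case 2
    then show False using impossible[of U y x W] U W inU cU r by blast
  next
    case 3
    then show False using impossible[of W x y U] U W inW cW r by blast
  next
    case 4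
    \<comment> \<open>Both corners separate related pairs and use up the cuts of \<open>U\<close>
      and \<open>W\<close>. So no edge leaves the union from the intersection, and each corner has
      one chip to pay with.\<close>
    have "3 \<le> cut (U - W)" using relD[OF r(2), of "U - W"] UV U 4 by auto
    moreover have "3 \<le> cut (W - U)" using relD[OF r(1), of "W - U"] WV W 4 by auto
    ultimately have z: "between (U \<inter> W) (V - (U \<union> W)) = 0"
      using cut_submodular_corner[OF UV WV] cU cW between_nonneg[of "U \<inter> W" "V - (U \<union> W)"] by linarith
    have one: "between (A - B) (V - A) \<le> 1" if "legal A (pt p + pt q + pt s)" "p \<in> B" "q \<in> B" "A \<subseteq> V" for A B s
    proof -
      have "between (A - B) (V - A) = (\<Sum>z\<in>A - B. outdeg A z)" by (simp add: between_def outdeg_def)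
      also have "\<dots> \<le> sum (pt p + pt q + pt s) (A - B)"
        using that(1) by (intro sum_mono) (auto simp: legal_def)
      also have "\<dots> \<le> 1" using that by (auto simp: sum.distrib)
      finally show ?thesis .
    qed
    have "U \<union> W = (U \<inter> W) \<union> ((U - W) \<union> (W - U))" by auto
    then have "cut (U \<union> W) = between ((U \<inter> W) \<union> ((U - W) \<union> (W - U))) (V - (U \<union> W))" by (simp add: cut_between)
    also have "\<dots> = between (U \<inter> W) (V - (U \<union> W)) + (between (U - W) (V - (U \<union> W)) + between (W - U) (V - (U \<union> W)))"
      using UV WV by (subst between_Un_left, auto)+
    also have "\<dots> \<le> 0 + (between (U - W) (V - U) + between (W - U) (V - W))"
      using UV WV z by (intro add_mono between_mono) auto
    also have "\<dots> \<le> 2" using one[OF U(1) inW UV] one[OF W(1) inU WV] by simp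
    finally show False using big by simp
  qed
qed

lemma chip_in_solid:
  assumes "z \<in> V" "solid B" "u \<in> B" "b \<in> B" "b \<noteq> u"
  obtains c d where "c \<in> B" "d \<in> V" "sim (D - pt z) (pt u + pt c + pt d)"
proof -
  have BV: "B \<subseteq> V" using assms(2) by (simp add: solid_def)
  obtain R where R: "sim (D - pt z) R" "eff R" "1 \<le> R u" "2 \<le> sum R B"
    using rk1_solid[OF rk_D1[OF assms(1)] assms(2-5)] by blast
  have E: "eff (R - pt u)" using eff_sub_pt R by auto
  have "1 \<le> sum (R - pt u) B" using R(4) BV assms(3) by (simp add: sum_subtractf)
  then have "\<exists>c\<in>B. 0 < (R - pt u) c" using sum_nonpos[of B "R - pt u"] by force
  then obtain c where c: "c \<in> B" "0 < (R - pt u) c" by blast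
  have E': "eff (R - pt u - pt c)" using eff_sub_pt E c by blast
  have "dg (R - pt u - pt c) = 1"
  proof -
    have "u \<in> V" "c \<in> V" using assms(3) c(1) BV by auto
    then show ?thesis using sim_dg[OF R(1)] dg_D assms(1) by (simp add: dg_diff dg_pt)
  qed
  from eff_dg1[OF E' this] obtain d where d: "d \<in> V" "\<And>v. v \<in> V \<Longrightarrow> (R - pt u - pt c) v = pt d v" by blast
  have "sim (D - pt z) (pt u + pt c + pt d)"
    by (rule sim_eq[OF R(1)]) (use d(2) in \<open>force simp: algebra_simps\<close>)+
  then show ?thesis using that c d by blast
qed

text \<open>Compare representatives of \<open>D - x\<close> and \<open>D - y\<close> with two chips
  in \<open>B\<close>. A level set separating \<open>x\<close> from \<open>y\<close> would need more
  edges than the chips pay for. So the script is level at \<open>x\<close> and \<open>y\<close> and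
  changes only along edges inside \<open>B\<close>; it is harmonic at \<open>y\<close>, which forces
  the free chip \<open>d\<close> onto \<open>y\<close>.\<close>

lemma solid_pair_chips:
  assumes A: "solid A" and B: "solid B" and AB: "A \<inter> B = {}"
    and xy: "x \<in> A" "y \<in> A" "x \<noteq> y" "rel x y" and u: "u \<in> B" "b \<in> B" "b \<noteq> u"
  shows "\<exists>c\<in>B. sim D (pt x + pt y + pt u + pt c)"
proof -
  have AV: "A \<subseteq> V" and BV: "B \<subseteq> V" using A B by (auto simp: solid_def)
  have V: "x \<in> V" "y \<in> V" "u \<in> V" using xy u AV BV by auto
  obtain c d where cd: "c \<in> B" "d \<in> V" "sim (D - pt x) (pt u + pt c + pt d)"
    using chip_in_solid[OF V(1) B u] by blast
  obtain c' d' where cd': "c' \<in> B" "d' \<in> V" "sim (D - pt y) (pt u + pt c' + pt d')"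
    using chip_in_solid[OF V(2) B u] by blast
  have yB: "y \<notin> B" "x \<notin> B" using xy AB by auto
  have "sim (D - pt u) (pt x + pt c + pt d)"
    by (rule sim_eq[OF sim_diff[OF sim_add[OF cd(3) sim_refl[of "pt x"]] sim_refl[of "pt u"]]]) auto
  moreover have "sim (D - pt u) (pt y + pt c' + pt d')"
    by (rule sim_eq[OF sim_diff[OF sim_add[OF cd'(3) sim_refl[of "pt y"]] sim_refl[of "pt u"]]]) auto
  ultimately have "sim (pt x + pt c + pt d) (pt y + pt c' + pt d')" using sim_sym sim_trans by blast
  then obtain f where f: "\<And>v. v \<in> V \<Longrightarrow> (pt x + pt c + pt d) v - (pt y + pt c' + pt d') v = lap f v"
    by (auto simp: sim_def)
  have flow: "cut U \<le> sum (pt x + pt c + pt d) U - sum (pt y + pt c' + pt d') U" "U \<subseteq> V"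
    if "U = {v \<in> V. t < f v}" for U t
    using flow_level[OF f that] that by auto
  have "\<not> f y < f x"
  proof
    assume lt: "f y < f x"
    define U where "U = {v \<in> V. f y < f v}"
    have U: "x \<in> U" "y \<notin> U" using lt V by (auto simp: U_def)
    have "3 \<le> cut U" using relD[OF xy(4) flow(2)[OF U_def] U] .
    then have in_out: "c \<in> U" "c' \<notin> U" "cut U \<le> 3"
      using flow[OF U_def] U by (auto simp: sum.distrib split: if_splits)
    have "4 \<le> cut U"
      using cut_two_solid[OF A B AB flow(2)[OF U_def] xy(1) U(1) xy(2) U(2) cd(1) in_out(1) cd'(1) in_out(2)] .
    with in_out(3) show False by simp
  qed
  moreover have "\<not> f x < f y"
  proof
    assume lt: "f x < f y"
    define U where "U = {v \<in> V. f x < f v}"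
    have U: "y \<in> U" "x \<notin> U" using lt V by (auto simp: U_def)
    have "3 \<le> cut U" using relD[OF rel_sym[OF V(1,2) xy(4)] flow(2)[OF U_def] U] .
    then show False using flow[OF U_def] U by (auto simp: sum.distrib split: if_splits)
  qed
  ultimately have fxy: "f x = f y" by simp
  \<comment> \<open>Such a level set must move two chips, which puts \<open>c\<close> inside and
    \<open>c'\<close> outside. Then \<open>B\<close> contributes two crossing edges and the given
    edge a third.\<close>
  have level: False if "a \<in> V" "b \<in> V" "f b < f a" "w a b \<noteq> 0" "a \<notin> B \<or> b \<notin> B" for a b
  proof -
    define U where "U = {v \<in> V. f b < f v}"
    have U: "a \<in> U" "b \<in> V - U" using that by (auto simp: U_def)
    have xyU: "x \<in> U \<longleftrightarrow> y \<in> U" using fxy V by (simp add: U_def)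
    have "2 \<le> cut U" using bridgeless[OF flow(2)[OF U_def]] U by auto
    then have in_out: "c \<in> U" "c' \<notin> U" "cut U \<le> 2"
      using flow[OF U_def] xyU by (auto simp: sum.distrib split: if_splits)
    have "2 \<le> between (B \<inter> U) (B - U)"
      using solid_split[OF B cd(1) in_out(1) cd'(1) in_out(2)] .
    moreover have "1 \<le> w a b" using that(4) w_nonneg[of a b] by linarith
    ultimately show False
      using cut_solid_edge[OF BV flow(2)[OF U_def] U that(5)] in_out(3) by simp
  qed
  have "lap f y = 0"
    unfolding lap_def
  proof (intro sum.neutral ballI)
    fix v assume "v \<in> V"
    then show "w y v * (f y - f v) = 0"
      using level[of y v] level[of v y] V yB w_sym[of y v] by (cases "f y" "f v" rule: linorder_cases) auto
  qed
  then have "(pt x + pt c + pt d) y = (pt y + pt c' + pt d') y" using f[OF V(2)] by simp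
  then have "d = y" using xy(3) yB cd(1) cd'(1) by (auto simp: pt_def split: if_splits)
  have "sim D (pt x + pt y + pt u + pt c)"
    by (rule sim_eq[OF sim_add[OF cd(3) sim_refl[of "pt x"]]]) (auto simp: \<open>d = y\<close>)
  then show ?thesis using cd(1) by blast
qed

text \<open>\<open>solid_pair_chips\<close> in both directions makes \<open>y + c\<close> equivalent
  to \<open>y' + k\<close>. A nontrivial flow of these two chips would split both solid sets, which
  takes four edges; hence \<open>k = y\<close>.\<close>

lemma disjoint_solid_pairs:
  assumes A: "solid A" and B: "solid B" and AB: "A \<inter> B = {}"
    and xy: "x \<in> A" "y \<in> A" "x \<noteq> y" "rel x y"
    and xy': "x' \<in> B" "y' \<in> B" "x' \<noteq> y'" "rel x' y'"
  shows "sim (D - pt x - pt y) (pt x' + pt y')"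
proof -
  have V: "A \<subseteq> V" "B \<subseteq> V" using A B by (auto simp: solid_def)
  obtain c where c: "c \<in> B" "sim D (pt x + pt y + pt x' + pt c)"
    using solid_pair_chips[OF A B AB xy xy'(1,2)] xy'(3) by blast
  obtain k where k: "k \<in> A" "sim D (pt x' + pt y' + pt x + pt k)"
    using solid_pair_chips[OF B A _ xy' xy(1,2)] xy(3) AB by blast
  have s: "sim (pt y + pt c) (pt y' + pt k)"
    by (rule sim_eq[OF sim_diff[OF sim_trans[OF sim_sym[OF c(2)] k(2)] sim_refl[of "pt x + pt x'"]]]) auto
  have "(pt y + pt c) y = (pt y' + pt k) y"
  proof (rule ccontr)
    assume "(pt y + pt c) y \<noteq> (pt y' + pt k) y"
    with nontrivial_flow[OF s] V xy obtain U where U: "U \<subseteq> V" "2 \<le> cut U"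
      "cut U \<le> sum (pt y + pt c) U - sum (pt y' + pt k) U" by blast
    then have io: "y \<in> U" "c \<in> U" "y' \<notin> U" "k \<notin> U" "cut U \<le> 2"
      by (auto simp: sum.distrib split: if_splits)
    have "4 \<le> cut U" using cut_two_solid[OF A B AB U(1) xy(2) io(1) k(1) io(4) c(1) io(2) xy'(2) io(3)] .
    with io(5) show False by simp
  qed
  moreover have "c \<noteq> y" "y' \<noteq> y" using c(1) xy' xy AB by auto
  ultimately have "k = y" by (auto simp: pt_def split: if_splits)
  show ?thesis
    by (rule sim_eq[OF sim_diff[OF k(2) sim_refl[of "pt x + pt y"]]]) (auto simp: \<open>k = y\<close>)
qed

end

section \<open>Branch vertices in a critical graph of genus 5\<close>

text \<open>A counterexample to \<open>clifford_equality\<close> below. Its contradiction comes from the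
  classes of \<open>rel\<close>: \<open>valence v - 2\<close> sums to 8, every vertex of valence at least 3 has a partner in
  its class, and three points of one class, or pairs from different classes, can be prescribed in
  an effective divisor equivalent to \<open>D\<close>.\<close>

locale critical_graph = rank2_graph +
  assumes no_cut_vertex: "v \<in> V \<Longrightarrow> X \<union> Y = V - {v} \<Longrightarrow> X \<inter> Y = {} \<Longrightarrow> X \<noteq> {} \<Longrightarrow> Y \<noteq> {} \<Longrightarrow> 1 \<le> between X Y"
    and not_hyperelliptic: "dg T = 2 \<Longrightarrow> \<not> rk T 1"
    and gen_5: "gen = 5"
begin

lemma valence_cut: "v \<in> V \<Longrightarrow> valence v = cut {v}"
  unfolding valence_def cut_def outdeg_def by (simp add: sum.remove)

lemma three_cut:
  assumes "x \<in> V" "y \<in> V" "x \<noteq> y"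
  obtains U where "U \<subseteq> V" "x \<in> U" "y \<notin> U" "cut U \<le> 3"
proof -
  have "\<not> rk (D - pt x - pt y) 1"
    using not_hyperelliptic dg_D assms by (simp add: dg_diff dg_pt)
  then obtain U where "U \<subseteq> V" "x \<in> U" "y \<notin> U" "\<not> 4 \<le> cut U" using rk_four_edge_connected[OF assms] by blast
  then show ?thesis using that by auto
qed

lemma not_halved:
  assumes "x \<in> V" "y \<in> V" "x \<noteq> y" "rel x y"
  shows "\<not> sim (D - pt x - pt y) (pt x + pt y)"
  using halving[OF assms] not_hyperelliptic[of "pt x + pt y"] assms by (auto simp: dg_add dg_pt)

text \<open>Otherwise sets of cut at most 2 that avoid \<open>v\<close> cover all other vertices.
  Two of them merge if they meet or are joined by an edge, and as \<open>v\<close> is no cut vertex,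
  merging continues up to \<open>V - {v}\<close>, whose cut is the valence of
  \<open>v\<close>.\<close>

lemma branch_related:
  assumes v: "v \<in> V" "3 \<le> valence v"
  shows "\<exists>y\<in>V. y \<noteq> v \<and> rel v y"
proof (rule ccontr)
  assume "\<not> ?thesis"
  then have no: "\<not> rel v y" if "y \<in> V" "y \<noteq> v" for y using that by blast
  define \<S> where "\<S> = {S. S \<subseteq> V - {v} \<and> S \<noteq> {} \<and> cut S \<le> 2}"
  have fin: "finite \<S>" unfolding \<S>_def by (rule finite_subset[of _ "Pow V"]) auto
  have ex: "\<exists>S\<in>\<S>. y \<in> S" if y: "y \<in> V" "y \<noteq> v" for y
  proof -
    obtain U where U: "U \<subseteq> V" "v \<in> U" "y \<notin> U" "\<not> 3 \<le> cut U" using no[OF y] by (auto simp: rel_def)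
    then show ?thesis using y cut_compl[OF U(1)] by (intro bexI[of _ "V - U"]) (auto simp: \<S>_def)
  qed
  have "\<exists>y\<in>V. y \<noteq> v"
  proof (rule ccontr)
    assume "\<not> (\<exists>y\<in>V. y \<noteq> v)"
    then have "valence v = 0" unfolding valence_def by (intro sum.neutral) (metis w_irrefl)
    then show False using v(2) by simp
  qed
  then have "\<S> \<noteq> {}" using ex by blast
  then have "Max (card ` \<S>) \<in> card ` \<S>" using fin by (intro Max_in) auto
  then obtain S where S: "S \<in> \<S>" "card S = Max (card ` \<S>)" by auto
  have S_max: "card T \<le> card S" if "T \<in> \<S>" for T
    unfolding S(2) using fin that by (intro Max_ge) auto
  have SV: "S \<subseteq> V - {v}" "S \<noteq> {}" "cut S \<le> 2" using S(1) by (auto simp: \<S>_def)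
  have "S \<noteq> V - {v}"
    using SV(3) v cut_compl[of "{v}"] valence_cut[OF v(1)] by auto
  then have "1 \<le> between S (V - {v} - S)" using SV by (intro no_cut_vertex[OF v(1)]) auto
  then obtain s y where sy: "s \<in> S" "y \<in> V - {v} - S" "w s y \<noteq> 0"
    unfolding between_def by (metis (no_types, lifting) not_one_le_zero sum.neutral)
  obtain S' where S': "S' \<in> \<S>" "y \<in> S'" using ex[of y] sy by auto
  have S'V: "S' \<subseteq> V - {v}" "cut S' \<le> 2" using S'(1) by (auto simp: \<S>_def)
  \<comment> \<open>For disjoint sets the joining edge saves 2. For overlapping ones submodularity
    applies, the intersection having cut at least 2 for lack of bridges.\<close>
  have "cut (S \<union> S') \<le> 2"
  proof (cases "S \<inter> S' = {}")
    case True
    have "w s y \<le> between S S'"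
      using between_mono[of "{s}" S "{y}" S'] sy S' SV S'V by (auto simp: between_def)
    then have "1 \<le> between S S'" using sy(3) w_nonneg[of s y] by linarith
    moreover have "cut (S \<union> S') = cut S + cut S' - 2 * between S S'"
      using SV S'V True by (intro cut_Un_disjoint) auto
    ultimately show ?thesis using SV(3) S'V(2) by simp
  next
    case False
    have "2 \<le> cut (S \<inter> S')" using SV S'V False v by (intro bridgeless) auto
    moreover have "cut (S \<inter> S') + cut (S \<union> S') \<le> cut S + cut S'"
      using SV S'V by (intro cut_submodular) auto
    ultimately show ?thesis using SV(3) S'V(2) by simp
  qed
  then have "S \<union> S' \<in> \<S>" using SV S'V by (auto simp: \<S>_def)
  then have "card (S \<union> S') \<le> card S" using S_max by blast
  moreover have "card S < card (S \<union> S')"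
    using SV S'V sy S'(2) by (intro psubset_card_mono) (auto intro: finite_subset[of _ V])
  ultimately show False by simp
qed

text \<open>Such a vertex has at most one edge back into \<open>X\<close>, so removing it opens no
  more edges than it closes.\<close>

lemma remove_vertex_cut:
  assumes "X \<subseteq> V" "q \<in> X" "valence q \<le> 2" "1 \<le> outdeg X q"
  shows "cut (X - {q}) \<le> cut X"
proof -
  have q: "q \<in> V" using assms by auto
  have "X - {q} \<subseteq> V" using assms by auto
  then have "cut X = cut {q} + cut (X - {q}) - 2 * between {q} (X - {q})"
    using cut_Un_disjoint[of "{q}" "X - {q}"] assms q by (simp add: insert_absorb)
  moreover have "between {q} (X - {q}) + outdeg X q = cut {q}"
  proof -
    have "V - {q} = (X - {q}) \<union> (V - X)" using assms by auto
    then have "cut {q} = between {q} (X - {q}) + between {q} (V - X)"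
      unfolding cut_between using assms by (simp only:) (intro between_Un_right, auto)
    then show ?thesis by (simp add: between_def outdeg_def)
  qed
  ultimately show ?thesis using assms(3,4) valence_cut[OF q] by linarith
qed

text \<open>Peel off vertices of valence at most 2 that touch the outside until only
  \<open>x\<close> remains. If there were none, \<open>x\<close> would be a cut vertex.\<close>

lemma valence_le_cut:
  assumes "X \<subseteq> V" "x \<in> X" "X \<noteq> V" "\<And>z. z \<in> X \<Longrightarrow> z \<noteq> x \<Longrightarrow> valence z \<le> 2"
  shows "valence x \<le> cut X"
  using assms
proof (induction "card X" arbitrary: X rule: less_induct)
  case (less X)
  show ?case
  proof (cases "X = {x}")
    case True
    then show ?thesis using valence_cut less.prems by auto
  next
    case False
    have "1 \<le> between (X - {x}) (V - X)"
      using less.prems False by (intro no_cut_vertex[of x]) auto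
    then obtain q where q: "q \<in> X - {x}" "(\<Sum>y\<in>V - X. w q y) \<noteq> 0"
      unfolding between_def by (metis (no_types, lifting) not_one_le_zero sum.neutral)
    then have out: "1 \<le> outdeg X q" using outdeg_nonneg[of X q] by (simp add: outdeg_def)
    have "valence x \<le> cut (X - {q})"
      using less.prems q by (intro less.hyps psubset_card_mono) auto
    also have "\<dots> \<le> cut X" using remove_vertex_cut[OF less.prems(1) _ _ out] less.prems(4) q by auto
    finally show ?thesis .
  qed
qed

text \<open>8 is the canonical degree 2g - 2 for g = 5.\<close>

lemma sum_canon_branch:
  assumes "S \<subseteq> V" "\<And>v. v \<in> V - S \<Longrightarrow> valence v \<le> 2"
  shows "8 \<le> (\<Sum>v\<in>S. valence v - 2)"
proof -
  have "8 = dg canon" using gen_5 dg_canon by simp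
  also have "\<dots> = (\<Sum>v\<in>V - S. valence v - 2) + (\<Sum>v\<in>S. valence v - 2)"
    unfolding dg_def canon_def using sum.subset_diff[OF assms(1) finite_V] by blast
  also have "(\<Sum>v\<in>V - S. valence v - 2) \<le> 0" using assms(2) by (intro sum_nonpos) force
  finally show ?thesis by simp
qed

text \<open>Take a smallest set of cut at most 2 around \<open>x\<close> and \<open>y\<close>. A
  split across fewer than two edges gives two pieces of cut at most 2; related points stay in one
  piece, against minimality.\<close>

lemma exists_minimal_solid:
  assumes S: "S \<subseteq> V" "S \<noteq> V" "cut S \<le> 2" and xy: "x \<in> S" "y \<in> S" "x \<noteq> y" "rel x y"
  obtains A where "A \<subseteq> S" "x \<in> A" "y \<in> A" "solid A" "cut A \<le> 2"
    "\<And>Z. Z \<subseteq> A \<Longrightarrow> x \<in> Z \<Longrightarrow> y \<in> Z \<Longrightarrow> cut Z \<le> 2 \<Longrightarrow> Z = A"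
proof -
  define P where "P A \<longleftrightarrow> A \<subseteq> S \<and> x \<in> A \<and> y \<in> A \<and> cut A \<le> 2" for A
  have "P S" using S xy by (simp add: P_def)
  then obtain A where A: "P A" "\<And>Z. P Z \<Longrightarrow> card A \<le> card Z"
    using ex_has_least_nat[of P S card] by blast
  have AV: "A \<subseteq> V" "A \<noteq> V" using A(1) S by (auto simp: P_def)
  have min: "Z = A" if "Z \<subseteq> A" "x \<in> Z" "y \<in> Z" "cut Z \<le> 2" for Z
  proof -
    have "P Z" using that A(1) by (auto simp: P_def)
    then show ?thesis using A(2) that(1) AV by (meson card_seteq finite_subset_V)
  qed
  have yx: "rel y x" using rel_sym xy S by blast
  have "solid A"
    unfolding solid_def
  proof (intro conjI allI impI AV(1))
    fix Z assume Z: "Z \<subseteq> A" "Z \<noteq> {}" "Z \<noteq> A"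
    have "A = Z \<union> (A - Z)" using Z by auto
    then have e: "cut A = cut Z + cut (A - Z) - 2 * between Z (A - Z)"
      using cut_Un_disjoint[of Z "A - Z"] Z AV by auto
    have two: "2 \<le> cut Z" "2 \<le> cut (A - Z)" using Z AV by (auto intro!: bridgeless)
    show "2 \<le> between Z (A - Z)"
    proof (rule ccontr)
      assume "\<not> 2 \<le> between Z (A - Z)"
      then have le: "cut Z \<le> 2" "cut (A - Z) \<le> 2" using e two A(1) by (auto simp: P_def)
      have "\<not> (x \<in> Z \<and> y \<notin> Z)" using relD[OF xy(4), of Z] le(1) Z AV by auto
      moreover have "\<not> (y \<in> Z \<and> x \<notin> Z)" using relD[OF yx, of Z] le(1) Z AV by auto
      ultimately have "x \<in> Z \<and> y \<in> Z \<or> x \<in> A - Z \<and> y \<in> A - Z" using A(1) by (auto simp: P_def)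
      then show False using min[of Z] min[of "A - Z"] le Z by auto
    qed
  qed
  then show ?thesis using that A(1) min by (auto simp: P_def)
qed

text \<open>A cut of size at most 2 between the two classes cannot separate related points, so it
  leaves each pair whole on its own side.\<close>

lemma exists_solid_pairs:
  assumes xy: "x \<in> V" "y \<in> V" "x \<noteq> y" "rel x y"
    and xy': "x' \<in> V" "y' \<in> V" "x' \<noteq> y'" "rel x' y'" and "\<not> rel x x'"
  obtains A B where "solid A" "solid B" "A \<inter> B = {}" "x \<in> A" "y \<in> A" "x' \<in> B" "y' \<in> B" "cut A \<le> 2"
    "\<And>Z. Z \<subseteq> A \<Longrightarrow> x \<in> Z \<Longrightarrow> y \<in> Z \<Longrightarrow> cut Z \<le> 2 \<Longrightarrow> Z = A"
proof -
  have "\<exists>S. S \<subseteq> V \<and> x \<in> S \<and> x' \<notin> S \<and> \<not> 3 \<le> cut S" using assms(9) unfolding rel_def by blast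
  then obtain S where S: "S \<subseteq> V" "x \<in> S" "x' \<notin> S" and "\<not> 3 \<le> cut S" by blast
  then have cS: "cut S \<le> 2" by simp
  have "y \<in> S" using relD[OF xy(4) S(1,2)] cS by force
  have "y' \<notin> S" using relD[OF rel_sym[OF xy'(1,2,4)] S(1) _ S(3)] cS by force
  have neV: "S \<noteq> V" "V - S \<noteq> V" using S xy xy' by auto
  obtain A where A: "A \<subseteq> S" "x \<in> A" "y \<in> A" "solid A" "cut A \<le> 2"
    "\<And>Z. Z \<subseteq> A \<Longrightarrow> x \<in> Z \<Longrightarrow> y \<in> Z \<Longrightarrow> cut Z \<le> 2 \<Longrightarrow> Z = A"
    using exists_minimal_solid[OF S(1) neV(1) cS S(2) \<open>y \<in> S\<close> xy(3,4)] by blast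
  have c: "cut (V - S) \<le> 2" "x' \<in> V - S" "y' \<in> V - S"
    using cS cut_compl[OF S(1)] S(3) xy'(1,2) \<open>y' \<notin> S\<close> by auto
  obtain B where B: "B \<subseteq> V - S" "x' \<in> B" "y' \<in> B" "solid B"
    by (rule exists_minimal_solid[OF Diff_subset neV(2) c xy'(3,4)]) (rule that, assumption+)
  show ?thesis by (rule that[of A B]) (use A B in auto)
qed

lemma two_classes:
  assumes xy: "x \<in> V" "y \<in> V" "x \<noteq> y" "rel x y"
    and xy': "x' \<in> V" "y' \<in> V" "x' \<noteq> y'" "rel x' y'" and "\<not> rel x x'"
  shows "sim (D - pt x - pt y) (pt x' + pt y')"
  using exists_solid_pairs[OF assms] disjoint_solid_pairs[OF _ _ _ _ _ xy(3,4) _ _ xy'(3,4)] by metis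

text \<open>Two candidates for the second point would be equivalent, and a bridgeless graph has no
  distinct equivalent points.\<close>

lemma class_size_two:
  assumes xy: "x \<in> V" "y \<in> V" "x \<noteq> y" "rel x y" and z: "z \<in> V" "z \<noteq> x" "rel x z"
    and xy': "x' \<in> V" "y' \<in> V" "x' \<noteq> y'" "rel x' y'" and n: "\<not> rel x x'"
  shows "z = y"
proof -
  have "sim (D - pt x - pt y) (D - pt x - pt z)"
    using two_classes[OF xy xy' n] two_classes[OF xy(1) z(1) _ z(3) xy' n] z(2) sim_sym sim_trans by metis
  then have "sim (pt z) (pt y)"
    by (rule sim_eq[OF sim_diff[OF _ sim_refl[of "D - pt x - pt y - pt z"]]]) auto
  then show ?thesis using pt_sim_eq z(1) xy(2) by blast
qed

text \<open>With three classes, two of the pairs are equivalent to each other and their sum is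
  equivalent to \<open>D\<close>, so \<open>D\<close> is twice a pair.\<close>

lemma third_class:
  assumes xy: "x \<in> V" "y \<in> V" "x \<noteq> y" "rel x y"
    and xy': "x' \<in> V" "y' \<in> V" "x' \<noteq> y'" "rel x' y'"
    and st: "s \<in> V" "t \<in> V" "s \<noteq> t" "rel s t"
    and n: "\<not> rel x x'" "\<not> rel x s" "\<not> rel x' s"
  shows False
proof -
  have 1: "sim (D - pt x - pt y) (pt x' + pt y')" using two_classes[OF xy xy' n(1)] .
  have 2: "sim (D - pt x - pt y) (pt s + pt t)" using two_classes[OF xy st n(2)] .
  have 3: "sim (D - pt x' - pt y') (pt s + pt t)" using two_classes[OF xy' st n(3)] .
  have "sim (pt x' + pt y') (pt s + pt t)" using 1 2 sim_sym sim_trans by blast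
  then have "sim (D - pt x' - pt y') (pt x' + pt y')" using 3 sim_sym sim_trans by blast
  then show False using not_halved[OF xy'] by blast
qed

text \<open>With two classes present, \<open>x\<close> and \<open>y\<close> are the only branch
  vertices of a minimal solid set \<open>A\<close>, and one edge leaves \<open>A\<close> at each. A
  3-cut between them can be pushed into \<open>A\<close>, where it bounds the valence of
  \<open>x\<close>.\<close>

lemma valence_le_3:
  assumes xy: "x \<in> V" "y \<in> V" "x \<noteq> y" "rel x y"
    and xy': "x' \<in> V" "y' \<in> V" "x' \<noteq> y'" "rel x' y'" and n: "\<not> rel x x'"
  shows "valence x \<le> 3"
proof -
  obtain A B where AB: "solid A" "solid B" "A \<inter> B = {}" "x \<in> A" "y \<in> A" "x' \<in> B" "y' \<in> B" "cut A \<le> 2"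
    and min: "\<And>Z. Z \<subseteq> A \<Longrightarrow> x \<in> Z \<Longrightarrow> y \<in> Z \<Longrightarrow> cut Z \<le> 2 \<Longrightarrow> Z = A"
    using exists_solid_pairs[OF assms] by blast
  have AV: "A \<subseteq> V" using AB by (simp add: solid_def)
  have AneV: "V - A \<noteq> {}" using AB xy' by auto
  have small: "valence z \<le> 2" if z: "z \<in> A" "z \<noteq> x" "z \<noteq> y" for z
  proof (rule ccontr)
    assume "\<not> valence z \<le> 2"
    then obtain t where t: "t \<in> V" "t \<noteq> z" "rel z t" using branch_related[of z] z AV by auto
    have zV: "z \<in> V" using z AV by auto
    have "\<not> rel x z" using class_size_two[OF xy zV _ _ xy' n] z by blast
    moreover have "\<not> rel x' z"
    proof
      assume "rel x' z"
      moreover have "\<not> rel x' x" using n rel_sym xy xy' by blast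
      moreover have "z \<noteq> x'" "z \<noteq> y'" using z AB by auto
      ultimately show False using class_size_two[OF xy' zV _ _ xy] by blast
    qed
    ultimately show False using third_class[OF xy xy' zV t(1) _ t(3) n] t(2) by blast
  qed
  have out0: "outdeg A z = 0" if z: "z \<in> A" "z \<noteq> x" "z \<noteq> y" for z
  proof (rule ccontr)
    assume "outdeg A z \<noteq> 0"
    then have "1 \<le> outdeg A z" using outdeg_nonneg[of A z] by linarith
    then have "cut (A - {z}) \<le> cut A" using remove_vertex_cut[OF AV z(1) small[OF z]] by blast
    then have "A - {z} = A" using min[of "A - {z}"] AB z by auto
    then show False using z by auto
  qed
  have cA: "cut A = outdeg A x + outdeg A y"
  proof -
    have "cut A = (\<Sum>v\<in>{x, y}. outdeg A v)"
      unfolding cut_def using AB out0 AV by (intro sum.mono_neutral_right) auto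
    then show ?thesis using xy(3) by simp
  qed
  \<comment> \<open>If all edges leaving \<open>A\<close> started at the other end, that end would
    be a cut vertex.\<close>
  have end_ge: "1 \<le> outdeg A e" if e: "e \<in> {x, y}" for e
  proof -
    define e' where "e' = (if e = x then y else x)"
    have e': "{e, e'} = {x, y}" "e' \<noteq> e" using e xy(3) by (auto simp: e'_def)
    have "1 \<le> between (A - {e'}) (V - A)"
      using AB AV AneV e' e by (intro no_cut_vertex[of e']) auto
    also have "\<dots> = (\<Sum>v\<in>A - {e'}. outdeg A v)" by (simp add: between_def outdeg_def)
    also have "\<dots> = outdeg A e"
    proof -
      have "(\<Sum>v\<in>A - {e'}. outdeg A v) = (\<Sum>v\<in>{e}. outdeg A v)"
        using AB out0 AV e' e by (intro sum.mono_neutral_right) auto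
      then show ?thesis by simp
    qed
    finally show ?thesis .
  qed
  have ends: "outdeg A x = 1" "outdeg A y = 1" using end_ge[of x] end_ge[of y] cA AB(8) by auto
  obtain U where U: "U \<subseteq> V" "x \<in> U" "y \<notin> U" "cut U \<le> 3" using three_cut[OF xy(1-3)] .
  define Z where "Z = A \<inter> U"
  define Q where "Q = A - U"
  have Zout: "between Z (V - A) = 1"
  proof -
    have "between Z (V - A) = (\<Sum>v\<in>Z. outdeg A v)" by (simp add: between_def outdeg_def)
    also have "\<dots> = (\<Sum>v\<in>{x}. outdeg A v)"
      using AB out0 AV U by (intro sum.mono_neutral_right) (auto simp: Z_def)
    finally show ?thesis using ends by simp
  qed
  have Qout: "between Q (V - A) = 1"
  proof -
    have "between Q (V - A) = (\<Sum>v\<in>Q. outdeg A v)" by (simp add: between_def outdeg_def)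
    also have "\<dots> = (\<Sum>v\<in>{y}. outdeg A v)"
      using AB out0 AV U by (intro sum.mono_neutral_right) (auto simp: Q_def)
    finally show ?thesis using ends by simp
  qed
  \<comment> \<open>Three edges here would be the whole cut of \<open>U\<close>. Then
    \<open>V - A\<close> would fall into two parts with no edges between them, each of cut at least
    2, but only two edges leave \<open>A\<close>.\<close>
  have "between Z Q \<le> 2"
  proof (rule ccontr)
    assume "\<not> between Z Q \<le> 2"
    define P where "P = U - A"
    define R where "R = (V - A) - U"
    have "cut U = between (Z \<union> P) (Q \<union> R)"
      unfolding cut_between using AV U by (intro arg_cong2[where f = between]) (auto simp: Z_def P_def Q_def R_def)
    also have "\<dots> = between Z Q + between Z R + between P Q + between P R"
    proof -
      have "Z \<subseteq> V" "P \<subseteq> V" "Q \<subseteq> V" "R \<subseteq> V" "Z \<inter> P = {}" "Q \<inter> R = {}"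
        using AV U by (auto simp: Z_def P_def Q_def R_def)
      then show ?thesis by (simp add: between_Un_left between_Un_right)
    qed
    finally have zero: "between Z R = 0" "between P Q = 0" "between P R = 0"
      using U(4) \<open>\<not> between Z Q \<le> 2\<close> between_nonneg[of Z R] between_nonneg[of P Q] between_nonneg[of P R]
      by linarith+
    have PR: "V - A = P \<union> R" "P \<subseteq> V" "R \<subseteq> V" "P \<inter> R = {}" using U by (auto simp: P_def R_def)
    have "P \<noteq> {}" using zero(1) Zout PR(1) by auto
    moreover have "R \<noteq> {}" using zero(2) Qout PR(1) between_commute[of P Q] by auto
    ultimately have "2 \<le> cut P" "2 \<le> cut R" using PR xy AB by (auto intro!: bridgeless)
    moreover have "cut (P \<union> R) = cut P + cut R - 2 * between P R"
      using PR by (intro cut_Un_disjoint) auto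
    ultimately have "4 \<le> cut (V - A)" using PR(1) zero(3) by simp
    then show False using cut_compl[OF AV] AB(8) by simp
  qed
  then have "cut Z \<le> 3"
  proof -
    have "V - Z = Q \<union> (V - A)" using AV by (auto simp: Z_def Q_def)
    then have "cut Z = between Z Q + between Z (V - A)"
      unfolding cut_between using AV by (simp only:) (intro between_Un_right, auto simp: Q_def)
    then show ?thesis using Zout \<open>between Z Q \<le> 2\<close> by simp
  qed
  moreover have "valence x \<le> cut Z"
    using small AB AV U xy by (intro valence_le_cut) (auto simp: Z_def)
  ultimately show ?thesis by simp
qed

text \<open>Otherwise all branch vertices lie in two pairs and have valence at most 3; they
  contribute at most 4 to a sum of at least 8.\<close>

lemma branch_one_class:
  assumes "x \<in> V" "3 \<le> valence x" "z \<in> V" "3 \<le> valence z"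
  shows "rel x z"
proof (rule ccontr)
  assume n: "\<not> rel x z"
  obtain y where y: "y \<in> V" "x \<noteq> y" "rel x y" using branch_related[OF assms(1,2)] by blast
  obtain t where t: "t \<in> V" "z \<noteq> t" "rel z t" using branch_related[OF assms(3,4)] by blast
  have n': "\<not> rel z x" "\<not> rel y z" "\<not> rel t x"
    using n y t assms rel_sym rel_trans by blast+
  have yx: "rel y x" "rel t z" using y t assms rel_sym by auto
  have v: "valence x \<le> 3" "valence y \<le> 3" "valence z \<le> 3" "valence t \<le> 3"
    using valence_le_3[OF assms(1) y assms(3) t n]
      valence_le_3[OF y(1) assms(1) y(2)[symmetric] yx(1) assms(3) t n'(2)]
      valence_le_3[OF assms(3) t assms(1) y n'(1)]
      valence_le_3[OF t(1) assms(3) t(2)[symmetric] yx(2) assms(1) y n'(3)] by auto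
  have "valence s \<le> 2" if s: "s \<in> V - {x, y, z, t}" for s
  proof (rule ccontr)
    assume "\<not> valence s \<le> 2"
    then obtain r where r: "r \<in> V" "s \<noteq> r" "rel s r" using branch_related[of s] s by auto
    have "\<not> rel x s" using class_size_two[OF assms(1) y(1,2,3) _ _ _ assms(3) t n, of s] s by auto
    moreover have "\<not> rel z s" using class_size_two[OF assms(3) t(1,2,3) _ _ _ assms(1) y n'(1), of s] s by auto
    ultimately show False using third_class[OF assms(1) y assms(3) t _ r n] s by auto
  qed
  then have "8 \<le> (\<Sum>v\<in>{x, y, z, t}. valence v - 2)"
    using assms y t by (intro sum_canon_branch) auto
  also have "\<dots> \<le> (\<Sum>v\<in>{x, y, z, t}. 1)" using v by (intro sum_mono) auto
  also have "\<dots> \<le> 4"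
    using card_insert_le_m1[of 4 "{y, z, t}" x] card_insert_le_m1[of 3 "{z, t}" y] card_insert_le_m1[of 2 "{t}" z] by simp
  finally show False by simp
qed

text \<open>By rank 2 a second chip can be brought to \<open>c\<close>, so the other three chips can
  fire towards it. The firing set separates \<open>c\<close> from a related point, hence takes all
  three chips and leaves no branch vertex but \<open>c\<close> outside; its cut is at most
  3.\<close>

lemma class_of_three:
  assumes V: "x \<in> V" "y \<in> V" "u \<in> V" "z \<in> V" and ne: "x \<noteq> y" "x \<noteq> u" "y \<noteq> u"
    and r: "rel x y" "rel x u" and M: "sim D (pt x + pt y + pt u + pt z)"
    and cls: "\<And>t. t \<in> V \<Longrightarrow> rel x t \<Longrightarrow> t \<in> {x, y, u, z}"
    and c: "c \<in> {x, y, u, z}" "rel x c" "(pt x + pt y + pt u + pt z) c = 1"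
  shows "valence c \<le> 3"
proof -
  let ?M = "pt x + pt y + pt u + pt z"
  define R where "R = ?M - pt c"
  have cV: "c \<in> V" using c V by auto
  have "eff ?M" by (simp add: eff_add)
  then have effR: "eff R" unfolding R_def using c(3) eff_sub_pt by simp
  have Rc: "R c = 0" using c(3) by (simp add: R_def pt_def)
  have "sim (D - pt c - pt c) (R - pt c)"
    by (rule sim_eq[OF sim_diff[OF M sim_refl[of "pt c + pt c"]]]) (auto simp: R_def)
  then have "eeff (R - pt c)" using eeff_D2[OF cV cV] eeff_sim by blast
  then obtain S where S: "legal S R" "c \<notin> S" using exists_legal[OF effR cV Rc] by blast
  have SV: "S \<subseteq> V" "S \<noteq> {}" using S by (auto simp: legal_def)
  have dR: "dg R = 3" using V cV by (simp add: R_def dg_diff dg_add dg_pt)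
  have "2 \<le> cut S" using SV S(2) cV by (intro bridgeless) auto
  then have "2 \<le> sum R S" using legal_cut[OF S(1)] by simp
  moreover have sR: "sum R S = sum ?M S" using SV S(2) by (simp add: R_def sum_subtractf)
  ultimately have two: "2 \<le> sum ?M S" by simp
  have "\<exists>s\<in>{x, y, u}. s \<in> S" using two SV by (auto simp: sum.distrib split: if_splits)
  then obtain s where s: "s \<in> {x, y, u}" "s \<in> S" by blast
  have sc: "rel s c" using s(1) r c(2) V rel_sym rel_trans by blast
  have "3 \<le> sum R S" using relD[OF sc SV(1) s(2) S(2)] legal_cut[OF S(1)] by simp
  have in_S: "t \<in> S" if t: "t \<in> {x, y, u, z}" "t \<noteq> c" for t
  proof (rule ccontr)
    assume "t \<notin> S"
    have "sum R S + R t \<le> sum R V"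
    proof -
      have "sum R S + R t = sum R (insert t S)" using \<open>t \<notin> S\<close> SV by simp
      also have "\<dots> \<le> sum R V" using SV t V effR by (intro sum_mono2) (auto simp: eff_def)
      finally show ?thesis .
    qed
    moreover have "1 \<le> R t" using t by (auto simp: R_def pt_def)
    ultimately show False using \<open>3 \<le> sum R S\<close> dR by (simp add: dg_def)
  qed
  have "valence c \<le> cut (V - S)"
  proof (rule valence_le_cut)
    fix t assume t: "t \<in> V - S" "t \<noteq> c"
    show "valence t \<le> 2"
    proof (rule ccontr)
      assume b: "\<not> valence t \<le> 2"
      have "3 \<le> cut {c}"
        using relD[OF rel_sym[OF _ cV sc], of "{c}"] s S(2) SV cV by auto
      then have "3 \<le> valence c" using valence_cut cV by simp
      then have "rel c t" using branch_one_class[OF cV _ _ ] b t by auto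
      then have "rel x t" using c(2) rel_trans by blast
      then have "t \<in> {x, y, u, z}" using cls t by blast
      then show False using in_S t by blast
    qed
  qed (use cV S SV in auto)
  also have "\<dots> = cut S" using cut_compl[OF SV(1)] .
  also have "\<dots> \<le> 3" using legal_cut_dg[OF S(1) effR] dR by simp
  finally show ?thesis .
qed

text \<open>The divisor through three points of a class has one more chip \<open>z\<close>, and its
  support contains the class. Valences are at most 3 where the chip is single, which keeps the
  canonical sum below 8.\<close>

lemma three_in_class:
  assumes V: "x \<in> V" "y \<in> V" "u \<in> V" and ne: "x \<noteq> y" "x \<noteq> u" "y \<noteq> u"
    and r: "rel x y" "rel x u" and b: "3 \<le> valence x"
  shows False
proof -
  have R: "rel a b" if "a \<in> V" "b \<in> V" "rel x a" "rel x b" for a b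
    using that V rel_sym rel_trans by blast
  have xx: "rel x x" by (simp add: rel_def)
  have "eeff (D - pt x - pt y - pt u)" using three_related[OF V ne] R V r xx by blast
  then obtain F where F: "eff F" "sim (D - pt x - pt y - pt u) F" by (auto simp: eeff_def)
  have "dg F = 1" using sim_dg[OF F(2)] V dg_D by (simp add: dg_diff dg_pt)
  then obtain z where z: "z \<in> V" "\<And>v. v \<in> V \<Longrightarrow> F v = pt z v" using eff_dg1[OF F(1)] by blast
  have M: "sim D (pt x + pt y + pt u + pt z)"
    by (rule sim_eq[OF sim_add[OF F(2) sim_refl[of "pt x + pt y + pt u"]]]) (auto simp: z)
  \<comment> \<open>Another class member \<open>t\<close> would make \<open>u + z\<close> equivalent
    to \<open>t + z'\<close>, and the flow of these two chips would separate \<open>u\<close> from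
    \<open>t\<close> across two edges.\<close>
  have cls: "t \<in> {x, y, u, z}" if t: "t \<in> V" "rel x t" for t
  proof (rule ccontr)
    assume nt: "t \<notin> {x, y, u, z}"
    have "eeff (D - pt x - pt y - pt t)" using three_related[of x y t] V ne nt R t r xx by blast
    then obtain F' where F': "eff F'" "sim (D - pt x - pt y - pt t) F'" by (auto simp: eeff_def)
    have "dg F' = 1" using sim_dg[OF F'(2)] V t dg_D by (simp add: dg_diff dg_pt)
    then obtain z' where z': "z' \<in> V" "\<And>v. v \<in> V \<Longrightarrow> F' v = pt z' v" using eff_dg1[OF F'(1)] by blast
    have s: "sim (pt u + pt z) (pt t + pt z')"
    proof -
      have "sim (D - pt x - pt y) (pt u + pt z)"
        by (rule sim_eq[OF sim_diff[OF M sim_refl[of "pt x + pt y"]]]) auto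
      moreover have "sim (D - pt x - pt y) (pt t + pt z')"
        by (rule sim_eq[OF sim_add[OF F'(2) sim_refl[of "pt t"]]]) (auto simp: z')
      ultimately show ?thesis using sim_sym sim_trans by blast
    qed
    have "(pt u + pt z) t \<noteq> (pt t + pt z') t" using nt by (auto simp: pt_def)
    from nontrivial_flow[OF s t(1) this] obtain U where U: "U \<subseteq> V" "2 \<le> cut U"
      "cut U \<le> sum (pt u + pt z) U - sum (pt t + pt z') U" by blast
    then have "u \<in> U" "t \<notin> U" "cut U \<le> 2" by (auto simp: sum.distrib split: if_splits)
    then show False using relD[OF R[OF V(3) t(1) r(2) t(2)] U(1)] by simp
  qed
  have val: "valence c \<le> 3" if "c \<in> {x, y, u, z}" "rel x c" "(pt x + pt y + pt u + pt z) c = 1" for c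
    using class_of_three[OF V z(1) ne r M cls that] by blast
  define S where "S = {t \<in> V. rel x t}"
  have S4: "S \<subseteq> {x, y, u, z}" using cls by (auto simp: S_def)
  have out: "valence v \<le> 2" if "v \<in> V - S" for v
    using branch_one_class[OF V(1) b, of v] that by (force simp: S_def)
  have sum8: "8 \<le> (\<Sum>v\<in>S. valence v - 2)" using out by (intro sum_canon_branch) (auto simp: S_def)
  show False
  proof (cases "z \<in> {x, y, u}")
    case False
    have "(\<Sum>v\<in>S. valence v - 2) \<le> (\<Sum>v\<in>S. 1)"
    proof (rule sum_mono)
      fix v assume v: "v \<in> S"
      then have "(pt x + pt y + pt u + pt z) v = 1" using S4 False ne by (auto simp: pt_def)
      then show "valence v - 2 \<le> 1" using val[of v] v S4 by (auto simp: S_def)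
    qed
    also have "\<dots> \<le> 4"
      using card_mono[OF _ S4] card_insert_le_m1[of 4 "{y, u, z}" x]
        card_insert_le_m1[of 3 "{u, z}" y] card_insert_le_m1[of 2 "{z}" u] by simp
    finally show False using sum8 by simp
  next
    case True
    then obtain a c where ac: "{x, y, u} = {z, a, c}" "z \<noteq> a" "z \<noteq> c" "a \<noteq> c" using ne by (metis insert_commute insert_iff singletonD)
    have Sz: "S = {z, a, c}" using S4 ac True V r xx by (auto simp: S_def)
    have acS: "a \<in> V" "rel x a" "c \<in> V" "rel x c" using Sz by (auto simp: S_def)
    have pa: "(pt x + pt y + pt u + pt z) v = 1" if "v \<in> {x, y, u}" "v \<noteq> z" for v
      using that ne by (auto simp: pt_def)
    have "valence a \<le> 3" "valence c \<le> 3"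
      using val[of a] val[of c] pa[of a] pa[of c] acS ac by auto
    \<comment> \<open>With a double chip at \<open>z\<close>, the other two points bound its valence
      by 3 + 3, and the canonical sum by 4 + 1 + 1.\<close>
    moreover have "valence z \<le> 6"
    proof -
      have "valence z \<le> cut (V - {a, c})"
        using out Sz ac z(1) acS by (intro valence_le_cut) auto
      also have "\<dots> = cut ({a} \<union> {c})" using acS by (subst cut_compl) (auto simp: insert_commute)
      also have "\<dots> = cut {a} + cut {c} - 2 * between {a} {c}" using acS ac by (intro cut_Un_disjoint) auto
      also have "\<dots> \<le> 6"
        using between_nonneg[of "{a}" "{c}"] valence_cut[OF acS(1)] valence_cut[OF acS(3)]
          \<open>valence a \<le> 3\<close> \<open>valence c \<le> 3\<close> by linarith
      finally show ?thesis .
    qed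
    ultimately show False using sum8 ac by (simp add: Sz)
  qed
qed

theorem contradiction: False
proof -
  have "\<exists>x\<in>V. 3 \<le> valence x"
  proof (rule ccontr)
    assume "\<not> (\<exists>x\<in>V. 3 \<le> valence x)"
    then have "8 \<le> (\<Sum>v\<in>{}. valence v - 2)" by (intro sum_canon_branch) force+
    then show False by simp
  qed
  then obtain x where x: "x \<in> V" "3 \<le> valence x" by blast
  obtain y where y: "y \<in> V" "y \<noteq> x" "rel x y" using branch_related[OF x] by blast
  have other: "valence v \<le> 2" if v: "v \<in> V - {x, y}" for v
  proof (rule ccontr)
    assume "\<not> valence v \<le> 2"
    then have "rel x v" using branch_one_class[OF x, of v] v by auto
    then show False using three_in_class[OF x(1) y(1), of v] y v x by auto
  qed
  obtain U where U: "U \<subseteq> V" "x \<in> U" "y \<notin> U" "cut U \<le> 3" using three_cut[OF x(1) y(1)] y(2) by blast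
  have "valence x \<le> cut U" using other U y by (intro valence_le_cut) auto
  moreover have "valence y \<le> cut (V - U)" using other U y x by (intro valence_le_cut) auto
  moreover have "8 \<le> (\<Sum>v\<in>{x, y}. valence v - 2)" using other x y by (intro sum_canon_branch) auto
  ultimately show False using U(4) cut_compl[OF U(1)] y(2) by simp
qed

end

section \<open>Extremal ranks on the sides of a cut vertex\<close>

context chip_graph begin

lemma eeff_mono:
  assumes "eeff A" "\<And>v. v \<in> V \<Longrightarrow> A v \<le> B v"
  shows "eeff B"
proof -
  have "eff (B - A)" using assms(2) by (simp add: eff_def)
  then have "eeff (A + (B - A))" using assms(1) eeff_add eff_eeff by blast
  then show ?thesis by (rule eeff_eq) simp
qed

lemma dg_cong: "(\<And>v. v \<in> V \<Longrightarrow> A v = B v) \<Longrightarrow> dg A = dg B"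
  unfolding dg_def by (rule sum.cong) auto

lemma gen_le_1: "rk T 2 \<Longrightarrow> dg T = 3 \<Longrightarrow> gen \<le> 1"
  using clifford[of T 2] by fastforce

text \<open>The residual of \<open>A\<close> has degree 0 and is equivalent to an effective divisor,
  hence to 0.\<close>

lemma sim_canon:
  assumes "gen = 4" "rk A 3" "dg A = 6"
  shows "sim canon A"
proof -
  have "eeff (canon - A)" using riemann_roch[of A 3 0] assms by (simp add: rk_0)
  then obtain F where F: "eff F" "sim (canon - A) F" by (auto simp: eeff_def)
  have "dg F = 0" using sim_dg[OF F(2)] assms by (simp add: dg_diff dg_canon)
  then have "F v = 0" if "v \<in> V" for v using eff_dg_0[OF F(1)] that by blast
  then show ?thesis by (intro sim_eq[OF sim_add[OF F(2) sim_refl[of A]]]) auto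
qed

end

context bridgeless_graph begin

lemma rk1_dg2:
  assumes "x \<in> V" "y \<in> V" "x \<noteq> y" "rk T 1"
  shows "2 \<le> dg T"
proof (rule ccontr)
  assume "\<not> 2 \<le> dg T"
  then have d: "dg T = 1" using rk_dg[OF assms(4)] by simp
  have "sim T (pt z)" if "z \<in> V" for z
  proof -
    have "eeff (T - pt z)" using assms(4) that unfolding rk_1 by blast
    then obtain F where F: "eff F" "sim (T - pt z) F" unfolding eeff_def by blast
    have "dg F = 0" using sim_dg[OF F(2)] d that by (simp add: dg_diff dg_pt)
    then have "F v = 0" if "v \<in> V" for v using eff_dg_0[OF F(1)] that by blast
    then show ?thesis by (intro sim_eq[OF sim_add[OF F(2) sim_refl[of "pt z"]]]) auto
  qed
  from sim_trans[OF sim_sym[OF this[OF assms(1)]] this[OF assms(2)]]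
  have "sim (pt x) (pt y)" .
  then show False using pt_sim_eq assms by blast
qed

lemma gen_pos:
  assumes "x \<in> V" "y \<in> V" "x \<noteq> y"
  shows "1 \<le> gen"
proof (rule ccontr)
  assume "\<not> 1 \<le> gen"
  then have "gen = 0" using gen_nonneg by simp
  then have "rk (pt x) 1" using assms by (intro rk_large) (simp add: dg_pt)
  from rk1_dg2[OF assms this] show False using assms by (simp add: dg_pt)
qed

end

text \<open>The case in which side 1 needs only one chip at \<open>v\<close>. Then \<open>N\<close>
  has rank 2 and degree 3 on side 2, which forces genus 1 there and genus 4 on side 1. This excludes
  \<open>k = 1\<close> by the same bound. For \<open>k = 2\<close>, both \<open>3 T1\<close> and
  \<open>2 T1 + 2v\<close> have degree 6 and rank 3 on side 1, hence are canonical, so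
  \<open>T1\<close> is equivalent to \<open>2v\<close>.\<close>

lemma cut_vertex_unequal:
  assumes G1: "bridgeless_graph V1 w" and G2: "bridgeless_graph V2 w"
    and v: "v \<in> V1" "v \<in> V2" and nontriv: "x1 \<in> V1" "x1 \<noteq> v" "x2 \<in> V2" "x2 \<noteq> v"
    and gens: "chip_graph.gen V1 w + chip_graph.gen V2 w = 5"
    and T1: "chip_graph.rk V1 w T1 1" "chip_graph.dg V1 T1 = 2"
    and T2: "chip_graph.rk V2 w T2 1" "chip_graph.dg V2 T2 = 2"
    and N1: "chip_graph.rk V1 w N 2" "\<And>u. u \<in> V1 \<Longrightarrow> N u = T1 u + k * pt v u"
    and N2: "chip_graph.rk V2 w N 2" "\<And>u. u \<in> V2 \<Longrightarrow> N u = T2 u + pt v u"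
    and k: "k = 1 \<or> k = 2" "k = 2 \<Longrightarrow> (\<And>u. u \<in> V2 \<Longrightarrow> T2 u = pt v u + pt v u)"
  shows "chip_graph.rk V1 w (pt v + pt v) 1 \<and> chip_graph.rk V2 w (pt v + pt v) 1"
proof -
  interpret G1: bridgeless_graph V1 w by (rule G1)
  interpret G2: bridgeless_graph V2 w by (rule G2)
  have "G2.dg N = G2.dg (T2 + pt v)" by (rule G2.dg_cong) (simp add: N2)
  then have "G2.gen \<le> 1" using G2.gen_le_1[OF N2(1)] T2(2) v by (simp add: G2.dg_add G2.dg_pt)
  then have g: "G1.gen = 4" using G2.gen_pos[of x2 v] nontriv v gens by simp
  have dN: "G1.dg N = 2 + k"
  proof -
    have "G1.dg N = (\<Sum>u\<in>V1. T1 u + k * pt v u)" unfolding G1.dg_def by (rule sum.cong) (auto simp: N1)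
    also have "\<dots> = 2 + k" using T1(2) v(1) by (simp add: G1.dg_def sum.distrib sum_distrib_left[symmetric])
    finally show ?thesis .
  qed
  have "k \<noteq> 1" using G1.gen_le_1[OF N1(1)] dN g by auto
  then have a: "k = 2" using k by simp
  have three: "1 + 1 + 1 = (3::nat)" "2 + 1 = (3::nat)" by simp_all
  have "G1.dg (T1 + T1 + T1) = 6" by (simp only: G1.dg_add T1(2))
  with G1.rk_add[OF G1.rk_add[OF T1(1) T1(1)] T1(1)] have s1: "G1.sim G1.canon (T1 + T1 + T1)"
    unfolding three by (intro G1.sim_canon g)
  have "G1.dg (N + T1) = 6" using dN a T1(2) by (simp add: G1.dg_add)
  with G1.rk_add[OF N1(1) T1(1)] have s2: "G1.sim G1.canon (N + T1)"
    unfolding three by (intro G1.sim_canon g)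
  have "G1.sim T1 (pt v + pt v)"
    by (rule G1.sim_eq[OF G1.sim_diff[OF G1.sim_trans[OF G1.sim_sym[OF s1] s2] G1.sim_refl[of "T1 + T1"]]])
      (auto simp: N1 a)
  then have "G1.rk (pt v + pt v) 1" using G1.rk_sim T1(1) by blast
  moreover have "G2.rk (pt v + pt v) 1" using T2(1) by (rule G2.rk_eq) (simp add: k(2)[OF a])
  ultimately show ?thesis by blast
qed

section \<open>Splitting at a cut vertex\<close>

context bridgeless_graph begin

text \<open>A set avoiding \<open>v\<close> has the same boundary in the side as in the whole graph;
  a set containing \<open>v\<close> is handled by its complement.\<close>

lemma side_graph:
  assumes v: "v \<in> V" and XY: "X \<union> Y = V - {v}" "X \<inter> Y = {}" and z: "between X Y = 0"
  shows "bridgeless_graph (insert v X) w"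
proof -
  let ?V = "insert v X"
  have sub: "?V \<subseteq> V" "X \<subseteq> V" "Y \<subseteq> V" "v \<notin> X" "v \<notin> Y" using v XY by auto
  have A: "2 \<le> between U (?V - U)" if U: "U \<subseteq> X" "U \<noteq> {}" for U
  proof -
    have "V - U = (?V - U) \<union> Y" using XY U v by auto
    then have "cut U = between U (?V - U) + between U Y"
      unfolding cut_between using sub XY U by (simp only:) (intro between_Un_right, auto)
    moreover have "between U Y \<le> between X Y" using U sub by (intro between_mono) auto
    moreover have "2 \<le> cut U" using U sub v by (intro bridgeless) auto
    ultimately show ?thesis using z by simp
  qed
  have B: "2 \<le> (\<Sum>x\<in>U. \<Sum>y\<in>?V - U. w x y)" if U: "U \<subseteq> ?V" "U \<noteq> {}" "U \<noteq> ?V" for U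
  proof (cases "v \<in> U")
    case False
    then show ?thesis using A[of U] U by (auto simp: between_def)
  next
    case True
    then have "2 \<le> between (?V - U) (?V - (?V - U))" using U by (intro A) auto
    also have "?V - (?V - U) = U" using U by auto
    finally show ?thesis using between_commute[of "?V - U" U] by (simp add: between_def)
  qed
  interpret G: chip_graph ?V w
  proof
    show "finite ?V" using sub by simp
    fix U assume "U \<subseteq> ?V" "U \<noteq> {}" "U \<noteq> ?V"
    then show "1 \<le> (\<Sum>x\<in>U. \<Sum>y\<in>?V - U. w x y)" using B[of U] by simp
  qed (auto simp: w_sym)
  show ?thesis
  proof
    fix U assume "U \<subseteq> ?V" "U \<noteq> {}" "U \<noteq> ?V"
    then show "2 \<le> G.cut U" using B[of U] by (simp add: G.cut_between G.between_def)
  qed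
qed

end

text \<open>A cut vertex \<open>v\<close> splits the graph into two sides that share \<open>v\<close>. A firing script on the whole
  graph restricts to each side, and the chips on \<open>v\<close> are divided between them.\<close>

locale cut_vertex_graph = rank2_graph +
  fixes v :: 'a and X Y :: "'a set" and D0 :: "'a \<Rightarrow> int"
  assumes v: "v \<in> V" and XY: "X \<union> Y = V - {v}" "X \<inter> Y = {}" "X \<noteq> {}" "Y \<noteq> {}" "between X Y = 0"
    and gen_5: "gen = 5"
    and D0: "sim D D0" "eff D0" "reduced v D0"
begin

lemma swap: "cut_vertex_graph V w D v Y X D0"
  by unfold_locales (use v XY gen_5 D0 between_commute[of Y X] in auto)

sublocale G1: bridgeless_graph "insert v X" w
  by (rule side_graph[OF v XY(1,2,5)])

sublocale G2: bridgeless_graph "insert v Y" w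
  by (rule side_graph[OF v, of Y X]) (use XY between_commute[of Y X] in auto)

lemma w_XY: "x \<in> X \<Longrightarrow> y \<in> Y \<Longrightarrow> w x y = 0"
proof -
  assume xy: "x \<in> X" "y \<in> Y"
  have "between {x} {y} \<le> between X Y" using xy XY(1) by (intro between_mono) auto
  then have "w x y \<le> 0" unfolding XY(5) by (simp add: between_def)
  then show "w x y = 0" using w_nonneg[of x y] by linarith
qed

lemma not_in: "v \<notin> X" "v \<notin> Y" "X \<subseteq> V" "Y \<subseteq> V" "finite X" "finite Y"
proof -
  show "v \<notin> X" "v \<notin> Y" "X \<subseteq> V" "Y \<subseteq> V" using XY(1) by blast+
  then show "finite X" "finite Y" using finite_subset_V by blast+
qed

lemma V_split: "V = insert v (X \<union> Y)"
  using XY(1) v by auto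

lemma sum_V: "(\<Sum>u\<in>V. g u) = g v + (\<Sum>u\<in>X. g u) + (\<Sum>u\<in>Y. g u)" for g :: "'a \<Rightarrow> int"
  unfolding V_split using not_in XY(2) by (subst sum.insert, auto simp: sum.union_disjoint)

lemma sum_V1: "(\<Sum>u\<in>insert v X. g u) = g v + (\<Sum>u\<in>X. g u)" for g :: "'a \<Rightarrow> int"
  using not_in by simp

lemma sum_V2: "(\<Sum>u\<in>insert v Y. g u) = g v + (\<Sum>u\<in>Y. g u)" for g :: "'a \<Rightarrow> int"
  using not_in by simp

lemma lap_X: "x \<in> X \<Longrightarrow> lap f x = G1.lap f x"
  unfolding lap_def G1.lap_def sum_V sum_V1 using w_XY by simp

lemma lap_Y: "y \<in> Y \<Longrightarrow> lap f y = G2.lap f y"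
  unfolding lap_def G2.lap_def sum_V sum_V2 using w_XY w_sym by simp

lemma lap_v: "lap f v = G1.lap f v + G2.lap f v"
  unfolding lap_def G1.lap_def G2.lap_def sum_V sum_V1 sum_V2 by simp

text \<open>One script serves both sides. Only at \<open>v\<close> do the two Laplacians add, so
  only there must chips be divided.\<close>

lemma split_eeff:
  assumes "eeff (D0 - E1 - E2)" "\<And>y. y \<in> Y \<Longrightarrow> E1 y = 0" "\<And>x. x \<in> X \<Longrightarrow> E2 x = 0"
  obtains m1 m2 where "m1 + m2 = D0 v" "G1.eeff (D0(v := m1) - E1)" "G2.eeff (D0(v := m2) - E2)"
proof -
  obtain F f where F: "eff F" and f: "\<forall>u\<in>V. (D0 - E1 - E2) u - F u = lap f u"
    using assms(1) by (auto simp: eeff_def sim_def)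
  \<comment> \<open>All chips that end on \<open>v\<close> are credited to the first side.\<close>
  define m1 where "m1 = E1 v + G1.lap f v + F v"
  define m2 where "m2 = E2 v + G2.lap f v"
  have Fn: "0 \<le> F u" if "u \<in> V" for u using F that by (simp add: eff_def)
  have "m1 + m2 = D0 v" using bspec[OF f v] lap_v[of f] by (simp add: m1_def m2_def)
  moreover have "G1.eeff (D0(v := m1) - E1)"
  proof (rule G1.eeffI)
    show "G1.eff F" using Fn V_split by (auto simp: G1.eff_def)
    show "G1.sim (D0(v := m1) - E1) F"
    proof (rule G1.simI)
      fix u assume u: "u \<in> insert v X"
      show "(D0(v := m1) - E1) u - F u = G1.lap f u"
      proof (cases "u = v")
        case True
        then show ?thesis by (simp add: m1_def)
      next
        case False
        then have "u \<in> X" "u \<in> V" using u not_in by auto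
        then show ?thesis using bspec[OF f, of u] lap_X[of u f] assms(3)[of u] False by simp
      qed
    qed
  qed
  moreover have "G2.eeff (D0(v := m2) - E2)"
  proof (rule G2.eeffI)
    show "G2.eff (F(v := 0))" using Fn V_split by (auto simp: G2.eff_def)
    show "G2.sim (D0(v := m2) - E2) (F(v := 0))"
    proof (rule G2.simI)
      fix u assume u: "u \<in> insert v Y"
      show "(D0(v := m2) - E2) u - (F(v := 0)) u = G2.lap f u"
      proof (cases "u = v")
        case True
        then show ?thesis by (simp add: m2_def)
      next
        case False
        then have "u \<in> Y" "u \<in> V" using u not_in by auto
        then show ?thesis using bspec[OF f, of u] lap_Y[of u f] assms(2)[of u] False by simp
      qed
    qed
  qed
  ultimately show ?thesis by (rule that)
qed

text \<open>A script extended by a constant over \<open>Y\<close> moves no chip there.\<close>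

lemma eeff_extend:
  assumes "G1.eeff A" "\<And>y. y \<in> Y \<Longrightarrow> A y = 0"
  shows "eeff A"
proof -
  obtain F f where F: "G1.eff F" and f: "\<forall>u\<in>insert v X. A u - F u = G1.lap f u"
    using assms(1) by (auto simp: G1.eeff_def G1.sim_def)
  define g where "g u = (if u \<in> Y then f v else f u)" for u
  define F' where "F' u = (if u \<in> Y then 0 else F u)" for u
  have gf: "g u = f u" if "u \<in> insert v X" for u using that not_in XY(2) by (auto simp: g_def)
  have l1: "G1.lap g u = G1.lap f u" if "u \<in> insert v X" for u
    using that gf by (intro G1.lap_cong) auto
  have l2: "G2.lap g u = 0" if "u \<in> insert v Y" for u
    unfolding G2.lap_def using that by (intro sum.neutral) (auto simp: g_def)
  have F'F: "F' u = F u" if "u \<in> insert v X" for u using that not_in XY(2) by (auto simp: F'_def)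
  show ?thesis
  proof (rule eeffI)
    show "eff F'"
      unfolding eff_def
    proof
      fix u assume "u \<in> V"
      then have "u \<in> insert v X \<or> u \<in> Y" using V_split by blast
      then show "0 \<le> F' u" using F by (auto simp: F'_def G1.eff_def)
    qed
    show "sim A F'"
    proof (rule simI)
      fix u assume "u \<in> V"
      then consider "u = v" | "u \<in> X" | "u \<in> Y" using V_split by auto
      then show "A u - F' u = lap g u"
      proof cases
        case 1
        then show ?thesis using lap_v[of g] l1[of v] l2[of v] bspec[OF f, of v] F'F[of v] by simp
      next
        case 2
        then show ?thesis using lap_X[OF 2, of g] l1[of u] bspec[OF f, of u] F'F[of u] by simp
      next
        case 3
        then show ?thesis using lap_Y[OF 3, of g] l2[of u] assms(2)[OF 3] by (simp add: F'_def)
      qed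
    qed
  qed
qed

text \<open>A debt at \<open>v\<close> would be repaid by firing a set inside \<open>X\<close>. That
  set is legal in the whole graph too, though \<open>D0\<close> is reduced at
  \<open>v\<close>.\<close>

lemma chips_nonneg:
  assumes "G1.eeff (D0(v := m))"
  shows "0 \<le> m"
proof (rule ccontr)
  assume "\<not> 0 \<le> m"
  let ?R = "D0(v := 0)"
  have "G1.eeff (?R - pt v)"
    using assms by (rule G1.eeff_mono) (use \<open>\<not> 0 \<le> m\<close> in \<open>auto simp: pt_def\<close>)
  moreover have "G1.eff ?R" using D0(2) not_in(3) by (auto simp: G1.eff_def eff_def)
  ultimately obtain U where U: "G1.legal U ?R" "v \<notin> U" using G1.exists_legal[of ?R v] by auto
  then have UX: "U \<subseteq> X" "U \<noteq> {}" by (auto simp: G1.legal_def)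
  have "legal U D0"
    unfolding legal_def
  proof (intro conjI ballI)
    fix x assume x: "x \<in> U"
    have "V - U = (insert v X - U) \<union> Y" using V_split XY(2) UX not_in by auto
    then have "outdeg U x = (\<Sum>y\<in>(insert v X - U) \<union> Y. w x y)" by (simp add: outdeg_def)
    also have "\<dots> = G1.outdeg U x + (\<Sum>y\<in>Y. w x y)"
      unfolding G1.outdeg_def using not_in XY(2) by (intro sum.union_disjoint) auto
    also have "(\<Sum>y\<in>Y. w x y) = 0" using x UX w_XY by (intro sum.neutral) auto
    also have "G1.outdeg U x \<le> ?R x" using U(1) x by (auto simp: G1.legal_def)
    finally show "outdeg U x \<le> D0 x" using x U(2) by (auto split: if_splits)
  qed (use UX not_in in auto)
  then show False using D0(3) U(2) by (auto simp: reduced_def)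
qed

lemma chips_nonneg2: "G2.eeff (D0(v := m)) \<Longrightarrow> 0 \<le> m"
  using cut_vertex_graph.chips_nonneg[OF swap] .

text \<open>The other side's share of the chips at \<open>v\<close> is nonnegative, so all of them
  suffice here. The trivial update matches the family \<open>D0(v := m)\<close>.\<close>

lemma rk2_side: "G1.rk (D0(v := D0 v)) 2"
  unfolding G1.rk_def
proof (intro allI impI)
  fix E assume E: "G1.eff E \<and> G1.dg E = int 2"
  define E' where "E' u = (if u \<in> insert v X then E u else 0)" for u
  have "eff E'" using E by (auto simp: eff_def G1.eff_def E'_def)
  moreover have "dg E' = 2"
  proof -
    have "dg E' = E v + (\<Sum>u\<in>X. E u) + (\<Sum>u\<in>Y. 0)"
      unfolding dg_def sum_V using not_in XY(2) by (intro arg_cong2[where f = "(+)"] sum.cong) (auto simp: E'_def)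
    then show ?thesis using E by (simp add: G1.dg_def not_in)
  qed
  ultimately have "eeff (D0 - E')" using rk_sim[OF rk_D D0(1)] by (auto simp: rk_def)
  then have "eeff (D0 - E' - 0)" by (rule eeff_eq) simp
  moreover have "E' y = 0" if "y \<in> Y" for y using that not_in XY(2) by (auto simp: E'_def)
  ultimately obtain m1 m2 where m: "m1 + m2 = D0 v" "G1.eeff (D0(v := m1) - E')" "G2.eeff (D0(v := m2) - 0)"
    by (rule split_eeff) auto
  have "G2.eeff (D0(v := m2))" using m(3) by (rule G2.eeff_eq) simp
  then have "0 \<le> m2" by (rule chips_nonneg2)
  then show "G1.eeff (D0(v := D0 v) - E)"
    by (intro G1.eeff_mono[OF m(2)]) (use m(1) in \<open>auto simp: E'_def\<close>)
qed

text \<open>The minimum exists by \<open>rk2_side\<close>; one chip less leaves some vertex of the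
  side unreachable.\<close>

definition need :: nat where
  "need = (LEAST m. G1.rk (D0(v := int m)) 1)"

lemma need: "G1.rk (D0(v := int need)) 1" "1 \<le> need"
  "\<exists>u\<in>insert v X. \<not> G1.eeff (D0(v := int need - 1) - pt u)"
proof -
  have "0 \<le> D0 v" using D0(2) v by (simp add: eff_def)
  then have "G1.rk (D0(v := int (nat (D0 v)))) 1"
    using rk2_side G1.rk_mono[of _ 2 1] by simp
  then show n1: "G1.rk (D0(v := int need)) 1" unfolding need_def by (rule LeastI)
  show n2: "1 \<le> need"
  proof (rule ccontr)
    assume "\<not> 1 \<le> need"
    then have "need = 0" by simp
    then have "G1.eeff (D0(v := 0) - pt v)" using n1 unfolding G1.rk_1 by simp
    then have "G1.eeff (D0(v := -1))" by (rule G1.eeff_eq) (auto simp: pt_def)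
    then show False using chips_nonneg by fastforce
  qed
  have "\<not> G1.rk (D0(v := int (need - 1))) 1"
    using not_less_Least[of "need - 1" "\<lambda>m. G1.rk (D0(v := int m)) 1"] n2 unfolding need_def[symmetric] by simp
  then show "\<exists>u\<in>insert v X. \<not> G1.eeff (D0(v := int need - 1) - pt u)"
    using n2 by (simp only: G1.rk_1) (auto simp: of_nat_diff)
qed

lemma gen_sides: "gen = G1.gen + G2.gen"
proof -
  have "valence u = G1.valence u" if "u \<in> X" for u
    unfolding valence_def G1.valence_def sum_V sum_V1 using w_XY[OF that] by simp
  moreover have "valence u = G2.valence u" if "u \<in> Y" for u
    unfolding valence_def G2.valence_def sum_V sum_V2 using w_XY[OF _ that] w_sym by simp
  moreover have "valence v = G1.valence v + G2.valence v"
    unfolding valence_def G1.valence_def G2.valence_def sum_V sum_V1 sum_V2 by simp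
  ultimately have "dg canon = G1.dg G1.canon + G2.dg G2.canon + 2"
    unfolding dg_def G1.dg_def G2.dg_def sum_V sum_V1 sum_V2 canon_def G1.canon_def G2.canon_def by simp
  then show ?thesis using dg_canon G1.dg_canon G2.dg_canon by simp
qed

lemma double_v:
  assumes "G1.rk (pt v + pt v) 1" "G2.rk (pt v + pt v) 1"
  shows "rk (pt v + pt v) 1"
  unfolding rk_1
proof
  interpret S: cut_vertex_graph V w D v Y X D0 by (rule swap)
  fix u assume "u \<in> V"
  then consider "u \<in> insert v X" | "u \<in> insert v Y" using V_split by auto
  then show "eeff (pt v + pt v - pt u)"
  proof cases
    case 1
    then have "G1.eeff (pt v + pt v - pt u)" using assms(1) unfolding G1.rk_1 by blast
    then show ?thesis by (rule eeff_extend) (use 1 not_in XY(2) in \<open>auto simp: pt_def\<close>)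
  next
    case 2
    then have "G2.eeff (pt v + pt v - pt u)" using assms(2) unfolding G2.rk_1 by blast
    then show ?thesis by (rule S.eeff_extend) (use 2 not_in XY(2) in \<open>auto simp: pt_def\<close>)
  qed
qed

text \<open>Two points that need all of \<open>need\<close> chips at \<open>v\<close>, one on each side, can be reached at once.
  So the needs of the two sides add up to at most \<open>D0 v\<close>; as a divisor of rank 1 on a side has degree
  at least 2 and \<open>D0\<close> has degree 4, equality holds throughout.\<close>

theorem hyperelliptic: "rk (pt v + pt v) 1"
proof -
  interpret S: cut_vertex_graph V w D v Y X D0 by (rule swap)
  define a1 where "a1 = int need"
  define a2 where "a2 = int S.need"
  define n where "n = D0 v"
  obtain u1 where u1: "u1 \<in> insert v X" "\<not> G1.eeff (D0(v := a1 - 1) - pt u1)" using need(3) a1_def by blast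
  obtain u2 where u2: "u2 \<in> insert v Y" "\<not> G2.eeff (D0(v := a2 - 1) - pt u2)" using S.need(3) a2_def by blast
  have "u1 \<in> V" "u2 \<in> V" using u1 u2 v not_in by auto
  then have "eeff (D0 - pt u1 - pt u2)" using rk_sim[OF rk_D D0(1)] unfolding rk_2 by blast
  moreover have "pt u1 y = 0" if "y \<in> Y" for y using that u1(1) not_in XY(2) by (auto simp: pt_def)
  moreover have "pt u2 x = 0" if "x \<in> X" for x using that u2(1) not_in XY(2) by (auto simp: pt_def)
  ultimately obtain m1 m2 where m: "m1 + m2 = n" "G1.eeff (D0(v := m1) - pt u1)" "G2.eeff (D0(v := m2) - pt u2)"
    unfolding n_def by (rule split_eeff)
  have "a1 \<le> m1"
  proof (rule ccontr)
    assume "\<not> a1 \<le> m1"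
    then have "G1.eeff (D0(v := a1 - 1) - pt u1)" by (intro G1.eeff_mono[OF m(2)]) auto
    with u1(2) show False by simp
  qed
  moreover have "a2 \<le> m2"
  proof (rule ccontr)
    assume "\<not> a2 \<le> m2"
    then have "G2.eeff (D0(v := a2 - 1) - pt u2)" by (intro G2.eeff_mono[OF m(3)]) auto
    with u2(2) show False by simp
  qed
  ultimately have n_ge: "a1 + a2 \<le> n" using m(1) by simp
  obtain x y where xy: "x \<in> X" "y \<in> Y" using XY(3,4) by blast
  then have xyv: "x \<in> insert v X" "x \<noteq> v" "y \<in> insert v Y" "y \<noteq> v" using not_in by auto
  define sX where "sX = (\<Sum>u\<in>X. D0 u)"
  define sY where "sY = (\<Sum>u\<in>Y. D0 u)"
  have nonneg: "0 \<le> D0 u" if "u \<in> V" for u using that D0(2) by (simp add: eff_def)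
  have s0: "0 \<le> sX" "0 \<le> sY" unfolding sX_def sY_def using nonneg not_in by (auto intro!: sum_nonneg)
  have d1: "G1.dg (D0(v := m)) = m + sX" for m
    unfolding G1.dg_def sum_V1 sX_def using not_in by (auto intro: sum.cong)
  have d2: "G2.dg (D0(v := m)) = m + sY" for m
    unfolding G2.dg_def sum_V2 sY_def using not_in by (auto intro: sum.cong)
  have "dg D0 = 4" using sim_dg[OF D0(1)] dg_D by simp
  then have tot: "n + sX + sY = 4" unfolding dg_def sum_V n_def sX_def sY_def .
  have T1: "G1.rk (D0(v := a1)) 1" and T2: "G2.rk (D0(v := a2)) 1"
    using need(1) S.need(1) by (auto simp: a1_def a2_def)
  have "2 \<le> a1 + sX" using G1.rk1_dg2[OF xyv(1) _ xyv(2) T1] d1 by simp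
  moreover have "2 \<le> a2 + sY" using G2.rk1_dg2[OF xyv(3) _ xyv(4) T2] d2 by simp
  ultimately have e: "a1 + sX = 2" "a2 + sY = 2" "n = a1 + a2" using tot n_ge by auto
  have zX: "D0 u = 0" if "a1 = 2" "u \<in> X" for u
    using that e(1) sum_nonneg_eq_0_iff[of X D0] nonneg not_in unfolding sX_def by auto
  have zY: "D0 u = 0" if "a2 = 2" "u \<in> Y" for u
    using that e(2) sum_nonneg_eq_0_iff[of Y D0] nonneg not_in unfolding sY_def by auto
  have a: "a1 = 1 \<or> a1 = 2" "a2 = 1 \<or> a2 = 2" using e s0 need(2) S.need(2) by (auto simp: a1_def a2_def)
  have N1: "G1.rk (D0(v := n)) 2" and N2: "G2.rk (D0(v := n)) 2"
    using rk2_side S.rk2_side by (auto simp: n_def)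
  have g: "G1.gen + G2.gen = 5" using gen_sides gen_5 by simp
  \<comment> \<open>If both needs are 2, no chip lies off \<open>v\<close> and both divisors are
    \<open>2v\<close>. Otherwise one need is 1 and the genera decide.\<close>
  consider "a1 = 2" "a2 = 2" | "a1 = 1" | "a2 = 1" using a by blast
  then have "G1.rk (pt v + pt v) 1 \<and> G2.rk (pt v + pt v) 1"
  proof cases
    case 1
    have "G1.rk (pt v + pt v) 1" using T1 by (rule G1.rk_eq) (use 1 zX not_in in \<open>auto simp: pt_def\<close>)
    moreover have "G2.rk (pt v + pt v) 1" using T2 by (rule G2.rk_eq) (use 1 zY not_in in \<open>auto simp: pt_def\<close>)
    ultimately show ?thesis by blast
  next
    case 2
    show ?thesis
    proof (rule cut_vertex_unequal[OF G1.bridgeless_graph_axioms G2.bridgeless_graph_axioms _ _ xyv g T1 _ T2 _ N1 _ N2, where k = a2])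
      show "a2 = 1 \<or> a2 = 2" by (rule a(2))
    qed (use d1 d2 e 2 zY not_in in \<open>auto simp: pt_def\<close>)
  next
    case 3
    have "G2.rk (pt v + pt v) 1 \<and> G1.rk (pt v + pt v) 1"
    proof (rule cut_vertex_unequal[OF G2.bridgeless_graph_axioms G1.bridgeless_graph_axioms _ _ xyv(3,4,1,2) _ T2 _ T1 _ N2 _ N1, where k = a1])
      show "a1 = 1 \<or> a1 = 2" by (rule a(1))
    qed (use d1 d2 e 3 zX not_in g in \<open>auto simp: pt_def\<close>)
    then show ?thesis by blast
  qed
  then show ?thesis using double_v by blast
qed

end

subsection \<open>Contracting a bridge\<close>

text \<open>The edges of \<open>y\<close> move to \<open>x\<close>; the zero diagonal drops the
  contracted edge, which would become a loop.\<close>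

definition contract :: "('a \<Rightarrow> 'a \<Rightarrow> int) \<Rightarrow> 'a \<Rightarrow> 'a \<Rightarrow> 'a \<Rightarrow> 'a \<Rightarrow> int" where
  "contract w x y = (\<lambda>a b. if a = b then 0 else
     w a b + (if a = x then w y b else 0) + (if b = x then w a y else 0))"

locale bridge_graph = chip_graph +
  fixes U :: "'a set" and x y :: 'a
  assumes U: "U \<subseteq> V" "x \<in> U" "y \<in> V" "y \<notin> U"
    and w_bridge: "w x y = 1"
    and only_bridge: "a \<in> U \<Longrightarrow> b \<in> V - U \<Longrightarrow> w a b \<noteq> 0 \<Longrightarrow> a = x \<and> b = y"
begin

lemma xy: "x \<in> V" "y \<in> V" "x \<noteq> y" "x \<in> V - {y}"
  using U by auto

lemma sum_V': "(\<Sum>a\<in>V. g a) = g y + (\<Sum>a\<in>V - {y}. g a)" for g :: "'a \<Rightarrow> int"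
  using sum.remove[OF finite_V xy(2)] .

lemma contract_graph: "chip_graph (V - {y}) (contract w x y)"
proof
  have sym: "contract w x y a b = contract w x y b a" for a b
    by (simp add: contract_def w_sym)
  have A: "1 \<le> (\<Sum>a\<in>W. \<Sum>b\<in>V - {y} - W. contract w x y a b)"
    if W: "W \<subseteq> V - {y}" "x \<in> W" "W \<noteq> V - {y}" for W
  proof -
    have "(\<Sum>a\<in>W. \<Sum>b\<in>V - {y} - W. contract w x y a b)
        = (\<Sum>a\<in>W. \<Sum>b\<in>V - {y} - W. w a b + (if a = x then w y b else 0))"
      using W by (intro sum.cong refl) (auto simp: contract_def)
    also have "\<dots> = between W (V - {y} - W) + (\<Sum>a\<in>W. if a = x then (\<Sum>b\<in>V - {y} - W. w y b) else 0)"
      by (simp add: sum.distrib between_def if_distrib[of "\<lambda>s. sum s _"] cong: if_cong)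
        (intro sum.cong, auto)
    also have "\<dots> = between W (V - insert y W) + between {y} (V - insert y W)"
    proof -
      have "finite W" "V - {y} - W = V - insert y W" using W by (auto intro: finite_subset[of W V])
      then show ?thesis using W(2) by (simp add: between_def)
    qed
    also have "\<dots> = between (W \<union> {y}) (V - insert y W)"
      using W xy by (intro between_Un_left[symmetric]) auto
    also have "\<dots> = cut (insert y W)" by (simp add: cut_between)
    finally show ?thesis using cut_ge_1[of "insert y W"] W xy by auto
  qed
  fix W assume W: "W \<subseteq> V - {y}" "W \<noteq> {}" "W \<noteq> V - {y}"
  show "1 \<le> (\<Sum>a\<in>W. \<Sum>b\<in>V - {y} - W. contract w x y a b)"
  proof (cases "x \<in> W")
    case True
    then show ?thesis using A W by blast
  next
    case False
    have "1 \<le> (\<Sum>a\<in>V - {y} - W. \<Sum>b\<in>V - {y} - (V - {y} - W). contract w x y a b)"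
      using A[of "V - {y} - W"] False W xy by auto
    also have "V - {y} - (V - {y} - W) = W" using W by auto
    also have "(\<Sum>a\<in>V - {y} - W. \<Sum>b\<in>W. contract w x y a b) = (\<Sum>a\<in>W. \<Sum>b\<in>V - {y} - W. contract w x y a b)"
      by (subst sum.swap) (simp add: sym)
    finally show ?thesis .
  qed
qed (use xy in \<open>auto simp: contract_def w_sym\<close>)

sublocale C: chip_graph "V - {y}" "contract w x y"
  by (rule contract_graph)

lemma C_lap:
  assumes "g y = g x" "a \<in> V - {y}"
  shows "C.lap g a = (if a = x then lap g x + lap g y else lap g a)"
proof (cases "a = x")
  case True
  have "C.lap g x = (\<Sum>b\<in>V - {y}. w x b * (g x - g b) + w y b * (g y - g b))"
    unfolding C.lap_def using assms(1) by (intro sum.cong refl) (auto simp: contract_def algebra_simps)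
  then show ?thesis using True assms(1) by (simp add: lap_def sum_V' sum.distrib)
next
  case False
  have "C.lap g a = (\<Sum>b\<in>V - {y}. w a b * (g a - g b) + (if b = x then w a y * (g a - g x) else 0))"
    unfolding C.lap_def using False by (intro sum.cong refl) (auto simp: contract_def algebra_simps)
  also have "\<dots> = (\<Sum>b\<in>V - {y}. w a b * (g a - g b)) + w a y * (g a - g x)"
    using xy by (simp add: sum.distrib)
  finally show ?thesis using False assms(1) by (simp add: lap_def sum_V')
qed

lemma w_out: "a \<in> U \<Longrightarrow> b \<in> V - U \<Longrightarrow> w a b = (if a = x \<and> b = y then 1 else 0)"
  using only_bridge[of a b] w_bridge by (cases "w a b = 0") auto

text \<open>Firing \<open>U\<close> sends one chip over the bridge and nothing else, so the ends of
  a bridge are equivalent.\<close>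

lemma lap_U: "z \<in> V \<Longrightarrow> lap (charf U) z = pt x z - pt y z"
proof (cases "z \<in> U")
  case True
  assume "z \<in> V"
  have "outdeg U z = (\<Sum>b\<in>V - U. if b = y then (if z = x then 1 else 0) else 0)"
    unfolding outdeg_def by (intro sum.cong refl) (simp add: w_out[OF True])
  also have "\<dots> = (if z = x then 1 else 0)" using U by simp
  finally show ?thesis using True lap_charf[OF True U(1)] U by (auto simp: pt_def)
next
  case False
  assume z: "z \<in> V"
  have "lap (charf U) z = (\<Sum>b\<in>V. if b = x then (if z = y then - 1 else 0) else 0)"
    unfolding lap_def
  proof (intro sum.cong refl)
    fix b assume "b \<in> V"
    show "w z b * (charf U z - charf U b) = (if b = x then (if z = y then - 1 else 0) else 0)"
      using w_out[of b z] False z w_sym[of z b] U by (cases "b \<in> U") (auto simp: charf_def)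
  qed
  also have "\<dots> = (if z = y then - 1 else 0)" using xy by simp
  finally show ?thesis using False U by (auto simp: pt_def)
qed

text \<open>Adding multiples of \<open>charf U\<close> moves chips only across the bridge. This
  makes a script agree at \<open>x\<close> and \<open>y\<close>, or corrects how chips are shared
  between them.\<close>

definition shift :: "int \<Rightarrow> ('a \<Rightarrow> int) \<Rightarrow> 'a \<Rightarrow> int" where
  "shift k f = (\<lambda>v. f v + k * charf U v)"

lemma lap_shift: "z \<in> V \<Longrightarrow> lap (shift k f) z = lap f z + k * (pt x z - pt y z)"
proof -
  assume z: "z \<in> V"
  have "lap (shift k f) z = lap f z + k * lap (charf U) z"
    unfolding lap_def shift_def by (simp add: sum_distrib_left sum.distrib[symmetric] algebra_simps)
  then show ?thesis using lap_U[OF z] by simp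
qed

lemma C_dg: "C.dg (D(x := D x + D y)) = dg D"
proof -
  have "(\<Sum>a\<in>V - {y}. (D(x := D x + D y)) a) = (\<Sum>a\<in>V - {y}. D a + (if a = x then D y else 0))"
    by (intro sum.cong) auto
  then show ?thesis using xy by (simp add: C.dg_def dg_def sum_V' sum.distrib)
qed

lemma C_gen: "C.gen = gen"
proof -
  have v: "C.valence a = valence a + (if a = x then valence y - 2 else 0)" if "a \<in> V - {y}" for a
  proof (cases "a = x")
    case True
    have "C.valence x = (\<Sum>b\<in>V - {y}. (w x b + w y b) - (if b = x then w y x else 0))"
      unfolding C.valence_def by (intro sum.cong refl) (auto simp: contract_def)
    also have "\<dots> = (\<Sum>b\<in>V - {y}. w x b) + (\<Sum>b\<in>V - {y}. w y b) - w y x"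
      using xy by (simp add: sum.distrib sum_subtractf)
    finally show ?thesis using True w_bridge w_sym[of x y] by (simp add: valence_def sum_V')
  next
    case False
    have "C.valence a = (\<Sum>b\<in>V - {y}. w a b + (if b = x then w a y else 0))"
      unfolding C.valence_def using False by (intro sum.cong refl) (auto simp: contract_def)
    also have "\<dots> = (\<Sum>b\<in>V - {y}. w a b) + w a y" using xy by (simp add: sum.distrib)
    finally show ?thesis using False by (simp add: valence_def sum_V')
  qed
  have "C.dg C.canon = (\<Sum>a\<in>V - {y}. (valence a - 2) + (if a = x then valence y - 2 else 0))"
    unfolding C.dg_def C.canon_def by (intro sum.cong refl) (auto simp: v)
  also have "\<dots> = dg canon" using xy by (simp add: sum.distrib dg_def canon_def sum_V')
  finally show ?thesis using C.dg_canon dg_canon by simp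
qed

lemma C_eeff:
  assumes "eeff A" "B x = A x + A y" "\<And>a. a \<in> V - {x, y} \<Longrightarrow> B a = A a"
  shows "C.eeff B"
proof -
  obtain F f where F: "eff F" and f: "\<forall>v\<in>V. A v - F v = lap f v"
    using assms(1) by (auto simp: eeff_def sim_def)
  define g where "g = shift (f y - f x) f"
  have gxy: "g y = g x" using U by (simp add: g_def shift_def charf_def)
  show ?thesis
  proof (rule C.eeffI)
    show "C.eff (F(x := F x + F y))" using F xy by (auto simp: C.eff_def eff_def)
    show "C.sim B (F(x := F x + F y))"
    proof (rule C.simI)
      fix a assume a: "a \<in> V - {y}"
      show "B a - (F(x := F x + F y)) a = C.lap g a"
      proof (cases "a = x")
        case True
        then show ?thesis
          using C_lap[OF gxy a] bspec[OF f xy(1)] bspec[OF f xy(2)] lap_shift[OF xy(1), of _ f] lap_shift[OF xy(2), of _ f] xy assms(2)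
          by (simp add: g_def pt_def)
      next
        case False
        then show ?thesis
          using C_lap[OF gxy a] bspec[OF f, of a] lap_shift[of a _ f] a assms(3)[of a] by (simp add: g_def pt_def)
      qed
    qed
  qed
qed

lemma eeff_lift:
  assumes "C.eeff B"
  shows "eeff (B(y := 0))"
proof -
  obtain F f where F: "C.eff F" and f: "\<forall>v\<in>V - {y}. B v - F v = C.lap f v"
    using assms by (auto simp: C.eeff_def C.sim_def)
  define g where "g = f(y := f x)"
  have gxy: "g y = g x" using xy by (simp add: g_def)
  have lg: "C.lap f a = C.lap g a" if "a \<in> V - {y}" for a
    using that by (intro C.lap_cong) (auto simp: g_def)
  \<comment> \<open>With this shift \<open>lap h y\<close> is 0, and \<open>x\<close> takes over the
    whole change at the merged vertex.\<close>
  define h where "h = shift (lap g y) g"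
  show ?thesis
  proof (rule eeffI)
    show "eff (F(y := 0))" using F by (auto simp: C.eff_def eff_def)
    show "sim (B(y := 0)) (F(y := 0))"
    proof (rule simI)
      fix a assume a: "a \<in> V"
      consider "a = x" | "a = y" | "a \<noteq> x" "a \<noteq> y" by blast
      then show "(B(y := 0)) a - (F(y := 0)) a = lap h a"
      proof cases
        case 1
        then show ?thesis
          using C_lap[OF gxy xy(4)] bspec[OF f xy(4)] lap_shift[OF xy(1), of "lap g y" g] lg[OF xy(4)] xy
          by (simp add: h_def pt_def)
      next
        case 2
        then show ?thesis using lap_shift[OF xy(2), of "lap g y" g] xy by (simp add: h_def pt_def)
      next
        case 3
        then show ?thesis
          using C_lap[OF gxy, of a] bspec[OF f, of a] lap_shift[OF a, of "lap g y" g] lg[of a] a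
          by (simp add: h_def pt_def)
      qed
    qed
  qed
qed

lemma C_rk2: "rk D 2 \<Longrightarrow> C.rk (D(x := D x + D y)) 2"
  unfolding C.rk_2
proof (intro ballI)
  fix a b assume D: "rk D 2" and ab: "a \<in> V - {y}" "b \<in> V - {y}"
  then have "eeff (D - pt a - pt b)" unfolding rk_2 by blast
  then show "C.eeff (D(x := D x + D y) - pt a - pt b)"
    by (rule C_eeff) (use ab in \<open>auto simp: pt_def\<close>)
qed

lemma rk1_lift:
  assumes "C.rk T 1"
  shows "rk (T(y := 0)) 1"
  unfolding rk_1
proof
  have e: "eeff (T(y := 0) - pt a)" if "a \<in> V - {y}" for a
  proof -
    have "C.eeff (T - pt a)" using assms that unfolding C.rk_1 by blast
    then have "eeff ((T - pt a)(y := 0))" by (rule eeff_lift)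
    then show ?thesis by (rule eeff_eq) (use that in \<open>auto simp: pt_def\<close>)
  qed
  fix a assume a: "a \<in> V"
  show "eeff (T(y := 0) - pt a)"
  proof (cases "a = y")
    case True
    have "sim (pt x) (pt y)" by (rule simI[of _ _ "charf U"]) (simp add: lap_U)
    then have "sim (T(y := 0) - pt x) (T(y := 0) - pt a)" using True sim_diff sim_refl by blast
    then show ?thesis using eeff_sim e[OF xy(4)] by blast
  next
    case False
    then show ?thesis using e a by blast
  qed
qed

end

section \<open>Equality in Clifford's inequality\<close>

text \<open>The case \<open>g = 5\<close>, \<open>r = 2\<close> of equality in Clifford's inequality, a special case of a theorem of
  Coppens.\<close>

lemma clifford_equality:
  assumes "chip_graph V w" "chip_graph.gen V w = 5" "chip_graph.rk V w D 2" "chip_graph.dg V D = 4"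
  shows "\<exists>T. chip_graph.dg V T = 2 \<and> chip_graph.rk V w T 1"
  using assms
proof (induction "card V" arbitrary: V w D rule: less_induct)
  case (less V w D)
  interpret G: chip_graph V w by (rule less.prems(1))
  show ?case
  proof (cases "\<forall>U. U \<subseteq> V \<longrightarrow> U \<noteq> {} \<longrightarrow> U \<noteq> V \<longrightarrow> 2 \<le> G.cut U")
    case False
    then obtain U where U: "U \<subseteq> V" "U \<noteq> {}" "U \<noteq> V" "G.cut U = 1"
      using G.cut_ge_1 by (metis int_one_le_iff_zero_less linorder_not_le one_add_one order_antisym zless_add1_eq zle_add1_eq_le)
    \<comment> \<open>Nonnegative integers with sum 1: one crossing pair has weight 1, all others
      have 0.\<close>
    have prod: "(\<Sum>p\<in>U \<times> (V - U). w (fst p) (snd p)) = 1"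
      using U(4) by (simp add: G.cut_between G.between_def sum.cartesian_product case_prod_beta)
    have fin: "finite (U \<times> (V - U))" using U by auto
    obtain p where p: "p \<in> U \<times> (V - U)" "w (fst p) (snd p) \<noteq> 0"
      using prod by (metis (no_types, lifting) sum.neutral zero_neq_one)
    have rest: "w (fst p) (snd p) + (\<Sum>q\<in>U \<times> (V - U) - {p}. w (fst q) (snd q)) = 1"
      using prod fin p(1) by (simp add: sum.remove)
    have nn: "0 \<le> (\<Sum>q\<in>U \<times> (V - U) - {p}. w (fst q) (snd q))" by (intro sum_nonneg) auto
    have p1: "w (fst p) (snd p) = 1" using rest nn p(2) G.w_nonneg[of "fst p" "snd p"] by linarith
    then have "(\<Sum>q\<in>U \<times> (V - U) - {p}. w (fst q) (snd q)) = 0" using rest by simp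
    then have zero: "w (fst q) (snd q) = 0" if "q \<in> U \<times> (V - U) - {p}" for q
      using that fin by (subst (asm) sum_nonneg_eq_0_iff) auto
    interpret B: bridge_graph V w U "fst p" "snd p"
    proof
      fix a b assume ab: "a \<in> U" "b \<in> V - U" "w a b \<noteq> 0"
      then have "(a, b) = p" using zero[of "(a, b)"] by auto
      then show "a = fst p \<and> b = snd p" by auto
    qed (use U p p1 in auto)
    \<comment> \<open>Only bridges use the induction; a cut vertex of a bridgeless graph is settled
      directly below.\<close>
    have "card (V - {snd p}) < card V" using B.xy by (intro psubset_card_mono) auto
    from less.hyps[OF this B.contract_graph _ B.C_rk2[OF less.prems(3)]]
    obtain T where T: "B.C.dg T = 2" "B.C.rk T 1"
      using B.C_gen B.C_dg less.prems by auto
    have "G.dg (T(snd p := 0)) = 2"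
      using T(1) by (simp add: B.C.dg_def G.dg_def B.sum_V')
    then show ?thesis using B.rk1_lift[OF T(2)] by blast
  next
    case True
    interpret R: rank2_graph V w D by unfold_locales (use True less.prems in auto)
    show ?thesis
    proof (cases "\<exists>v X Y. v \<in> V \<and> X \<union> Y = V - {v} \<and> X \<inter> Y = {} \<and> X \<noteq> {} \<and> Y \<noteq> {} \<and> \<not> 1 \<le> G.between X Y")
      case True
      then obtain v X Y where c: "v \<in> V" "X \<union> Y = V - {v}" "X \<inter> Y = {}" "X \<noteq> {}" "Y \<noteq> {}" "G.between X Y = 0"
        using G.between_nonneg by (metis int_one_le_iff_zero_less order_less_le)
      obtain D0 where D0: "G.sim D D0" "G.eff D0" "G.reduced v D0"
        using G.exists_reduced[OF c(1) G.rk_eeff[OF less.prems(3)]] by blast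
      interpret X: cut_vertex_graph V w D v X Y D0
        by unfold_locales (use c D0 less.prems in auto)
      have "G.dg (pt v + pt v) = 2" using G.dg_add[of "pt v" "pt v"] G.dg_pt[OF c(1)] by linarith
      then show ?thesis using X.hyperelliptic by blast
    next
      case nc: False
      show ?thesis
      proof (rule ccontr)
        assume n: "\<not> ?thesis"
        interpret K: critical_graph V w D by unfold_locales (use nc n less.prems in blast)+
        show False by (rule K.contradiction)
      qed
    qed
  qed
qed

subsection \<open>Degrees and ranks of divisors on a graph of genus at most five\<close>

context chip_graph begin

text \<open>For fixed \<open>r\<close> these degrees form a ray that starts at the r-th gonality, so
  gonalities can be compared without handling minima.\<close>

definition has :: "int \<Rightarrow> nat \<Rightarrow> bool" where
  "has d r \<longleftrightarrow> (\<exists>D. dg D = d \<and> rk D r)"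

lemma has_mono: "has d r \<Longrightarrow> d \<le> d' \<Longrightarrow> has d' r"
proof -
  assume "has d r" "d \<le> d'"
  then obtain D where D: "dg D = d" "rk D r" by (auto simp: has_def)
  obtain v where v: "v \<in> V" by (rule exists_V)
  define F where "F = (\<lambda>u. (d' - d) * pt v u)"
  have "eff F" using \<open>d \<le> d'\<close> by (simp add: F_def eff_def pt_def)
  then have "rk (D + F) r" using D rk_add_eeff eff_eeff by blast
  moreover have "dg F = d' - d" using v by (simp add: dg_def F_def sum_distrib_left[symmetric])
  ultimately show "has d' r" using D by (auto simp: has_def dg_add intro!: exI[of _ "D + F"])
qed

lemma has_add: "has d r \<Longrightarrow> has d' s \<Longrightarrow> has (d + d') (r + s)"
  unfolding has_def using rk_add dg_add by metis

lemma has_ge: "has d r \<Longrightarrow> int r \<le> d"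
  using rk_dg by (auto simp: has_def)

lemma has_dual: "has d r \<Longrightarrow> int s \<le> int r - d + gen - 1 \<Longrightarrow> has (2 * gen - 2 - d) s"
  unfolding has_def using riemann_roch by (metis dg_canon dg_diff)

lemma has_large: "int r + gen \<le> d \<Longrightarrow> has d r"
proof -
  assume le: "int r + gen \<le> d"
  obtain v where v: "v \<in> V" by (rule exists_V)
  define F where "F = (\<lambda>u. d * pt v u)"
  have "dg F = d" using v by (simp add: dg_def F_def sum_distrib_left[symmetric])
  then show ?thesis using rk_large[of r F] le by (auto simp: has_def)
qed

text \<open>Below the bound the residual would have rank larger than its degree.\<close>

lemma has_iff_large:
  assumes "gen \<le> int r"
  shows "has d r \<longleftrightarrow> int r + gen \<le> d"
proof
  assume h: "has d r"
  show "int r + gen \<le> d"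
  proof (rule ccontr)
    assume "\<not> int r + gen \<le> d"
    then have "has (2 * gen - 2 - d) (nat (int r - d + gen - 1))" using has_dual[OF h] by simp
    from has_ge[OF this] show False using assms \<open>\<not> int r + gen \<le> d\<close> by simp
  qed
qed (rule has_large)

lemma has_zero: "0 \<le> d \<Longrightarrow> has d 0"
proof -
  assume "0 \<le> d"
  have "has 0 0" unfolding has_def by (intro exI[of _ 0]) (auto simp: dg_def rk_0 intro: eff_eeff)
  then show ?thesis using has_mono \<open>0 \<le> d\<close> by blast
qed

text \<open>\<open>canon\<close> attains the bound; a smaller degree would leave a residual whose
  rank equals its positive degree.\<close>

lemma has_iff_canon:
  assumes "gen = int r + 1" "1 \<le> r"
  shows "has d r \<longleftrightarrow> 2 * int r \<le> d"
proof
  assume h: "has d r"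
  show "2 * int r \<le> d"
  proof (rule ccontr)
    assume lt: "\<not> 2 * int r \<le> d"
    define s where "s = nat (2 * int r - d)"
    have s: "int s = 2 * int r - d" "1 \<le> s" using lt by (auto simp: s_def)
    have "2 * gen - 2 - d = int s" using assms s by simp
    then have "has (int s) s" using has_dual[OF h, of s] assms s by simp
    then obtain D where "dg D = int s" "rk D s" by (auto simp: has_def)
    then show False using rk_lt_dg[of D s] assms s by simp
  qed
next
  assume "2 * int r \<le> d"
  moreover have "has (2 * int r) r"
    using has_dual[OF has_zero[of 0], of r] assms by simp
  ultimately show "has d r" using has_mono by blast
qed

text \<open>(4, 2) and (2, 1) are dual in genus 4. Twice (3, 2) is (6, 4), below the nonspecial
  bound 8.\<close>

lemma has_2_genus_4:
  assumes "gen = 4"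
  shows "has d 2 \<longleftrightarrow> 5 \<le> d \<or> 4 \<le> d \<and> has 2 1"
proof -
  have 5: "has 5 2" using has_dual[OF has_zero[of 1], of 2] assms by simp
  have 4: "has 4 2" if "has 2 1" using has_dual[OF that, of 2] assms by simp
  have 2: "has 2 1" if "has 4 2" using has_dual[OF that, of 1] assms by simp
  have 3: "\<not> has 3 2"
  proof
    assume h: "has 3 2"
    then have "has (3 + 3) (2 + 2)" using has_add by blast
    then show False using has_iff_large[of 4 6] assms by simp
  qed
  have "d \<le> 3 \<or> d = 4 \<or> 5 \<le> d" by linarith
  then show ?thesis using has_mono[OF _, of d 2 3] has_mono[OF 5, of d] has_mono[OF 4, of d] 2 3 by auto
qed

text \<open>(6, 3) and (2, 1) are dual in genus 5. The dual of (5, 3) is (3, 2), and their sum (8,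
  5) is below the bound 10.\<close>

lemma has_3_genus_5:
  assumes "gen = 5"
  shows "has d 3 \<longleftrightarrow> 7 \<le> d \<or> 6 \<le> d \<and> has 2 1"
proof -
  have 7: "has 7 3" using has_dual[OF has_zero[of 1], of 3] assms by simp
  have 6: "has 6 3" if "has 2 1" using has_dual[OF that, of 3] assms by simp
  have 2: "has 2 1" if "has 6 3" using has_dual[OF that, of 1] assms by simp
  have 5: "\<not> has 5 3"
  proof
    assume h: "has 5 3"
    then have "has 3 2" using has_dual[OF h, of 2] assms by simp
    then have "has (5 + 3) (3 + 2)" using has_add h by blast
    then show False using has_iff_large[of 5 8] assms by simp
  qed
  have "d \<le> 5 \<or> d = 6 \<or> 7 \<le> d" by linarith
  then show ?thesis using has_mono[OF _, of d 3 5] has_mono[OF 7, of d] has_mono[OF 6, of d] 2 5 by auto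
qed

text \<open>(5, 2) and (3, 1) are dual; the self-dual (4, 2) is where
  \<open>clifford_equality\<close> enters.\<close>

lemma has_2_genus_5:
  assumes "gen = 5"
  shows "has d 2 \<longleftrightarrow> 6 \<le> d \<or> 5 \<le> d \<and> has 3 1 \<or> 4 \<le> d \<and> has 2 1"
proof -
  have 6: "has 6 2" using has_dual[OF has_zero[of 2], of 2] assms by simp
  have 5: "has 5 2" if "has 3 1" using has_dual[OF that, of 2] assms by simp
  have five': "has 3 1" if "has 5 2" using has_dual[OF that, of 1] assms by simp
  have 4: "has 4 2" if "has 2 1" using has_add[OF that that] by (simp add: numeral_2_eq_2)
  have four': "has 2 1" if "has 4 2"
    using that clifford_equality[OF chip_graph_axioms assms] unfolding has_def by blast
  have 3: "\<not> has 3 2"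
  proof
    assume h: "has 3 2"
    then have "has 5 3" using has_dual[OF h, of 3] assms by simp
    then show False using has_3_genus_5[OF assms, of 5] by simp
  qed
  have "d \<le> 3 \<or> d = 4 \<or> d = 5 \<or> 6 \<le> d" by linarith
  then show ?thesis
    using has_mono[OF _, of d 2 3] has_mono[OF 6, of d] has_mono[OF 5, of d] has_mono[OF 4, of d] five' four' 3
      has_mono[of 2 1 3] by auto
qed

end

text \<open>The six cases exhaust \<open>r \<ge> 1\<close> in genus at most 5; in each, the answer
  depends at most on which pairs (d, 1) occur.\<close>

lemma has_determined:
  assumes "chip_graph V w" "chip_graph V' w'"
    and g: "chip_graph.gen V w = chip_graph.gen V' w'" "chip_graph.gen V w \<le> 5"
    and one: "\<And>d. chip_graph.has V w d 1 = chip_graph.has V' w' d 1" and "1 \<le> r"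
  shows "chip_graph.has V w d r = chip_graph.has V' w' d r"
proof -
  interpret G: chip_graph V w by fact
  interpret H: chip_graph V' w' by fact
  have nonneg: "0 \<le> G.gen" by (rule G.gen_nonneg)
  consider "G.gen \<le> int r" | "G.gen = int r + 1" | "r = 1" | "G.gen = 4" "r = 2" | "G.gen = 5" "r = 3" | "G.gen = 5" "r = 2"
    using g(2) \<open>1 \<le> r\<close> nonneg by linarith
  then show ?thesis
  proof cases
    case 1
    then show ?thesis using G.has_iff_large H.has_iff_large g(1) by simp
  next
    case 2
    then show ?thesis using G.has_iff_canon H.has_iff_canon g(1) \<open>1 \<le> r\<close> by simp
  next
    case 3
    then show ?thesis using one by simp
  next
    case 4
    then show ?thesis using G.has_2_genus_4 H.has_2_genus_4 g(1) one by simp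
  next
    case 5
    then show ?thesis using G.has_3_genus_5 H.has_3_genus_5 g(1) one by simp
  next
    case 6
    then show ?thesis using G.has_2_genus_5 H.has_2_genus_5 g(1) one by simp
  qed
qed

subsection \<open>Multigraphs\<close>

definition wt :: "'a mgraph \<Rightarrow> 'a \<Rightarrow> 'a \<Rightarrow> int" where
  "wt G x y = (if x = y then 0 else int (count (edges G) {x, y}))"

lemma wt_nonneg [simp]: "0 \<le> wt G x y"
  by (simp add: wt_def)

lemma rtrancl_crossing:
  assumes "(a, b) \<in> R\<^sup>*" "a \<in> U" "b \<notin> U"
  obtains x y where "(x, y) \<in> R" "x \<in> U" "y \<notin> U"
proof -
  have "b \<in> U \<or> (\<exists>x y. (x, y) \<in> R \<and> x \<in> U \<and> y \<notin> U)"
    using assms(1,2) by (induction rule: rtrancl_induct) auto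
  then show ?thesis using assms(3) that by blast
qed

lemma mgraph_chip_graph:
  assumes "is_mgraph G"
  shows "chip_graph (verts G) (wt G)"
proof
  have fin: "finite (verts G)" and conn: "connected_mgraph G"
    and edge: "\<And>e. e \<in># edges G \<Longrightarrow> e \<subseteq> verts G \<and> card e = 2"
    using assms by (auto simp: is_mgraph_def)
  show "finite (verts G)" by (rule fin)
  show "verts G \<noteq> {}" using assms by (simp add: is_mgraph_def)
  fix U assume U: "U \<subseteq> verts G" "U \<noteq> {}" "U \<noteq> verts G"
  then obtain a b where ab: "a \<in> U" "b \<in> verts G" "b \<notin> U" by blast
  have "(a, b) \<in> {(x, y). {x, y} \<in># edges G}\<^sup>*" using conn ab U by (auto simp: connected_mgraph_def)
  then obtain x y where xy: "{x, y} \<in># edges G" "x \<in> U" "y \<notin> U"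
    using ab by (elim rtrancl_crossing) auto
  have y: "y \<in> verts G - U" using edge[OF xy(1)] xy by auto
  have "1 \<le> wt G x y" using xy count_greater_zero_iff[of "edges G" "{x, y}"] by (auto simp: wt_def)
  also have "\<dots> \<le> (\<Sum>y\<in>verts G - U. wt G x y)"
    using y fin by (intro member_le_sum) (auto simp: wt_def)
  also have "\<dots> \<le> (\<Sum>x\<in>U. \<Sum>y\<in>verts G - U. wt G x y)"
    using xy fin U finite_subset[OF U(1) fin]
    by (intro member_le_sum[of x U "\<lambda>x. \<Sum>y\<in>verts G - U. wt G x y"]) (auto intro!: sum_nonneg)
  finally show "1 \<le> (\<Sum>x\<in>U. \<Sum>y\<in>verts G - U. wt G x y)" .
qed (auto simp: wt_def insert_commute)

locale multigraph =
  fixes G :: "'a mgraph"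
  assumes mgraph: "is_mgraph G"
begin

sublocale chip_graph "verts G" "wt G"
  by (rule mgraph_chip_graph[OF mgraph])

lemma val_valence:
  assumes "v \<in> verts G"
  shows "int (val G v) = valence v"
proof -
  have "(\<Sum>u\<in>verts G. (if u = v then int (val G v) else 0) - wt G v u) = (\<Sum>u\<in>verts G. laplacian G u v)"
    by (intro sum.cong) (auto simp: laplacian_def wt_def insert_commute)
  also have "\<dots> = 0" by (rule sum_laplacian_column[OF mgraph assms])
  finally show ?thesis using assms by (simp add: sum_subtractf valence_def)
qed

lemma laplacian_lap:
  assumes "v \<in> verts G"
  shows "(\<Sum>u\<in>verts G. laplacian G v u * f u) = lap f v"
proof -
  have "(\<Sum>u\<in>verts G. laplacian G v u * f u)
      = (\<Sum>u\<in>verts G. (if u = v then int (val G v) * f v else 0) - wt G v u * f u)"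
    by (intro sum.cong) (auto simp: laplacian_def wt_def)
  also have "\<dots> = valence v * f v - (\<Sum>u\<in>verts G. wt G v u * f u)"
    using assms by (simp add: sum_subtractf val_valence)
  also have "\<dots> = lap f v"
    by (simp add: valence_def lap_def sum_distrib_right sum_subtractf right_diff_distrib)
  finally show ?thesis .
qed

lemma sum_val: "(\<Sum>v\<in>verts G. val G v) = 2 * size (edges G)"
proof -
  have "(\<Sum>v\<in>verts G. size {#e \<in># M. v \<in> e#}) = 2 * size M"
    if "\<forall>e. e \<in># M \<longrightarrow> e \<subseteq> verts G \<and> card e = 2" for M
    using that
  proof (induction M)
    case (add e M)
    then have e: "e \<subseteq> verts G" "card e = 2" by auto
    have "(\<Sum>v\<in>verts G. size {#e' \<in># add_mset e M. v \<in> e'#})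
        = (\<Sum>v\<in>verts G. (if v \<in> e then 1 else 0) + size {#e \<in># M. v \<in> e#})"
      by (intro sum.cong) auto
    also have "\<dots> = card e + 2 * size M"
      using e add by (simp add: sum.distrib Int_absorb1 sum.If_cases)
    finally show ?case using e by simp
  qed simp
  then show ?thesis using mgraph by (simp add: val_def is_mgraph_def)
qed

lemma genus_gen: "genus G = gen"
proof -
  have "(\<Sum>v\<in>verts G. valence v) = (\<Sum>v\<in>verts G. int (val G v))" using val_valence by simp
  also have "\<dots> = 2 * int (size (edges G))" using sum_val by (metis of_nat_mult of_nat_numeral of_nat_sum)
  finally show ?thesis by (simp add: genus_def gen_def valence_def)
qed

lemma lin_equiv_sim: "lin_equiv G D D' \<longleftrightarrow> sim D D'"
  unfolding lin_equiv_def sim_def using laplacian_lap by simp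

lemma deg_dg: "deg G D = dg D"
  by (simp add: deg_def dg_def)

lemma equiv_effective_eeff: "equiv_effective G D \<longleftrightarrow> eeff D"
proof
  assume "eeff D"
  then obtain F where F: "eff F" "sim D F" by (auto simp: eeff_def)
  define F' where "F' v = (if v \<in> verts G then F v else 0)" for v
  have "effective G F'" using F(1) by (auto simp: effective_def divisors_def eff_def F'_def)
  moreover have "sim D F'" by (rule sim_eq[OF F(2)]) (auto simp: F'_def)
  ultimately show "equiv_effective G D" by (auto simp: equiv_effective_def lin_equiv_sim)
qed (auto simp: equiv_effective_def lin_equiv_sim effective_def eeff_def eff_def)

lemma rank_ge_rk: "rank_ge G D r \<longleftrightarrow> rk D r"
proof
  assume R: "rank_ge G D r"
  show "rk D r"
    unfolding rk_def
  proof (intro allI impI)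
    fix E assume E: "eff E \<and> dg E = int r"
    define E' where "E' v = (if v \<in> verts G then E v else 0)" for v
    have "effective G E'" using E by (auto simp: effective_def divisors_def eff_def E'_def)
    moreover have "deg G E' = int r" using E by (auto simp: deg_def dg_def E'_def)
    ultimately have "eeff (\<lambda>v. D v - E' v)" using R by (simp add: rank_ge_def equiv_effective_eeff)
    then show "eeff (D - E)" by (rule eeff_eq) (simp add: E'_def)
  qed
next
  assume R: "rk D r"
  show "rank_ge G D r"
    unfolding rank_ge_def equiv_effective_eeff
  proof (intro allI impI)
    fix E assume "effective G E \<and> deg G E = int r"
    then have "eff E" "dg E = int r" by (auto simp: effective_def eff_def deg_dg)
    then have "eeff (D - E)" using R by (simp add: rk_def)
    then show "eeff (\<lambda>v. D v - E v)" by (rule eeff_eq) simp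
  qed
qed

lemma rank_iff_rk: "int r \<le> rank G D \<longleftrightarrow> rk D r"
proof
  assume R: "int r \<le> rank G D"
  then have "equiv_effective G D" by (auto simp: rank_def split: if_splits)
  then obtain s where "rank G D = int s" "rank_ge G D s" using rank_attained[OF mgraph] by blast
  then show "rk D r" using R rk_mono rank_ge_rk by simp
next
  assume R: "rk D r"
  then have "equiv_effective G D" using rk_eeff by (simp add: equiv_effective_eeff)
  then obtain s where "rank G D = int s" "r \<le> s" using rank_attained[OF mgraph] R rank_ge_rk by metis
  then show "int r \<le> rank G D" by simp
qed

lemma gon_le_iff: "gon r G \<le> d \<longleftrightarrow> has d r"
proof
  assume "gon r G \<le> d"
  moreover obtain D where "int r \<le> rank G D" "deg G D = gon r G" using gon_attained(1)[OF mgraph] by blast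
  then have "has (gon r G) r" using rank_iff_rk deg_dg by (auto simp: has_def)
  ultimately show "has d r" using has_mono by blast
next
  assume "has d r"
  then obtain D where D: "dg D = d" "rk D r" by (auto simp: has_def)
  define D' where "D' v = (if v \<in> verts G then D v else 0)" for v
  have "rk D' r" using D(2) by (rule rk_eq) (simp add: D'_def)
  moreover have "D' \<in> divisors G" by (simp add: divisors_def D'_def)
  moreover have "deg G D' = d" using D(1) by (simp add: deg_def dg_def D'_def)
  ultimately show "gon r G \<le> d" using gon_attained(2)[OF mgraph, of D' r] rank_iff_rk by simp
qed

end

theorem gonality_sequence_determined:
  assumes "is_mgraph G" "is_mgraph G'" "genus G = genus G'" "genus G \<le> 5" "gon 1 G = gon 1 G'" "1 \<le> r"
  shows "gon r G = gon r G'"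
proof -
  interpret G: multigraph G by unfold_locales fact
  interpret H: multigraph G' by unfold_locales fact
  have "G.has d r = H.has d r" for d
  proof (rule has_determined[OF G.chip_graph_axioms H.chip_graph_axioms])
    show "G.has d 1 = H.has d 1" for d using G.gon_le_iff[of 1 d] H.gon_le_iff[of 1 d] assms(5) by simp
  qed (use assms G.genus_gen H.genus_gen in auto)
  then have "gon r G \<le> d \<longleftrightarrow> gon r G' \<le> d" for d using G.gon_le_iff H.gon_le_iff by simp
  then show ?thesis by (meson order_antisym order_refl)
qed

subsection \<open>Paths with multiple edges\<close>

definition mpath :: "nat \<Rightarrow> (nat \<Rightarrow> nat) \<Rightarrow> nat mgraph" where
  "mpath n m = \<lparr>verts = {..<n}, edges = (\<Sum>i<n - 1. replicate_mset (m i) {i, Suc i})\<rparr>"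

lemma count_mpath:
  "count (edges (mpath n m)) {x, y} =
     (if y = Suc x \<and> y < n then m x else if x = Suc y \<and> x < n then m y else 0)"
proof -
  have "count (edges (mpath n m)) {x, y} = (\<Sum>i<n - 1. if {i, Suc i} = {x, y} then m i else 0)"
    by (auto simp: mpath_def count_sum intro!: sum.cong)
  also have "\<dots> = (\<Sum>i<n - 1. if y = Suc x \<and> i = x then m x else if x = Suc y \<and> i = y then m y else 0)"
    by (intro sum.cong refl) (auto simp: doubleton_eq_iff)
  also have "\<dots> = (\<Sum>i<n - 1. (if i = x then if y = Suc x then m x else 0 else 0) + (if i = y then if x = Suc y then m y else 0 else 0))"
    by (intro sum.cong refl) auto
  also have "\<dots> = (if y = Suc x \<and> y < n then m x else if x = Suc y \<and> x < n then m y else 0)"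
    unfolding sum.distrib by auto
  finally show ?thesis .
qed

lemma wt_mpath:
  "wt (mpath n m) x y =
     (if y = Suc x \<and> y < n then int (m x) else if x = Suc y \<and> x < n then int (m y) else 0)"
  by (simp add: wt_def count_mpath)

locale multipath =
  fixes n :: nat and m :: "nat \<Rightarrow> nat"
  assumes n_pos: "1 \<le> n" and m_pos: "1 \<le> m i"
begin

lemma is_mgraph_mpath: "is_mgraph (mpath n m)"
proof -
  let ?R = "{(x, y). {x, y} \<in># edges (mpath n m)}"
  have step: "(i, Suc i) \<in> ?R" "(Suc i, i) \<in> ?R" if "Suc i < n" for i
    using that m_pos[of i] count_mpath[of n m i "Suc i"] count_greater_zero_iff[of "edges (mpath n m)" "{i, Suc i}"]
    by (auto simp: insert_commute)
  have up: "(0, i) \<in> ?R\<^sup>*" if "i < n" for i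
    using that
  proof (induction i)
    case (Suc i)
    then show ?case using rtrancl_into_rtrancl[OF _ step(1)] by simp
  qed simp
  have down: "(i, 0) \<in> ?R\<^sup>*" if "i < n" for i
    using that
  proof (induction i)
    case (Suc i)
    then show ?case using converse_rtrancl_into_rtrancl[OF step(2)] by simp
  qed simp
  have "connected_mgraph (mpath n m)"
    unfolding connected_mgraph_def
  proof (intro ballI)
    fix u v assume "u \<in> verts (mpath n m)" "v \<in> verts (mpath n m)"
    then have "(u, 0) \<in> ?R\<^sup>*" "(0, v) \<in> ?R\<^sup>*" using up down by (auto simp: mpath_def)
    then show "(u, v) \<in> ?R\<^sup>*" by (rule rtrancl_trans)
  qed
  moreover have "e \<subseteq> verts (mpath n m) \<and> card e = 2" if "e \<in># edges (mpath n m)" for e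
  proof -
    have "e \<in> (\<Union>i<n - 1. set_mset (replicate_mset (m i) {i, Suc i}))"
      using that by (simp only: mpath_def mgraph.simps set_mset_sum finite_lessThan)
    then obtain i where "i < n - 1" "e = {i, Suc i}" by (auto split: if_splits)
    then show ?thesis by (auto simp: mpath_def)
  qed
  moreover have "finite (verts (mpath n m))" "verts (mpath n m) \<noteq> {}"
    using n_pos by (auto simp: mpath_def lessThan_empty_iff)
  ultimately show ?thesis by (simp add: is_mgraph_def)
qed

sublocale M: multigraph "mpath n m"
  by unfold_locales (rule is_mgraph_mpath)

lemma verts_mpath: "verts (mpath n m) = {..<n}"
  by (simp add: mpath_def)

lemma in_verts_mpath [simp]: "v \<in> verts (mpath n m) \<longleftrightarrow> v < n"
  by (simp add: verts_mpath)

lemma genus_mpath: "genus (mpath n m) = (\<Sum>i<n - 1. int (m i)) - int n + 1"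
  by (simp add: genus_def mpath_def size_multiset_sum)

lemma initial_segment_flow:
  assumes "Suc i < n"
  shows "(\<Sum>v\<in>{..i}. M.lap f v) = int (m i) * (f i - f (Suc i))"
proof -
  have "(\<Sum>v\<in>{..i}. M.lap f v) = (\<Sum>v\<in>{..i}. \<Sum>u\<in>{..<n} - {..i}. wt (mpath n m) v u * (f v - f u))"
    using M.sum_lap[of "{..i}" f] assms by (simp add: verts_mpath subset_eq)
  also have "\<dots> = (\<Sum>v\<in>{..i}. \<Sum>u\<in>{..<n} - {..i}. if u = Suc i then (if v = i then int (m i) * (f i - f (Suc i)) else 0) else 0)"
    by (intro sum.cong refl) (auto simp: wt_mpath)
  also have "\<dots> = int (m i) * (f i - f (Suc i))" using assms by simp
  finally show ?thesis .
qed

lemma sim_dvd: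
  assumes "M.sim A B" "Suc i < n"
  shows "int (m i) dvd sum A {..i} - sum B {..i}"
proof -
  obtain f where f: "\<And>v. v < n \<Longrightarrow> A v - B v = M.lap f v"
    using assms(1) unfolding M.sim_def in_verts_mpath[symmetric] by blast
  have "sum A {..i} - sum B {..i} = (\<Sum>v\<in>{..i}. M.lap f v)"
    unfolding sum_subtractf[symmetric] using f assms(2) by (intro sum.cong) auto
  then show ?thesis using initial_segment_flow[OF assms(2)] by simp
qed

text \<open>Firing \<open>{..i}\<close> once sends a full bundle of chips to the next
  vertex.\<close>

lemma sim_step:
  assumes "Suc i < n"
  shows "M.sim (\<lambda>u. int (m i) * pt i u) (\<lambda>u. int (m i) * pt (Suc i) u)"
proof (rule M.simI[of _ _ "charf {..i}"])
  fix v assume v: "v \<in> verts (mpath n m)"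
  have "M.lap (charf {..i}) v = (\<Sum>u\<in>{..<n}. (if u = Suc i then (if v = i then int (m i) else 0) else 0)
      - (if u = i then (if v = Suc i then int (m i) else 0) else 0))"
    using v by (subst M.lap_def, intro sum.cong) (auto simp: verts_mpath wt_mpath charf_def)
  also have "\<dots> = (if v = i then int (m i) else 0) - (if v = Suc i then int (m i) else 0)"
    using assms by (simp add: sum_subtractf)
  finally show "int (m i) * pt i v - int (m i) * pt (Suc i) v = M.lap (charf {..i}) v"
    by (simp add: pt_def)
qed

lemma sim_chain:
  assumes "a \<le> b" "b < n" "\<And>j. a \<le> j \<Longrightarrow> j < b \<Longrightarrow> int (m j) = k"
  shows "M.sim (\<lambda>u. k * pt a u) (\<lambda>u. k * pt b u)"
  using assms
proof (induction b rule: dec_induct)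
  case (step b)
  then have "M.sim (\<lambda>u. k * pt a u) (\<lambda>u. k * pt b u)" by simp
  moreover have "M.sim (\<lambda>u. k * pt b u) (\<lambda>u. k * pt (Suc b) u)"
    using sim_step[of b] step by simp
  ultimately show ?case by (rule M.sim_trans)
qed simp

end

section \<open>Paths of triple and double edges\<close>

definition triple_double :: "nat \<Rightarrow> nat \<Rightarrow> nat" where
  "triple_double t i = (if i < t then 3 else 2)"

locale triple_double_path =
  fixes n t :: nat
  assumes t_less: "t < n"
begin

sublocale multipath n "triple_double t"
  using t_less by unfold_locales (auto simp: triple_double_def)

abbreviation "P \<equiv> mpath n (triple_double t)"

lemma triple_sim: "a \<le> t \<Longrightarrow> M.sim (\<lambda>u. 3 * pt t u) (\<lambda>u. 3 * pt a u)"
  using sim_chain[of a t 3] t_less by (intro M.sim_sym[of "\<lambda>u. 3 * pt a u"]) (simp add: triple_double_def)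

lemma double_sim: "t \<le> b \<Longrightarrow> b < n \<Longrightarrow> M.sim (\<lambda>u. 2 * pt t u) (\<lambda>u. 2 * pt b u)"
  using sim_chain[of t b 2] by (simp add: triple_double_def)

lemma dg_multiple_pt: "M.dg (\<lambda>u. k * pt t u) = k"
  unfolding M.dg_def using t_less by (simp add: pt_def verts_mpath sum_distrib_left[symmetric])

lemma genus_P: "genus P = int n - 1 + int t"
proof -
  have "(\<Sum>i<n - 1. int (triple_double t i)) = (\<Sum>i<n - 1. 2 + (if i < t then 1 else 0))"
    by (intro sum.cong) (auto simp: triple_double_def)
  also have "\<dots> = 2 * int (n - 1) + int (card ({..<n - 1} \<inter> {i. i < t}))"
    by (simp add: sum.distrib sum.If_cases)
  also have "{..<n - 1} \<inter> {i. i < t} = {..<t}" using t_less by auto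
  finally show ?thesis using n_pos by (simp add: genus_mpath)
qed

text \<open>At vertex \<open>t\<close> the two kinds of bundles meet: three chips travel left
  together, or two travel right while the third stays.\<close>

lemma has_3_1: "M.has 3 1"
proof -
  have "M.rk (\<lambda>u. 3 * pt t u) 1"
    unfolding M.rk_1 M.eeff_diff_iff
  proof
    fix x assume x: "x \<in> verts P"
    show "\<exists>F. M.sim (\<lambda>u. 3 * pt t u) F \<and> (\<forall>v\<in>verts P. pt x v \<le> F v)"
    proof (cases "x \<le> t")
      case True
      then show ?thesis using triple_sim by (intro exI[of _ "\<lambda>u. 3 * pt x u"]) (auto simp: pt_def)
    next
      case False
      have "M.sim (\<lambda>u. 3 * pt t u) (pt t + (\<lambda>u. 2 * pt x u))"
        by (rule M.sim_eq[OF M.sim_add[OF M.sim_refl[of "pt t"] double_sim[of x]]]) (use False x in auto)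
      then show ?thesis by (intro exI[of _ "pt t + (\<lambda>u. 2 * pt x u)"]) (auto simp: pt_def)
    qed
  qed
  then show ?thesis using dg_multiple_pt M.has_def by blast
qed

lemma mod_initial_segment:
  assumes "M.sim A B" "i < t"
  shows "sum A {..i} mod 3 = sum B {..i} mod 3"
  using sim_dvd[OF assms(1), of i] assms(2) t_less by (simp add: mod_eq_dvd_iff triple_double_def)

lemma initial_segment_le_dg:
  assumes "M.eff R" "i < n"
  shows "sum R {..i} \<le> M.dg R"
  unfolding M.dg_def using assms by (intro sum_mono2) (auto simp: M.eff_def)

lemma rk1_representative:
  assumes "M.rk D 1" "a < n"
  obtains R where "M.sim D R" "M.eff R" "1 \<le> R a"
proof -
  obtain R where R: "M.sim D R" "\<forall>v\<in>verts P. pt a v \<le> R v"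
    using assms unfolding M.rk_1 M.eeff_diff_iff in_verts_mpath[symmetric] by blast
  have "M.eff R"
    unfolding M.eff_def
  proof
    fix v assume "v \<in> verts P"
    then have "pt a v \<le> R v" using R(2) by blast
    then show "0 \<le> R v" by (simp add: pt_def split: if_splits)
  qed
  moreover have "1 \<le> R a" using bspec[OF R(2), of a] assms(2) by (simp add: pt_def)
  ultimately show ?thesis using that R(1) by blast
qed

end

lemma gonality_path_one:
  assumes "3 \<le> n"
  defines "G \<equiv> mpath n (triple_double (Suc 0))"
  shows "is_mgraph G" "genus G = int n" "gon 1 G = 3" "gon 2 G \<le> 5"
proof -
  interpret triple_double_path n "Suc 0" by unfold_locales (use assms in simp)
  show "is_mgraph G" unfolding G_def by (rule is_mgraph_mpath)
  show "genus G = int n" unfolding G_def using genus_P by simp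
  have "\<not> M.has 2 1"
  proof
    assume "M.has 2 1"
    then obtain D where D: "M.dg D = 2" "M.rk D 1" by (auto simp: M.has_def)
    obtain R0 where R0: "M.sim D R0" "M.eff R0" "1 \<le> R0 0" using rk1_representative[OF D(2), of 0] assms by auto
    obtain R1 where R1: "M.sim D R1" "M.eff R1" "1 \<le> R1 1" using rk1_representative[OF D(2), of 1] assms by auto
    obtain R2 where R2: "M.sim D R2" "M.eff R2" "1 \<le> R2 2" using rk1_representative[OF D(2), of 2] assms by auto
    have mod3: "R0 0 mod 3 = R1 0 mod 3" "R0 0 mod 3 = R2 0 mod 3"
      using mod_initial_segment[OF M.sim_trans[OF M.sim_sym[OF R0(1)] R1(1)], of 0]
        mod_initial_segment[OF M.sim_trans[OF M.sim_sym[OF R0(1)] R2(1)], of 0] by simp_all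
    have mod2: "2 dvd R1 0 + R1 1 - (R2 0 + R2 1)"
      using sim_dvd[OF M.sim_trans[OF M.sim_sym[OF R1(1)] R2(1)], of 1] assms by (simp add: triple_double_def)
    have le: "R 0 + R 1 + R 2 \<le> 2 \<and> 0 \<le> R 0 \<and> 0 \<le> R 1 \<and> 0 \<le> R 2" if "M.sim D R" "M.eff R" for R
      using initial_segment_le_dg[OF that(2), of 2] M.sim_dg[OF that(1)] D(1) that(2) assms
      by (simp add: M.eff_def numeral_2_eq_2)
    \<comment> \<open>With two chips in all, the residue modulo 3 at vertex 0 can only be 1. The
      first two vertices then carry 2 chips in \<open>R1\<close> but 1 in \<open>R2\<close>, against
      parity across the double bundle.\<close>
    have "R1 0 = 1 \<and> R1 1 = 1" using le[OF R0(1,2)] le[OF R1(1,2)] R0(3) R1(3) mod3(1) by presburger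
    moreover have "R2 0 = 1 \<and> R2 1 = 0" using le[OF R0(1,2)] le[OF R2(1,2)] R0(3) R2(3) mod3(2) by presburger
    ultimately show False using mod2 by simp
  qed
  then show "gon 1 G = 3"
    using M.gon_le_iff[of 1 3] M.gon_le_iff[of 1 2] has_3_1 by (simp add: G_def)
  have "M.rk (\<lambda>u. 5 * pt (Suc 0) u) 2"
    unfolding M.rk_2
  proof (intro ballI)
    have close: "M.eeff ((\<lambda>u. 5 * pt (Suc 0) u) - pt x - pt y)"
      if "M.sim (\<lambda>u. 5 * pt (Suc 0) u) F" "\<And>v. pt x v + pt y v \<le> F v" for F x y
    proof -
      have "M.eeff ((\<lambda>u. 5 * pt (Suc 0) u) - (pt x + pt y))" unfolding M.eeff_diff_iff using that by auto
      then show ?thesis by (rule M.eeff_eq) simp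
    qed
    have at_zero: "M.eeff ((\<lambda>u. 5 * pt (Suc 0) u) - pt x - pt 0)" if "x < n" for x
    proof (cases "x = 0")
      case True
      have "M.sim (\<lambda>u. 5 * pt (Suc 0) u) ((\<lambda>u. 3 * pt 0 u) + (\<lambda>u. 2 * pt (Suc 0) u))"
        by (rule M.sim_eq[OF M.sim_add[OF triple_sim[of 0] M.sim_refl[of "\<lambda>u. 2 * pt (Suc 0) u"]]]) auto
      then show ?thesis by (rule close) (use True in \<open>simp add: pt_def\<close>)
    next
      case False
      have "M.sim (\<lambda>u. 5 * pt (Suc 0) u) ((\<lambda>u. 3 * pt 0 u) + (\<lambda>u. 2 * pt x u))"
        by (rule M.sim_eq[OF M.sim_add[OF triple_sim[of 0] double_sim[of x]]]) (use False that in auto)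
      then show ?thesis by (rule close) (simp add: pt_def)
    qed
    fix x y assume "x \<in> verts P" "y \<in> verts P"
    then have xy: "x < n" "y < n" by simp_all
    show "M.eeff ((\<lambda>u. 5 * pt (Suc 0) u) - pt x - pt y)"
    proof (cases "x = 0 \<or> y = 0")
      case True
      then show ?thesis
      proof
        assume "x = 0"
        then show ?thesis using M.eeff_eq[OF at_zero[OF xy(2)]] by simp
      qed (use at_zero[OF xy(1)] in simp)
    next
      case False
      \<comment> \<open>Away from vertex 0, two pairs travel independently and one chip stays
        behind.\<close>
      have "M.sim (\<lambda>u. 5 * pt (Suc 0) u) (pt (Suc 0) + ((\<lambda>u. 2 * pt x u) + (\<lambda>u. 2 * pt y u)))"
        by (rule M.sim_eq[OF M.sim_add[OF M.sim_refl[of "pt (Suc 0)"] M.sim_add[OF double_sim[of x] double_sim[of y]]]])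
          (use False xy in auto)
      then show ?thesis by (rule close) (simp add: pt_def)
    qed
  qed
  then show "gon 2 G \<le> 5"
    using M.gon_le_iff[of 2 5] dg_multiple_pt by (auto simp: G_def M.has_def)
qed

text \<open>The cells are the first three vertices and the rest of the path; \<open>x\<close> counts
  their chips. Two cells of residue 0 cannot both be occupied, as that takes 6 chips. So at most one
  residue is 0, and the residues sum to at least 3, hence to 5. Then the counts are forced, and two
  chips in every cell would take 8.\<close>

lemma residues_not_all_pairs:
  fixes r :: "nat \<Rightarrow> int"
  assumes "\<And>a b. a < 4 \<Longrightarrow> b < 4 \<Longrightarrow>
    \<exists>x. (\<forall>i<4. x i mod 3 = r i \<and> pt a i + pt b i \<le> x i) \<and> x 0 + x 1 + x 2 + x 3 = 5"
  shows False
proof -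
  have rep: "\<exists>x. (\<forall>i<4. x i mod 3 = r i \<and> 0 \<le> x i \<and> r i \<le> x i) \<and> x 0 + x 1 + x 2 + x 3 = 5
      \<and> 1 \<le> x a \<and> 1 \<le> x b \<and> (a = b \<longrightarrow> 2 \<le> x a)" if ab: "a < 4" "b < 4" for a b
  proof -
    obtain x where x: "\<And>i. i < 4 \<Longrightarrow> x i mod 3 = r i" "\<And>i. i < 4 \<Longrightarrow> pt a i + pt b i \<le> x i"
      "x 0 + x 1 + x 2 + x 3 = 5" using assms[OF ab] by blast
    have "0 \<le> x i" if "i < 4" for i using x(2)[OF that] by (simp add: pt_def split: if_splits)
    moreover from this have "r i \<le> x i" if "i < 4" for i
      using x(1)[OF that] that zmod_le_nonneg_dividend by metis
    ultimately show ?thesis using x x(2)[of a] x(2)[of b] ab by (intro exI[of _ x]) (auto simp: pt_def split: if_splits)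
  qed
  have r0: "0 \<le> r i" if i: "i < 4" for i
    using rep[OF i i] i by (metis pos_mod_sign zero_less_numeral)
  obtain x where x: "\<And>i. i < 4 \<Longrightarrow> x i mod 3 = r i" "\<And>i. i < 4 \<Longrightarrow> 0 \<le> x i" "x 0 + x 1 + x 2 + x 3 = 5"
    using rep[of 0 0] by auto
  define k where "k = x 0 div 3 + x 1 div 3 + x 2 div 3 + x 3 div 3"
  have sum: "r 0 + r 1 + r 2 + r 3 = 5 - 3 * k"
    using x(1)[of 0] x(1)[of 1] x(1)[of 2] x(1)[of 3] x(3) unfolding k_def
    by (simp add: minus_mult_div_eq_mod[symmetric])
  have "0 \<le> k" unfolding k_def using x(2) by (simp add: pos_imp_zdiv_nonneg_iff)
  have "1 \<le> r a \<or> 1 \<le> r b" if ab: "a < 4" "b < 4" "a \<noteq> b" for a b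
  proof (rule ccontr)
    assume "\<not> (1 \<le> r a \<or> 1 \<le> r b)"
    then have z: "r a = 0" "r b = 0" using r0 ab by force+
    obtain x where x: "\<And>i. i < 4 \<Longrightarrow> x i mod 3 = r i" "\<And>i. i < 4 \<Longrightarrow> 0 \<le> x i" "x 0 + x 1 + x 2 + x 3 = 5"
      "1 \<le> x a" "1 \<le> x b" using rep[OF ab(1,2)] by blast
    have "3 \<le> x a" "3 \<le> x b" using x(1)[OF ab(1)] x(1)[OF ab(2)] z x(4,5) by presburger+
    moreover have "x a + x b \<le> sum x {..<4}"
      using sum_mono2[of "{..<4}" "{a, b}" x] x(2) ab by auto
    ultimately show False using x(3) by (simp add: eval_nat_numeral)
  qed
  from this[of 0 1] this[of 0 2] this[of 0 3] this[of 1 2] this[of 1 3] this[of 2 3]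
  have "3 \<le> r 0 + r 1 + r 2 + r 3" using r0[of 0] r0[of 1] r0[of 2] r0[of 3] by auto
  then have five: "r 0 + r 1 + r 2 + r 3 = 5" using sum \<open>0 \<le> k\<close> by presburger
  have "2 \<le> r a" if a: "a < 4" for a
  proof -
    obtain x where x: "\<And>i. i < 4 \<Longrightarrow> r i \<le> x i" "x 0 + x 1 + x 2 + x 3 = 5" "2 \<le> x a" using rep[OF a a] by blast
    have "r 0 = x 0 \<and> r 1 = x 1 \<and> r 2 = x 2 \<and> r 3 = x 3"
      using x(1)[of 0] x(1)[of 1] x(1)[of 2] x(1)[of 3] x(2) five by auto
    moreover have "a = 0 \<or> a = 1 \<or> a = 2 \<or> a = 3" using a by auto
    ultimately show ?thesis using x(3) by auto
  qed
  from this[of 0] this[of 1] this[of 2] this[of 3] show False using five by simp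
qed

lemma gonality_path_three:
  assumes "4 \<le> n"
  defines "H \<equiv> mpath n (triple_double 3)"
  shows "is_mgraph H" "genus H = int n + 2" "gon 1 H = 3" "5 < gon 2 H"
proof -
  interpret triple_double_path n 3 by unfold_locales (use assms in simp)
  show "is_mgraph H" unfolding H_def by (rule is_mgraph_mpath)
  show "genus H = int n + 2" unfolding H_def using genus_P by simp
  have mod3: "A i mod 3 = B i mod 3" if "M.sim A B" "i < 3" for A B i
  proof (cases i)
    case 0
    then show ?thesis using mod_initial_segment[OF that(1), of 0] by simp
  next
    case (Suc j)
    then have "(sum A {..j} + A i) mod 3 = (sum B {..j} + B i) mod 3" "sum A {..j} mod 3 = sum B {..j} mod 3"
      using mod_initial_segment[OF that(1), of i] mod_initial_segment[OF that(1), of j] that(2) by simp_all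
    from mod_diff_cong[OF this] show ?thesis by simp
  qed
  have "\<not> M.has 2 1"
  proof
    assume "M.has 2 1"
    then obtain D where D: "M.dg D = 2" "M.rk D 1" by (auto simp: M.has_def)
    have le: "R 0 + R 1 + R 2 \<le> 2 \<and> 0 \<le> R 0 \<and> 0 \<le> R 1 \<and> 0 \<le> R 2" if "M.sim D R" "M.eff R" for R
      using initial_segment_le_dg[OF that(2), of 2] M.sim_dg[OF that(1)] D(1) that(2) assms
      by (simp add: M.eff_def numeral_2_eq_2)
    obtain R where R: "M.sim D R" "M.eff R" using rk1_representative[OF D(2), of 0] assms by auto
    \<comment> \<open>Some representative has one or two chips on \<open>i\<close>, so the residue
      is nonzero and every effective representative has a chip there; three vertices exceed degree
      2.\<close>
    have "1 \<le> R i" if i: "i < 3" for i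
    proof -
      obtain S where S: "M.sim D S" "M.eff S" "1 \<le> S i" using rk1_representative[OF D(2), of i] assms i by auto
      have "i = 0 \<or> i = 1 \<or> i = 2" using i by auto
      then have "S i \<le> 2" "0 \<le> R i" using le[OF S(1,2)] le[OF R] by auto
      then show ?thesis
        using mod3[OF M.sim_trans[OF M.sim_sym[OF R(1)] S(1)] i] S(3) by presburger
    qed
    from this[of 0] this[of 1] this[of 2] show False using le[OF R] by simp
  qed
  then show "gon 1 H = 3"
    using M.gon_le_iff[of 1 3] M.gon_le_iff[of 1 2] has_3_1 by (simp add: H_def)
  have "\<not> M.has 5 2"
  proof
    assume "M.has 5 2"
    then obtain D where D: "M.dg D = 5" "M.rk D 2" by (auto simp: M.has_def)
    \<comment> \<open>The residues modulo 3 of the numbers of chips on each of the first three vertices, and on all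
      the others together, are invariants of the divisor class.\<close>
    define c where "c R i = (if i < 3 then R i else 5 - (R 0 + R 1 + R 2))" for R :: "nat \<Rightarrow> int" and i :: nat
    show False
    proof (rule residues_not_all_pairs[of "\<lambda>i. c D i mod 3"])
      fix a b :: nat assume ab: "a < 4" "b < 4"
      have "M.eeff (D - pt a - pt b)" using D(2) ab assms unfolding M.rk_2 by simp
      then have "M.eeff (D - (pt a + pt b))" by (rule M.eeff_eq) simp
      then obtain R where R: "M.sim D R" "\<forall>v\<in>verts P. (pt a + pt b) v \<le> R v"
        unfolding M.eeff_diff_iff by blast
      have "c R i mod 3 = c D i mod 3" for i
      proof (cases "i < 3")
        case False
        have "D 0 mod 3 = R 0 mod 3" "D 1 mod 3 = R 1 mod 3" "D 2 mod 3 = R 2 mod 3"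
          using mod3[OF R(1)] by simp_all
        then have "(5 - (R 0 + R 1 + R 2)) mod 3 = (5 - (D 0 + D 1 + D 2)) mod 3"
          by (intro mod_diff_cong mod_add_cong) simp_all
        then show ?thesis using False by (simp only: c_def if_False)
      qed (use mod3[OF R(1), of i] in \<open>simp add: c_def\<close>)
      moreover have "pt a i + pt b i \<le> c R i" if i: "i < 4" for i
      proof (cases "i < 3")
        case False
        \<comment> \<open>Vertex 3 stands for the last cell, whose other vertices carry no
          debt.\<close>
        have "0 \<le> R v" if "v \<in> verts P" for v
          using bspec[OF R(2) that] by (simp add: pt_def split: if_splits)
        then have "M.eff R" by (simp add: M.eff_def)
        then have "sum R {..3} \<le> 5"
          using initial_segment_le_dg[of R 3] M.sim_dg[OF R(1)] D(1) assms by simp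
        then have "R 3 \<le> c R 3" by (simp add: c_def eval_nat_numeral)
        moreover have "i = 3" using False i by simp
        ultimately show ?thesis using bspec[OF R(2), of 3] assms by simp
      qed (use bspec[OF R(2), of i] assms in \<open>simp add: c_def\<close>)
      ultimately show "\<exists>x. (\<forall>i<4. x i mod 3 = c D i mod 3 \<and> pt a i + pt b i \<le> x i) \<and> x 0 + x 1 + x 2 + x 3 = 5"
        by (intro exI[of _ "c R"]) (simp add: c_def)
    qed
  qed
  then show "5 < gon 2 H" using M.gon_le_iff[of 2 5] by (simp add: H_def)
qed

theorem theorem1p4:
  fixes g :: int
  assumes "g \<ge> 0"
  shows "(g \<le> 5 \<longrightarrow>
            (\<forall>(G :: 'a mgraph) (G' :: 'b mgraph).
               is_mgraph G \<and> is_mgraph G' \<and> genus G = g \<and> genus G' = g \<and> gon 1 G = gon 1 G'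
               \<longrightarrow> (\<forall>r\<ge>1. gon r G = gon r G')))
       \<and> (g \<ge> 6 \<longrightarrow>
            (\<exists>(G :: nat mgraph) (H :: nat mgraph).
               is_mgraph G \<and> is_mgraph H \<and> genus G = g \<and> genus H = g \<and> gon 1 G = gon 1 H
               \<and> \<not> (\<forall>r\<ge>1. gon r G = gon r H)))"
proof (intro conjI impI allI)
  fix G :: "'a mgraph" and G' :: "'b mgraph" and r :: nat
  assume "g \<le> 5" "is_mgraph G \<and> is_mgraph G' \<and> genus G = g \<and> genus G' = g \<and> gon 1 G = gon 1 G'" "1 \<le> r"
  then show "gon r G = gon r G'" using gonality_sequence_determined[of G G' r] by simp
next
  assume g: "6 \<le> g"
  \<comment> \<open>A path of double bundles on n vertices has genus n - 1 and each triple bundle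
    adds 1, so the second path has two vertices fewer. From g = 6 on it has the four vertices needed
    for four cells.\<close>
  let ?G = "mpath (nat g) (triple_double (Suc 0))" and ?H = "mpath (nat g - 2) (triple_double 3)"
  have n: "3 \<le> nat g" "4 \<le> nat g - 2" using g by simp_all
  note G = gonality_path_one[OF n(1)] and H = gonality_path_three[OF n(2)]
  have "genus ?G = g" "genus ?H = g" using G(2) H(2) g by simp_all
  moreover have "\<not> (\<forall>r\<ge>1. gon r ?G = gon r ?H)"
  proof
    assume "\<forall>r\<ge>1. gon r ?G = gon r ?H"
    then have "gon 2 ?G = gon 2 ?H" by simp
    then show False using G(4) H(4) by simp
  qed
  ultimately show "\<exists>(G :: nat mgraph) (H :: nat mgraph).
      is_mgraph G \<and> is_mgraph H \<and> genus G = g \<and> genus H = g \<and> gon 1 G = gon 1 H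
      \<and> \<not> (\<forall>r\<ge>1. gon r G = gon r H)"
    using G(1,3) H(1,3) by metis
qed

end
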